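(* Let $d\ge1$, let $a,b,o\in C^\infty(\mathbb{T}^{2d})$ with $a,b$ real-valued, and for $N\in\mathbb{N}$, $N\ge 1$, put $h=\frac{1}{2\pi N}$ (so $0<h\le 1$). Let $A=\mathrm{op}_N(a)$, $B=\mathrm{op}_N(b)$, $O=\mathrm{op}_N(o)$ be their quantizations as operators $H_N\to H_N$, and let $H=A+B$. Let $t>0$, $n\in\mathbb{N}$ with $n\ge 1$, $t=ns$, and define $$T(t):=e^{\mathrm{i}Ht/h}\,O\,e^{-\mathrm{i}Ht/h},\qquad T_{1,n}(s):=\big(e^{\mathrm{i}As/h}e^{\mathrm{i}Bs/h}\big)^n\,O\,\big(e^{-\mathrm{i}Bs/h}e^{-\mathrm{i}As/h}\big)^n.$$ Then $$\|T_{1,n}(s)-T(t)\|\le C_t\,s$$ for some constant $C_t$ (depending on $t$) independent of $n$ and $h$ (equivalently, of $n$ and $N$), where $\|\cdot\|$ is the operator norm on $H_N$.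
   Context: $\mathbb{T}=\mathbb{R}/\mathbb{Z}$. For $N\in\mathbb{N}$ let $H_N$ be the $N^d$-dimensional space of tempered distributions on $\mathbb{R}^d$ spanned by $$Q_n=N^{-d/2}\sum_{k\in\mathbb{Z}^d}\delta_{x=k+\frac nN},\qquad n\in\{0,1,\dots,N-1\}^d,$$ where $\delta_{x=y}$ is the Dirac distribution at $y$; $H_N$ is made a Hilbert space by declaring $(Q_n)$ to be an orthonormal basis. Thus operators on $H_N$ are $N^d\times N^d$ matrices in the basis $(Q_n)$, and the operator norm on $H_N$ is the spectral ($\ell^2\to\ell^2$) norm of the matrix. For $a\in C^\infty(\mathbb{T}^{2d})$, let $\tilde a$ be its lift to a $\mathbb{Z}^{2d}$-periodic smooth function on $T^*\mathbb{R}^d=\mathbb{R}^{2d}$. With $h=\frac1{2\pi N}$, set $\mathrm{op}_N(a):=\mathrm{op}_h(\tilde a)|_{H_N}$, which maps $H_N$ to itself, where $\mathrm{op}_h$ is the semiclassical Weyl quantization $$(\mathrm{op}_h(\tilde a)u)(x)=\frac{1}{(2\pi h)^d}\iint_{\mathbb{R}^{2d}}e^{\frac{\mathrm{i}}{h}\langle x-y,\xi\rangle}\tilde a\Big(\frac{x+y}{2},\xi\Big)u(y)\,dy\,d\xi ,$$ extended by duality to tempered distributions. *)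

theory Defs
  imports "HOL-Analysis.Analysis"
begin

section \<open>Smooth and Schwartz functions\<close>

text \<open>For \<open>vs\<close> a list of basis vectors, \<open>partials vs f\<close> is the iterated partial derivative
  \<open>\<partial>\<^sup>\<alpha> f\<close>, where \<open>\<alpha>\<close> counts the occurrences of each basis vector.\<close>

primrec partials ::
  "'a::euclidean_space list \<Rightarrow> ('a \<Rightarrow> 'b::real_normed_vector) \<Rightarrow> 'a \<Rightarrow> 'b" where
  "partials [] f = f"
| "partials (v # vs) f = (\<lambda>x. frechet_derivative (partials vs f) (at x) v)"

text \<open>Differentiability of all iterated partial derivatives gives their continuity as well,
  so this is \<open>C\<^sup>\<infinity>\<close> in the real sense.\<close>

definition smooth :: "('a::euclidean_space \<Rightarrow> 'b::real_normed_vector) \<Rightarrow> bool" where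
  "smooth f \<longleftrightarrow> (\<forall>vs x. set vs \<subseteq> Basis \<longrightarrow> partials vs f differentiable (at x))"

definition schwartz :: "('a::euclidean_space \<Rightarrow> complex) \<Rightarrow> bool" where
  "schwartz f \<longleftrightarrow> smooth f \<and>
     (\<forall>m::nat. \<forall>vs. set vs \<subseteq> Basis \<longrightarrow> bounded (range (\<lambda>x. norm x ^ m * norm (partials vs f x))))"

text \<open>\<open>C\<^sup>\<infinity>(\<bbbT>\<^sup>2\<^sup>d)\<close>: a function on the torus is given by its lift to a smooth
  \<open>\<int>\<^sup>2\<^sup>d\<close>-periodic function of \<open>(x, \<xi>)\<close>.\<close>

definition torus_smooth :: "((real^'d) \<times> (real^'d) \<Rightarrow> complex) \<Rightarrow> bool" where
  "torus_smooth a \<longleftrightarrow> smooth a \<and>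
     (\<forall>x \<xi>. \<forall>k l :: int^'d. a (x + (\<chi> i. of_int (k $ i)), \<xi> + (\<chi> i. of_int (l $ i))) = a (x, \<xi>))"


section \<open>Weyl quantization\<close>

text \<open>Distributions are functionals on Schwartz functions. As the underlying HOL type also
  contains other test functions, every distribution below is set to \<open>0\<close> on those, so that
  equality of functionals is equality as distributions.\<close>

type_synonym 'd distr = "(real^'d \<Rightarrow> complex) \<Rightarrow> complex"

text \<open>The double integral is an iterated one, first in \<open>y\<close> and then in \<open>\<xi>\<close>. For a smooth
  periodic symbol and Schwartz \<open>u\<close> the inner integral decays rapidly in \<open>\<xi>\<close> (integrate by
  parts in \<open>y\<close>), so that both integrals converge absolutely, whereas the joint integrand is
  in general not integrable on the product space.\<close>

definition weyl ::
  "real \<Rightarrow> ((real^'d) \<times> (real^'d) \<Rightarrow> complex) \<Rightarrow> (real^'d \<Rightarrow> complex) \<Rightarrow> real^'d \<Rightarrow> complex" where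
  "weyl h a u x = complex_of_real (1 / (2 * pi * h) ^ CARD('d)) *
     (LINT \<xi>|lborel. LINT y|lborel.
        exp (\<i> / complex_of_real h * complex_of_real ((x - y) \<bullet> \<xi>)) *
        a ((1/2) *\<^sub>R (x + y), \<xi>) * u y)"

text \<open>Extension by duality, with respect to the bilinear pairing \<open>\<integral> u \<phi>\<close>.\<close>

definition transposed ::
  "((real^'d \<Rightarrow> complex) \<Rightarrow> (real^'d \<Rightarrow> complex)) \<Rightarrow> (real^'d \<Rightarrow> complex) \<Rightarrow> (real^'d \<Rightarrow> complex)" where
  "transposed P \<phi> = (THE \<psi>. schwartz \<psi> \<and>
     (\<forall>u. schwartz u \<longrightarrow> (LINT x|lborel. P u x * \<phi> x) = (LINT x|lborel. u x * \<psi> x)))"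

definition extend_by_duality ::
  "((real^'d \<Rightarrow> complex) \<Rightarrow> (real^'d \<Rightarrow> complex)) \<Rightarrow> 'd distr \<Rightarrow> 'd distr" where
  "extend_by_duality P u = (\<lambda>\<phi>. if schwartz \<phi> then u (transposed P \<phi>) else 0)"

definition op_h :: "real \<Rightarrow> ((real^'d) \<times> (real^'d) \<Rightarrow> complex) \<Rightarrow> 'd distr \<Rightarrow> 'd distr" where
  "op_h h a = extend_by_duality (weyl h a)"


section \<open>The spaces \<open>H\<^sub>N\<close>\<close>

definition idx :: "nat \<Rightarrow> (nat^'d) set" where
  "idx N = {n. \<forall>i. n $ i < N}"

definition Q :: "nat \<Rightarrow> nat^'d \<Rightarrow> 'd distr" where
  "Q N n = (\<lambda>\<phi>. if schwartz \<phi>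
     then complex_of_real (real N powr (- real CARD('d) / 2)) *
       (\<Sum>\<^sub>\<infinity>k\<in>(UNIV :: (int^'d) set). \<phi> (\<chi> i. of_int (k $ i) + of_nat (n $ i) / of_nat N))
     else 0)"

definition lincomb :: "nat \<Rightarrow> (nat^'d \<Rightarrow> complex) \<Rightarrow> 'd distr" where
  "lincomb N c = (\<lambda>\<phi>. \<Sum>n\<in>idx N. c n * Q N n \<phi>)"

definition HN :: "nat \<Rightarrow> ('d::finite) distr set" where
  "HN N = range (lincomb N)"

definition coords :: "nat \<Rightarrow> ('d::finite) distr \<Rightarrow> nat^'d \<Rightarrow> complex" where
  "coords N u = (THE c. (\<forall>n. n \<notin> idx N \<longrightarrow> c n = 0) \<and> u = lincomb N c)"

definition HN_inner :: "nat \<Rightarrow> ('d::finite) distr \<Rightarrow> 'd distr \<Rightarrow> complex" where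
  "HN_inner N u v = (\<Sum>n\<in>idx N. coords N u n * cnj (coords N v n))"

definition HN_norm :: "nat \<Rightarrow> ('d::finite) distr \<Rightarrow> real" where
  "HN_norm N u = sqrt (Re (HN_inner N u u))"


section \<open>Operators on \<open>H\<^sub>N\<close>\<close>

text \<open>Only the values of an operator on \<open>HN N\<close> matter.\<close>

definition op_N ::
  "nat \<Rightarrow> ((real^'d) \<times> (real^'d) \<Rightarrow> complex) \<Rightarrow> 'd distr \<Rightarrow> 'd distr" where
  "op_N N a = restrict (op_h (1 / (2 * pi * real N)) a) (HN N)"

definition op_plus ::
  "('d distr \<Rightarrow> 'd distr) \<Rightarrow> ('d distr \<Rightarrow> 'd distr) \<Rightarrow> 'd distr \<Rightarrow> 'd distr" where
  "op_plus A B = (\<lambda>u \<phi>. A u \<phi> + B u \<phi>)"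

definition op_minus ::
  "('d distr \<Rightarrow> 'd distr) \<Rightarrow> ('d distr \<Rightarrow> 'd distr) \<Rightarrow> 'd distr \<Rightarrow> 'd distr" where
  "op_minus A B = (\<lambda>u \<phi>. A u \<phi> - B u \<phi>)"

text \<open>\<open>e\<^sup>z\<^sup>A\<close> by its power series. The series is summed pointwise on test functions; as
  \<open>H\<^sub>N\<close> is finite-dimensional, on it this is the same as convergence in norm.\<close>

definition op_exp :: "complex \<Rightarrow> ('d distr \<Rightarrow> 'd distr) \<Rightarrow> 'd distr \<Rightarrow> 'd distr" where
  "op_exp z A = (\<lambda>u \<phi>. \<Sum>k. z ^ k / fact k * (A ^^ k) u \<phi>)"

definition op_norm :: "nat \<Rightarrow> (('d::finite) distr \<Rightarrow> 'd distr) \<Rightarrow> real" where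
  "op_norm N A = Sup {HN_norm N (A u) |u. u \<in> HN N \<and> HN_norm N u \<le> 1}"


section \<open>Exact and Trotterized evolution of an observable\<close>

definition exact_evol ::
  "real \<Rightarrow> ('d distr \<Rightarrow> 'd distr) \<Rightarrow> ('d distr \<Rightarrow> 'd distr) \<Rightarrow> real \<Rightarrow> 'd distr \<Rightarrow> 'd distr" where
  "exact_evol h H Ob t =
     op_exp (\<i> * of_real (t / h)) H \<circ> Ob \<circ> op_exp (- (\<i> * of_real (t / h))) H"

definition trotter_evol ::
  "real \<Rightarrow> ('d distr \<Rightarrow> 'd distr) \<Rightarrow> ('d distr \<Rightarrow> 'd distr) \<Rightarrow> ('d distr \<Rightarrow> 'd distr) \<Rightarrow>
   nat \<Rightarrow> real \<Rightarrow> 'd distr \<Rightarrow> 'd distr" where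
  "trotter_evol h A B Ob n s =
     ((op_exp (\<i> * of_real (s / h)) A \<circ> op_exp (\<i> * of_real (s / h)) B) ^^ n) \<circ> Ob \<circ>
     ((op_exp (- (\<i> * of_real (s / h))) B \<circ> op_exp (- (\<i> * of_real (s / h))) A) ^^ n)"

end

theory Submission
  imports Defs "HOL-Probability.Probability" "HOL-Library.Diagonal_Subsequence"
begin

text \<open>A smooth symbol on the torus is a rapidly convergent Fourier series, and the quantization of
  the exponential with frequency \<open>m = (k, l)\<close> is the unitary \<open>U\<^sub>m = e\<^sup>2\<^sup>\<pi>\<^sup>i\<^sup>k\<^sup>x\<close> times the translation by
  \<open>l / N\<close>, up to a phase. These satisfy \<open>U\<^sub>m U\<^sub>m\<^sub>' = e\<^sup>2\<^sup>\<pi>\<^sup>i\<^sup>\<theta> U\<^sub>m\<^sub>' U\<^sub>m\<close> with \<open>\<bar>\<theta>\<bar> \<le> 2 \<bar>m\<bar> \<bar>m'\<bar> / N\<close>.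
  No symbol calculus is needed: the regularity of an operator \<open>X\<close> is measured by the least
  \<open>L\<close> with \<open>\<parallel>U\<^sub>m X U\<^sub>m\<^sup>-\<^sup>1 - X\<parallel> \<le> L (1 + \<bar>m\<bar>)\<close> for all \<open>m\<close>. For quantized observables it
  is \<open>O(1/N)\<close>. If \<open>Y\<close> has regularity \<open>L\<close>, then \<open>N\<^sup>2 \<parallel>[[A, B], Y]\<parallel> \<le> C N L\<close>, and along the flow of \<open>A / h\<close>
  the regularity grows at most exponentially in time, uniformly in \<open>N\<close>, by a
  Gronwall argument, since \<open>U\<^sub>m A U\<^sub>m\<^sup>-\<^sup>1 - A\<close> is \<open>1/N\<close> times an operator of the same kind. As
  the local error of the splitting is a time integral of the conjugated double commutators \<open>h\<^sup>-\<^sup>2 [[A, B], Y]\<close>,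
  with \<open>Y\<close> an evolved observable, it is \<open>O(s\<^sup>2)\<close>, and the \<open>n\<close> local errors add up
  because conjugation by unitaries is isometric.\<close>


section \<open>Commutator bounds and Trotter error in a Banach algebra\<close>

text \<open>Bounding \<open>[[A, B], Y] / h^2\<close> by norms alone leaves a factor
  \<open>N^2\<close>. The phase in the Weyl relation recovers one power of \<open>N\<close> from
  \<open>[A, B]\<close>. The other has to come from the commutator with \<open>Y\<close>, and
  \<open>Y\<close> is an evolved observable about whose symbol nothing is known; this is the place
  where Egorov's theorem would usually enter. The weight 1 + |m| fits because that phase is bilinear
  in the frequencies: a first-order condition on \<open>Y\<close> is reproduced by the flow, and
  each use of it costs one more power of |m| in a Fourier coefficient, which rapid decay absorbs.
  Two powers suffice for the Hamiltonians and one for the observable. The Gronwall argument needs a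
  finite regularity to start from, and every bounded operator has one, namely twice its norm. That
  value may be huge compared with \<open>1 / N\<close>, but it disappears from the final estimate,
  so only the regularity of the observable at time 0 remains. The powers of \<open>N\<close> then
  balance: \<open>1 / N\<close> from the observable, \<open>N\<close> from the double commutator of
  the rescaled generators, and none from the growth along the flows.\<close>

lemma norm_diff_le_vector_derivative:
  fixes f :: "real \<Rightarrow> 'a::real_normed_vector"
  assumes "0 \<le> t"
    and "\<And>x. 0 \<le> x \<Longrightarrow> x \<le> t \<Longrightarrow> (f has_vector_derivative f' x) (at x)"
    and "\<And>x. 0 \<le> x \<Longrightarrow> x \<le> t \<Longrightarrow> norm (f' x) \<le> B"
  shows "norm (f t - f 0) \<le> B * t"
proof -
  have "norm (f t - f 0) \<le> B * norm (t - 0)"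
  proof (rule differentiable_bound[where S = "{0..t}" and f' = "\<lambda>x y. y *\<^sub>R f' x"])
    show "(f has_derivative (\<lambda>y. y *\<^sub>R f' x)) (at x within {0..t})" if "x \<in> {0..t}" for x
      using assms(2)[of x] that
      by (auto simp: has_vector_derivative_def intro: has_derivative_at_withinI)
    show "onorm (\<lambda>y. y *\<^sub>R f' x) \<le> B" if "x \<in> {0..t}" for x
      using assms(3)[of x] that by (intro onorm_le) (auto simp: mult.commute[of B] intro: mult_left_mono)
  qed (use assms(1) in auto)
  thus ?thesis using assms(1) by simp
qed

section \<open>Commutators and conjugation flows in a Banach algebra\<close>

definition comm :: "'a \<Rightarrow> 'a \<Rightarrow> 'a::real_normed_algebra_1" where
  "comm X Y = X * Y - Y * X"

definition evol :: "'a \<Rightarrow> real \<Rightarrow> 'a \<Rightarrow> 'a::{real_normed_algebra_1,banach}" where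
  "evol a t X = exp (t *\<^sub>R a) * X * exp (t *\<^sub>R (- a))"

text \<open>The quantifier covers both signs of \<open>t\<close>, so an exponential and its inverse
  both contract and conjugation by them is isometric. This stands for skew-adjointness of
  \<open>a\<close> in an algebra without adjoints.\<close>

definition contr :: "'a::{real_normed_algebra_1,banach} \<Rightarrow> bool" where
  "contr a \<longleftrightarrow> (\<forall>t::real. norm (exp (t *\<^sub>R a)) \<le> 1)"

lemma norm_mult_le_left: "norm (x::'a::real_normed_algebra) \<le> 1 \<Longrightarrow> norm (x * y) \<le> norm y"
  using norm_mult_ineq[of x y] mult_right_mono[of "norm x" 1 "norm y"] by auto

lemma norm_mult_le_right: "norm (y::'a::real_normed_algebra) \<le> 1 \<Longrightarrow> norm (x * y) \<le> norm x"
  using norm_mult_ineq[of x y] mult_left_mono[of "norm y" 1 "norm x"] by auto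

lemma contr_minus: "contr a \<Longrightarrow> contr (- a)"
  unfolding contr_def
proof
  fix t :: real assume "\<forall>t::real. norm (exp (t *\<^sub>R a)) \<le> 1"
  from this[rule_format, of "-t"] show "norm (exp (t *\<^sub>R - a)) \<le> 1" by simp
qed

lemma norm_evol_le: assumes "contr a" shows "norm (evol a t X) \<le> norm X"
proof -
  have "norm (exp (t *\<^sub>R (- a))) \<le> 1" "norm (exp (t *\<^sub>R a)) \<le> 1"
    using assms contr_minus unfolding contr_def by blast+
  thus ?thesis unfolding evol_def
    by (meson norm_mult_le_left norm_mult_le_right order_trans)
qed

lemma exp_scaleR_add: "exp ((s + t) *\<^sub>R a) = exp (s *\<^sub>R a) * exp (t *\<^sub>R (a::'a::{real_normed_algebra_1,banach}))"
  by (simp add: scaleR_add_left exp_add_commuting)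

lemma exp_scaleR_minus: "exp (t *\<^sub>R a) * exp (t *\<^sub>R - (a::'a::{real_normed_algebra_1,banach})) = 1"
  "exp (t *\<^sub>R - a) * exp (t *\<^sub>R a) = 1"
  using exp_minus_inverse[of "t *\<^sub>R a"] exp_minus_inverse[of "- (t *\<^sub>R a)"] by simp_all

lemma evol_add: "evol a (s + t) X = evol a s (evol a t X)"
proof -
  have "exp ((s + t) *\<^sub>R - a) = exp (t *\<^sub>R - a) * exp (s *\<^sub>R - a)"
    by (metis exp_scaleR_add add.commute)
  thus ?thesis by (simp add: evol_def exp_scaleR_add mult.assoc)
qed

lemma evol_0 [simp]: "evol a 0 X = X"
  by (simp add: evol_def)

lemma evol_diff: "evol a t (X - Y) = evol a t X - evol a t Y"
  by (simp add: evol_def algebra_simps)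

lemma evol_plus: "evol a t (X + Y) = evol a t X + evol a t Y"
  by (simp add: evol_def algebra_simps)

lemma evol_mult: "evol a t (X * Y) = evol a t X * evol a t Y"
proof -
  have "evol a t X * evol a t Y = exp (t *\<^sub>R a) * X * (exp (t *\<^sub>R - a) * exp (t *\<^sub>R a)) * Y * exp (t *\<^sub>R - a)"
    unfolding evol_def by (simp only: mult.assoc)
  thus ?thesis unfolding exp_scaleR_minus by (simp add: evol_def mult.assoc)
qed

lemma evol_comm: "evol a t (comm X Y) = comm (evol a t X) (evol a t Y)"
  by (simp add: comm_def evol_diff evol_mult)

lemma evol_inverse: "evol a t (evol (- a) t X) = X"
proof -
  have "evol a t (evol (- a) t X) = (exp (t *\<^sub>R a) * exp (t *\<^sub>R - a)) * X * (exp (t *\<^sub>R a) * exp (t *\<^sub>R - a))"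
    unfolding evol_def by (simp only: mult.assoc minus_minus)
  thus ?thesis unfolding exp_scaleR_minus by simp
qed

lemma evol_inverse': "evol (- a) t (evol a t X) = X"
  using evol_inverse[of "- a"] by simp

lemma evol_self: "evol a t a = a"
proof -
  have "exp (t *\<^sub>R a) * a = a * exp (t *\<^sub>R a)"
    by (rule exp_times_scaleR_commute)
  hence "evol a t a = a * (exp (t *\<^sub>R a) * exp (t *\<^sub>R - a))" by (simp only: evol_def mult.assoc)
  thus ?thesis unfolding exp_scaleR_minus by simp
qed

text \<open>Because \<open>a\<close> commutes with its exponentials, it can be written on the inner
  side of each of them; next to \<open>F s\<close> the two contributions form a commutator.\<close>

lemma has_vector_derivative_evol:
  assumes "(F has_vector_derivative F') (at s)"
  shows "((\<lambda>s. evol a s (F s)) has_vector_derivative evol a s (comm a (F s) + F')) (at s)"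
proof -
  have 1: "((\<lambda>s. exp (s *\<^sub>R a)) has_vector_derivative exp (s *\<^sub>R a) * a) (at s)"
    by (rule exp_scaleR_has_vector_derivative_right)
  have 2: "((\<lambda>s. exp (s *\<^sub>R - a)) has_vector_derivative - a * exp (s *\<^sub>R - a)) (at s)"
    by (rule exp_scaleR_has_vector_derivative_left)
  show ?thesis unfolding evol_def
    by (rule has_vector_derivative_eq_rhs[OF has_vector_derivative_mult[OF has_vector_derivative_mult[OF 1 assms] 2]])
       (simp add: comm_def algebra_simps)
qed

section \<open>Regularity with respect to a family of conjugations, and its growth along a
  flow\<close>

locale conj_family =
  fixes U V :: "'m \<Rightarrow> 'a::{real_normed_algebra_1,banach}" and w :: "'m \<Rightarrow> real"
  assumes UV: "U m * V m = 1" and VU: "V m * U m = 1"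
    and norm_U: "norm (U m) \<le> 1" and norm_V: "norm (V m) \<le> 1"
    and w_ge_1: "1 \<le> w m"
begin

definition lip :: "real \<Rightarrow> 'a \<Rightarrow> bool" where
  "lip L X \<longleftrightarrow> (\<forall>m. norm (U m * X * V m - X) \<le> L * w m)"

text \<open>Conjugation by \<open>U m\<close> disturbs the flow of \<open>a\<close> through exactly
  this commutator with the evolved observable, so \<open>C\<close> bounds the exponential rate at
  which the regularity can grow.\<close>

definition tame :: "real \<Rightarrow> 'a \<Rightarrow> bool" where
  "tame C a \<longleftrightarrow> (\<forall>L Y m. lip L Y \<longrightarrow> norm (comm (V m * a * U m - a) Y) \<le> C * L * w m)"

lemma norm_conj_le: "norm (U m * X * V m) \<le> norm X"
  by (meson norm_mult_le_left norm_mult_le_right order_trans norm_U norm_V)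

lemma lip_nonneg: assumes "lip L X" shows "0 \<le> L"
proof (rule ccontr)
  assume "\<not> 0 \<le> L"
  hence "L * w m < 0" for m using w_ge_1[of m] by (simp add: mult_less_0_iff)
  moreover have "0 \<le> L * w m" for m using assms unfolding lip_def by (metis norm_ge_zero order_trans)
  ultimately show False by (meson not_le)
qed

text \<open>Conjugation does not increase the norm and the weights are at least 1. This crude value
  only serves to start the iteration along the flow.\<close>

lemma lip_trivial: "lip (2 * norm X) X"
  unfolding lip_def
proof
  fix m
  have "norm (U m * X * V m - X) \<le> 2 * norm X"
    using norm_triangle_ineq4[of "U m * X * V m" X] norm_conj_le[of m X] by linarith
  also have "\<dots> \<le> 2 * norm X * w m"
    using w_ge_1[of m] mult_left_mono[of 1 "w m" "2 * norm X"] by simp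
  finally show "norm (U m * X * V m - X) \<le> 2 * norm X * w m" .
qed

lemma lip_mono: assumes "lip L X" "L \<le> L'" shows "lip L' X"
  using assms w_ge_1 unfolding lip_def
  by (smt (verit, best) mult_right_mono)

text \<open>Interaction picture: \<open>G\<close> evolves the conjugated observable back in time, so
  the flow of \<open>a\<close> itself drops out of \<open>G'\<close> and only the commutator
  controlled by tameness is left. \<open>L\<close> is any bound already known on the whole interval;
  it is traded for one that is better when \<open>C * t\<close> is small.\<close>

lemma lip_evol_step:
  assumes "tame C a" "contr a" "lip L0 X" "0 \<le> t" "0 \<le> C"
    and L: "\<And>s. 0 \<le> s \<Longrightarrow> s \<le> t \<Longrightarrow> lip L (evol a s X)"
  shows "lip (L0 + C * L * t) (evol a t X)"
  unfolding lip_def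
proof
  fix m
  define T where "T s = evol a s X" for s
  define G where "G s = evol (- a) s (U m * T s * V m)" for s
  define G' where "G' s = evol (- a) s (comm (- a) (U m * T s * V m) + U m * comm a (T s) * V m)" for s
  have dT: "(T has_vector_derivative comm a (T s)) (at s)" for s
    using has_vector_derivative_evol[of "\<lambda>_. X" 0 s a]
    by (simp add: T_def [abs_def] evol_comm evol_self)
  have dG: "(G has_vector_derivative G' s) (at s)" for s
    unfolding G_def G'_def
    by (intro has_vector_derivative_evol)
       (rule bounded_linear.has_vector_derivative[OF _ dT,
          where f = "\<lambda>x. U m * x * V m"],
        intro bounded_linear_intros)
  have nG: "norm (G' s) \<le> C * L * w m" if "0 \<le> s" "s \<le> t" for s
  proof -
    \<comment> \<open>Pulling \<open>U m\<close> and \<open>V m\<close> outside turns the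
      \<open>a\<close> of the first commutator into \<open>V m * a * U m\<close>.\<close>
    have "comm (- a) (U m * T s * V m) + U m * comm a (T s) * V m
        = - (U m * comm (V m * a * U m - a) (T s) * V m)"
    proof -
      have e: "U m * (V m * x) = x" "V m * (U m * x) = x" for x
        using UV[of m] VU[of m] by (simp_all flip: mult.assoc)
      show ?thesis
        by (simp add: comm_def algebra_simps e UV VU)
    qed
    hence "norm (G' s) \<le> norm (- (U m * comm (V m * a * U m - a) (T s) * V m))"
      unfolding G'_def using norm_evol_le[OF contr_minus[OF assms(2)]] by metis
    also have "\<dots> \<le> norm (comm (V m * a * U m - a) (T s))" using norm_conj_le by simp
    also have "\<dots> \<le> C * L * w m" using assms(1) L[OF that] unfolding tame_def T_def by blast
    finally show ?thesis .
  qed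
  have "norm (G t - G 0) \<le> C * L * w m * t"
    by (rule norm_diff_le_vector_derivative[OF assms(4) dG nG])
  moreover have "norm (G 0 - X) \<le> L0 * w m"
    using assms(3) by (simp add: G_def T_def lip_def)
  ultimately have "norm (G t - X) \<le> (L0 + C * L * t) * w m"
    using norm_triangle_ineq[of "G t - G 0" "G 0 - X"] by (simp add: algebra_simps)
  moreover have "U m * T t * V m - T t = evol a t (G t - X)"
    by (simp add: G_def evol_diff evol_inverse T_def)
  ultimately show "norm (U m * evol a t X * V m - evol a t X) \<le> (L0 + C * L * t) * w m"
    using norm_evol_le[OF assms(2), of t "G t - X"] by (simp add: T_def)
qed

text \<open>The a priori bound \<open>2 * norm X\<close> is improved by iterating \<open>L \<mapsto> L\<^sub>0 + L / 2\<close>.\<close>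

lemma lip_evol_short:
  assumes "tame C a" "contr a" "lip L0 X" "0 \<le> t" "0 \<le> C" "C * t \<le> 1 / 2"
  shows "lip (2 * L0) (evol a t X)"
proof -
  define B where "B = 2 * norm X"
  have "lip (2 * L0 + B / 2 ^ k) (evol a s X)" if "0 \<le> s" "s \<le> t" for k s
    using that
  proof (induction k arbitrary: s)
    case 0
    have "lip (2 * norm (evol a s X)) (evol a s X)" by (rule lip_trivial)
    moreover have "2 * norm (evol a s X) \<le> 2 * L0 + B"
      using norm_evol_le[OF assms(2), of s X] lip_nonneg[OF assms(3)] by (simp add: B_def)
    ultimately show ?case using lip_mono by simp
  next
    case (Suc k)
    let ?L = "2 * L0 + B / 2 ^ k"
    have L: "0 \<le> ?L" using lip_nonneg[OF assms(3)] by (simp add: B_def)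
    have "lip (L0 + C * ?L * s) (evol a s X)"
      by (rule lip_evol_step[OF assms(1,2,3) _ assms(5)]) (use Suc in auto)
    moreover have "C * s \<le> 1 / 2"
      using assms(5,6) Suc.prems mult_left_mono[of s t C] by linarith
    hence "C * s * ?L \<le> 1 / 2 * ?L" using L by (rule mult_right_mono)
    hence "L0 + C * ?L * s \<le> 2 * L0 + B / 2 ^ Suc k" by (simp add: algebra_simps)
    ultimately show ?case using lip_mono by blast
  qed
  hence *: "lip (2 * L0 + B / 2 ^ k) (evol a t X)" for k using assms(4) by simp
  show ?thesis unfolding lip_def
  proof
    fix m
    have "(\<lambda>k. (2 * L0 + B / 2 ^ k) * w m) \<longlonglongrightarrow> (2 * L0 + 0) * w m"
      by (intro tendsto_intros LIMSEQ_divide_realpow_zero) auto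
    thus "norm (U m * evol a t X * V m - evol a t X) \<le> 2 * L0 * w m"
      using * unfolding lip_def by (intro LIMSEQ_le_const[where a = "norm (U m * evol a t X * V m - evol a t X)"]) auto
  qed
qed

text \<open>The time interval is cut into \<open>n\<close> pieces with
  \<open>C * (t / n) \<le> 1 / 2\<close>, each of which doubles the constant. Formulating the
  condition with a horizon \<open>T\<close> lets one \<open>n\<close> serve all times up to
  \<open>T\<close>.\<close>

lemma lip_evol:
  assumes "tame C a" "contr a" "lip L0 X" "0 \<le> t" "t \<le> T" "0 \<le> C" "C * T \<le> real n / 2" "0 < n"
  shows "lip (2 ^ n * L0) (evol a t X)"
proof -
  have *: "lip (2 ^ k * L0) (evol a (real k * (t / n)) X)" for k
  proof (induction k)
    case 0 thus ?case using assms(3) by simp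
  next
    case (Suc k)
    have "C * t \<le> real n / 2" using assms mult_left_mono[of t T C] by linarith
    hence "C * (t / n) \<le> 1 / 2" using assms(8) by (simp add: field_simps)
    hence "lip (2 * (2 ^ k * L0)) (evol a (t / n) (evol a (real k * (t / n)) X))"
      by (intro lip_evol_short[OF assms(1,2) Suc]) (use assms in auto)
    thus ?case by (simp add: evol_add[symmetric] algebra_simps add_divide_distrib)
  qed
  show ?thesis using *[of n] assms(8) by simp
qed

text \<open>Two nested Duhamel formulas give the two factors \<open>s\<close>. \<open>G\<close>
  joins the exact evolution at 0 to the split evolution at \<open>s\<close>. Its derivative is an
  evolved value of \<open>J\<close>, which vanishes at time 0 and whose own derivative is a double
  commutator with an evolved \<open>comm a b\<close>.\<close>

lemma trotter_local_error:
  assumes "contr a" "contr b" "contr (a + b)" "0 \<le> s"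
    and P: "\<And>r u. 0 \<le> r \<Longrightarrow> r \<le> s \<Longrightarrow> 0 \<le> u \<Longrightarrow> u \<le> s \<Longrightarrow>
      norm (comm (comm a b) (evol b r (evol (a + b) u X))) \<le> K"
  shows "norm (evol a s (evol b s X) - evol (a + b) s X) \<le> K * s\<^sup>2"
proof -
  define Z where "Z r = evol (a + b) (s - r) X" for r
  define G where "G r = evol a r (evol b r (Z r))" for r
  \<comment> \<open>The observable \<open>z\<close> is a separate argument, so that in
    \<open>dJ\<close> only the flow of \<open>b\<close> is differentiated and the observable stays
    frozen.\<close>
  define J where "J z r = comm (evol (- b) r a - a) z" for z r
  have dJ: "(J z has_vector_derivative comm (evol (- b) r (comm a b)) z) (at r)" for z r
  proof -
    have "((\<lambda>r. evol (- b) r a) has_vector_derivative evol (- b) r (comm a b)) (at r)"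
      using has_vector_derivative_evol[of "\<lambda>_. a" 0 r "- b"] by (simp add: comm_def algebra_simps)
    hence "((\<lambda>r. evol (- b) r a - a) has_vector_derivative evol (- b) r (comm a b) - 0) (at r)"
      by (intro derivative_intros)
    hence "((\<lambda>r. comm (evol (- b) r a - a) z) has_vector_derivative comm (evol (- b) r (comm a b) - 0) z) (at r)"
      unfolding comm_def
      by (intro bounded_linear.has_vector_derivative[where f = "\<lambda>x. x * z - z * x"] bounded_linear_intros)
    thus ?thesis by (simp add: J_def[abs_def])
  qed
  have nJ: "norm (J (Z u) r) \<le> K * s" if ru: "0 \<le> r" "r \<le> s" "0 \<le> u" "u \<le> s" for r u
  proof -
    have b: "norm (comm (evol (- b) q (comm a b)) (Z u)) \<le> K" if q: "0 \<le> q" "q \<le> r" for q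
    proof -
      \<comment> \<open>The flow of \<open>b\<close> is moved from \<open>comm a b\<close> onto the
        observable. For this reason \<open>P\<close> is required for observables evolved first by
        \<open>a + b\<close> and then by \<open>b\<close>.\<close>
      have "comm (evol (- b) q (comm a b)) (Z u) = evol (- b) q (comm (comm a b) (evol b q (Z u)))"
        by (simp add: evol_comm evol_inverse')
      hence "norm (comm (evol (- b) q (comm a b)) (Z u)) \<le> norm (comm (comm a b) (evol b q (Z u)))"
        using norm_evol_le[OF contr_minus[OF assms(2)]] by metis
      also have "\<dots> \<le> K" unfolding Z_def using ru q by (intro P) auto
      finally show ?thesis .
    qed
    have "norm (J (Z u) r - J (Z u) 0) \<le> K * r"
      by (rule norm_diff_le_vector_derivative[OF \<open>0 \<le> r\<close> dJ b])
    moreover have "J (Z u) 0 = 0" by (simp add: J_def comm_def)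
    moreover have "0 \<le> K" using P[of 0 0] assms(4) norm_ge_zero order_trans by blast
    hence "K * r \<le> K * s" using that by (intro mult_left_mono)
    ultimately show ?thesis by simp
  qed
  define G' where "G' r = evol a r (comm a (evol b r (Z r)) + evol b r (comm b (Z r) + - comm (a + b) (Z r)))" for r
  have dZ: "(Z has_vector_derivative - comm (a + b) (Z r)) (at r)" for r
  proof -
    have 1: "((\<lambda>r. evol (a + b) r X) has_vector_derivative comm (a + b) (evol (a + b) q X)) (at q)" for q
      using has_vector_derivative_evol[of "\<lambda>_. X" 0 q "a + b"] by (simp add: evol_comm evol_self)
    have 2: "((\<lambda>r. s - r) has_vector_derivative -1) (at r)"
      by (auto intro!: derivative_eq_intros)
    show ?thesis using vector_diff_chain_at[OF 2 1]
      by (simp add: Z_def[abs_def] o_def)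
  qed
  have dG: "(G has_vector_derivative G' r) (at r)" for r
    unfolding G_def G'_def by (intro has_vector_derivative_evol dZ)
  have nG: "norm (G' r) \<le> K * s" if "0 \<le> r" "r \<le> s" for r
  proof -
    have "G' r = evol a r (evol b r (J (Z r) r))"
    proof -
      have "comm a (evol b r (Z r)) = evol b r (comm (evol (- b) r a) (Z r))"
        by (simp add: evol_comm evol_inverse)
      hence "comm a (evol b r (Z r)) + evol b r (comm b (Z r) + - comm (a + b) (Z r))
        = evol b r (comm (evol (- b) r a) (Z r) + (comm b (Z r) + - comm (a + b) (Z r)))"
        by (simp only: evol_plus)
      also have "comm (evol (- b) r a) (Z r) + (comm b (Z r) + - comm (a + b) (Z r)) = J (Z r) r"
        by (simp add: J_def comm_def algebra_simps)
      finally show ?thesis by (simp add: G'_def)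
    qed
    thus ?thesis using nJ[of r r] that norm_evol_le[OF assms(1)] norm_evol_le[OF assms(2)]
      by (metis order_trans)
  qed
  have "norm (G s - G 0) \<le> K * s * s"
    by (rule norm_diff_le_vector_derivative[OF assms(4) dG nG])
  thus ?thesis by (simp add: G_def Z_def power2_eq_square mult.assoc)
qed

text \<open>Each local error is committed at a point of the orbit of \<open>R\<close>, which will be
  the exact evolution and the only orbit whose regularity is controlled; \<open>F\<close> carries it
  to the end without enlarging it.\<close>

lemma funpow_telescope:
  fixes S E :: "'b \<Rightarrow> 'c::real_normed_vector" and F R :: "'c \<Rightarrow> 'c"
  assumes "\<And>X Y. norm (F X - F Y) \<le> norm (X - Y)"
    and "\<And>k. k < n \<Longrightarrow> norm (F ((R ^^ k) X) - R ((R ^^ k) X)) \<le> e"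
  shows "norm ((F ^^ n) X - (R ^^ n) X) \<le> real n * e"
  using assms(2)
proof (induction n)
  case (Suc n)
  have "norm ((F ^^ Suc n) X - (R ^^ Suc n) X)
      \<le> norm (F ((F ^^ n) X) - F ((R ^^ n) X)) + norm (F ((R ^^ n) X) - R ((R ^^ n) X))"
    using norm_triangle_ineq[of "F ((F ^^ n) X) - F ((R ^^ n) X)" "F ((R ^^ n) X) - R ((R ^^ n) X)"] by simp
  also have "\<dots> \<le> real n * e + e"
    using assms(1)[of "(F ^^ n) X" "(R ^^ n) X"] Suc by (intro add_mono) (auto intro: order_trans)
  finally show ?case by (simp add: algebra_simps)
qed simp

text \<open>The factor \<open>4 ^ q\<close> is \<open>2 ^ q * 2 ^ q\<close>: one growth factor for
  the exact flow up to time \<open>t\<close>, one for the flow of \<open>b\<close> up to time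
  \<open>s \<le> t\<close>. Adding \<open>n\<close> errors proportional to \<open>s * s\<close>
  leaves \<open>t * s\<close>.\<close>

theorem trotter_error:
  assumes "contr a" "contr b" "contr (a + b)" "tame Cb b" "tame Ch (a + b)" "0 \<le> Cb" "0 \<le> Ch"
    and P: "\<And>L Y. lip L Y \<Longrightarrow> norm (comm (comm a b) Y) \<le> C2 * L"
    and X: "lip L0 X"
    and n: "0 < n" "t = real n * s" "0 < s"
    and q: "0 < q" "Cb * t \<le> real q / 2" "Ch * t \<le> real q / 2"
  shows "norm (((\<lambda>Y. evol a s (evol b s Y)) ^^ n) X - evol (a + b) t X) \<le> t * C2 * 4 ^ q * L0 * s"
proof -
  have pow: "(evol (a + b) s ^^ k) X = evol (a + b) (real k * s) X" for k
    by (induction k) (simp_all add: evol_add[symmetric] algebra_simps)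
  have "s \<le> t" using n mult_right_mono[of 1 "real n" s] by simp
  have loc: "norm (evol a s (evol b s ((evol (a + b) s ^^ k) X)) - evol (a + b) s ((evol (a + b) s ^^ k) X))
      \<le> C2 * 4 ^ q * L0 * s\<^sup>2" if "k < n" for k
  proof (rule trotter_local_error[OF assms(1-3)])
    fix r u assume ru: "0 \<le> r" "r \<le> s" "0 \<le> u" "u \<le> s"
    \<comment> \<open>Since \<open>k < n\<close>, even the last local step stays within the horizon
      \<open>t\<close>, so a single \<open>q\<close> covers all of them.\<close>
    have "real k * s + u \<le> (real k + 1) * s" using ru by (simp add: algebra_simps)
    also have "\<dots> \<le> t" unfolding n using that n(3) by (intro mult_right_mono) auto
    finally have le: "u + real k * s \<le> t" by simp
    have "lip (2 ^ q * L0) (evol (a + b) (u + real k * s) X)"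
      by (rule lip_evol[OF assms(5,3) X _ le]) (use assms n q ru in auto)
    hence "lip (2 ^ q * (2 ^ q * L0)) (evol b r (evol (a + b) (u + real k * s) X))"
      by (rule lip_evol[OF assms(4,2) _ _ _ assms(6) q(2) q(1)]) (use ru \<open>s \<le> t\<close> in auto)
    moreover have "2 ^ q * (2 ^ q * L0) = 4 ^ q * L0"
      by (simp flip: power_mult_distrib mult.assoc)
    ultimately show "norm (comm (comm a b) (evol b r (evol (a + b) u ((evol (a + b) s ^^ k) X)))) \<le> C2 * 4 ^ q * L0"
      using P by (simp add: pow evol_add mult.assoc)
  qed (use n in auto)
  have iso: "norm (evol a s (evol b s Y) - evol a s (evol b s Z)) \<le> norm (Y - Z)" for Y Z
    unfolding evol_diff[symmetric]
    using norm_evol_le[OF assms(1)] norm_evol_le[OF assms(2)] by (meson order_trans)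
  have "norm (((\<lambda>Y. evol a s (evol b s Y)) ^^ n) X - (evol (a + b) s ^^ n) X) \<le> real n * (C2 * 4 ^ q * L0 * s\<^sup>2)"
    by (rule funpow_telescope[OF iso loc])
  also have "(evol (a + b) s ^^ n) X = evol (a + b) t X" using pow[of n] n by simp
  also have "real n * (C2 * 4 ^ q * L0 * s\<^sup>2) = t * C2 * 4 ^ q * L0 * s"
    using n by (simp add: power2_eq_square algebra_simps)
  finally show ?thesis .
qed

end

section \<open>Bounded operators on \<open>\<ell>\<^sup>2\<close>\<close>

text \<open>With an infinite index type one Banach algebra serves every \<open>N\<close>: the finite
  set \<open>idx N\<close> of relevant indices varies while the type stays fixed.\<close>

typedef 'i ell2 = "{f :: 'i \<Rightarrow> complex. (\<lambda>i. (norm (f i))\<^sup>2) summable_on UNIV}"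
  morphisms coord Abs_ell2
  by (rule exI[of _ "\<lambda>_. 0"]) simp

setup_lifting type_definition_ell2

lemma coord_summable: "(\<lambda>i. (norm (coord f i))\<^sup>2) summable_on UNIV"
  using coord[of f] by simp

lemma ell2_add_closed:
  fixes f g :: "'i \<Rightarrow> complex"
  assumes "(\<lambda>i. (norm (f i))\<^sup>2) summable_on UNIV" "(\<lambda>i. (norm (g i))\<^sup>2) summable_on UNIV"
  shows "(\<lambda>i. (norm (f i + g i))\<^sup>2) summable_on UNIV"
proof (rule summable_on_comparison_test)
  show "(\<lambda>i. 2 * (norm (f i))\<^sup>2 + 2 * (norm (g i))\<^sup>2) summable_on UNIV"
    by (intro summable_on_add summable_on_cmult_right assms)
  show "(norm (f i + g i))\<^sup>2 \<le> 2 * (norm (f i))\<^sup>2 + 2 * (norm (g i))\<^sup>2" for i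
  proof -
    have "(norm (f i + g i))\<^sup>2 \<le> (norm (f i) + norm (g i))\<^sup>2"
      by (intro power_mono norm_triangle_ineq) simp
    also have "\<dots> \<le> 2 * (norm (f i))\<^sup>2 + 2 * (norm (g i))\<^sup>2"
      using zero_le_power2[of "norm (f i) - norm (g i)"] by (simp add: power2_eq_square algebra_simps)
    finally show ?thesis .
  qed
qed simp_all

lemma ell2_inner_summable:
  fixes f g :: "'i \<Rightarrow> complex"
  assumes "(\<lambda>i. (norm (f i))\<^sup>2) summable_on UNIV" "(\<lambda>i. (norm (g i))\<^sup>2) summable_on UNIV"
  shows "(\<lambda>i. f i \<bullet> g i) summable_on UNIV"
proof (rule abs_summable_summable, rule summable_on_comparison_test)
  show "(\<lambda>i. (norm (f i))\<^sup>2 + (norm (g i))\<^sup>2) summable_on UNIV"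
    by (intro summable_on_add assms)
  show "norm (f i \<bullet> g i) \<le> (norm (f i))\<^sup>2 + (norm (g i))\<^sup>2" for i
  proof -
    have "norm (f i \<bullet> g i) \<le> norm (f i) * norm (g i)" using Cauchy_Schwarz_ineq2 by simp
    also have "\<dots> \<le> (norm (f i))\<^sup>2 + (norm (g i))\<^sup>2"
      using sum_squares_bound[of "norm (f i)" "norm (g i)"]
        mult_nonneg_nonneg[of "norm (f i)" "norm (g i)"] by (simp del: mult_nonneg_nonneg)
    finally show ?thesis .
  qed
qed simp_all

instantiation ell2 :: (type) real_vector
begin

lift_definition zero_ell2 :: "'a ell2" is "\<lambda>_. 0" by simp
lift_definition plus_ell2 :: "'a ell2 \<Rightarrow> 'a ell2 \<Rightarrow> 'a ell2" is "\<lambda>f g i. f i + g i"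
  by (rule ell2_add_closed)
lift_definition uminus_ell2 :: "'a ell2 \<Rightarrow> 'a ell2" is "\<lambda>f i. - f i" by simp
lift_definition minus_ell2 :: "'a ell2 \<Rightarrow> 'a ell2 \<Rightarrow> 'a ell2" is "\<lambda>f g i. f i - g i"
  using ell2_add_closed[where g = "\<lambda>i. - g i" for g] by auto
lift_definition scaleR_ell2 :: "real \<Rightarrow> 'a ell2 \<Rightarrow> 'a ell2" is "\<lambda>r f i. r *\<^sub>R f i"
  by (simp add: power_mult_distrib summable_on_cmult_right)

instance by standard (transfer; simp add: fun_eq_iff algebra_simps)+
end

instantiation ell2 :: (type) real_inner
begin

text \<open>This is the real part of the usual complex inner product. A complex-linear operator
  \<open>a\<close> is skew-adjoint exactly when the form vanishes on all pairs \<open>a f\<close>,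
  \<open>f\<close>, and skewness is tested in this way later.\<close>

definition inner_ell2 :: "'a ell2 \<Rightarrow> 'a ell2 \<Rightarrow> real" where
  "inner_ell2 f g = (\<Sum>\<^sub>\<infinity>i. coord f i \<bullet> coord g i)"
definition norm_ell2 :: "'a ell2 \<Rightarrow> real" where "norm_ell2 f = sqrt (f \<bullet> f)"
definition sgn_ell2 :: "'a ell2 \<Rightarrow> 'a ell2" where "sgn_ell2 f = f /\<^sub>R norm f"
definition dist_ell2 :: "'a ell2 \<Rightarrow> 'a ell2 \<Rightarrow> real" where "dist_ell2 f g = norm (f - g)"
definition uniformity_ell2 :: "('a ell2 \<times> 'a ell2) filter" where
  "uniformity_ell2 = (INF e\<in>{0<..}. principal {(x, y). dist x y < e})"
definition open_ell2 :: "'a ell2 set \<Rightarrow> bool" where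
  "open_ell2 S = (\<forall>x\<in>S. \<forall>\<^sub>F (x', y) in uniformity. x' = x \<longrightarrow> y \<in> S)"

instance
proof
  fix f g h :: "'a ell2" and r :: real
  note s = ell2_inner_summable[OF coord_summable coord_summable]
  show "f \<bullet> g = g \<bullet> f" by (simp add: inner_ell2_def inner_commute)
  show "(f + g) \<bullet> h = f \<bullet> h + g \<bullet> h"
    by (simp add: inner_ell2_def plus_ell2.rep_eq inner_add_left infsum_add s)
  show "(r *\<^sub>R f) \<bullet> g = r * (f \<bullet> g)"
    by (simp add: inner_ell2_def scaleR_ell2.rep_eq infsum_cmult_right' )
  show "0 \<le> f \<bullet> f" by (simp add: inner_ell2_def infsum_nonneg)
  show "f \<bullet> f = 0 \<longleftrightarrow> f = 0"
  proof
    assume 0: "f \<bullet> f = 0"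
    have "coord f i = 0" for i
    proof -
      have "(\<Sum>i\<in>{i}. coord f i \<bullet> coord f i) \<le> f \<bullet> f"
        unfolding inner_ell2_def by (rule finite_sum_le_infsum[OF s]) auto
      with 0 have "coord f i \<bullet> coord f i \<le> 0" by simp
      thus ?thesis by (metis inner_ge_zero inner_eq_zero_iff order_antisym)
    qed
    thus "f = 0" by transfer auto
  qed (simp add: inner_ell2_def zero_ell2.rep_eq)
qed (simp_all add: norm_ell2_def sgn_ell2_def dist_ell2_def uniformity_ell2_def open_ell2_def)
end

lemma norm_ell2_square: "(norm (f :: 'i ell2))\<^sup>2 = (\<Sum>\<^sub>\<infinity>i. (norm (coord f i))\<^sup>2)"
  by (simp add: norm_ell2_def[of f] inner_ell2_def infsum_nonneg power2_norm_eq_inner)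

lemma sum_coord_le: "finite F \<Longrightarrow> (\<Sum>i\<in>F. (norm (coord f i))\<^sup>2) \<le> (norm f)\<^sup>2"
  unfolding norm_ell2_square by (rule finite_sum_le_infsum[OF coord_summable]) auto

lemma norm_coord_le: "norm (coord f i) \<le> norm f"
  using sum_coord_le[of "{i}" f] by (intro power2_le_imp_le[of "norm (coord f i)"]) simp_all

lemma norm_ell2_le:
  assumes "\<And>F. finite F \<Longrightarrow> (\<Sum>i\<in>F. (norm (coord f i))\<^sup>2) \<le> B\<^sup>2" "0 \<le> B"
  shows "norm f \<le> B"
proof -
  have "(norm f)\<^sup>2 \<le> B\<^sup>2" unfolding norm_ell2_square
    by (rule infsum_le_finite_sums[OF coord_summable assms(1)])
  thus ?thesis using assms(2) by (rule power2_le_imp_le)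
qed

instance ell2 :: (type) banach
proof
  fix X :: "nat \<Rightarrow> 'a ell2" assume C: "Cauchy X"
  have coordC: "Cauchy (\<lambda>n. coord (X n) i)" for i
  proof (rule metric_CauchyI)
    fix e :: real assume "0 < e"
    then obtain M where M: "\<And>m n. m \<ge> M \<Longrightarrow> n \<ge> M \<Longrightarrow> dist (X m) (X n) < e"
      using C by (metis Cauchy_def)
    have "dist (coord (X m) i) (coord (X n) i) < e" if "m \<ge> M" "n \<ge> M" for m n
      using norm_coord_le[of "X m - X n" i] M[OF that] by (simp add: dist_norm minus_ell2.rep_eq)
    thus "\<exists>M. \<forall>m\<ge>M. \<forall>n\<ge>M. dist (coord (X m) i) (coord (X n) i) < e" by blast
  qed
  define x where "x i = lim (\<lambda>n. coord (X n) i)" for i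
  have x: "(\<lambda>n. coord (X n) i) \<longlonglongrightarrow> x i" for i
    using coordC[of i] by (simp add: x_def Cauchy_convergent_iff convergent_LIMSEQ_iff)
  \<comment> \<open>Only finite partial sums are used, since square summability of the pointwise
    limit is not yet known; finite sums pass to the limit in \<open>m\<close>.\<close>
  have bound: "\<exists>M. \<forall>n\<ge>M. \<forall>F. finite F \<longrightarrow> (\<Sum>i\<in>F. (norm (coord (X n) i - x i))\<^sup>2) \<le> e\<^sup>2" if "0 < e" for e :: real
  proof -
    obtain M where M: "\<And>m n. m \<ge> M \<Longrightarrow> n \<ge> M \<Longrightarrow> dist (X m) (X n) < e"
      using C \<open>0 < e\<close> by (metis Cauchy_def)
    have "(\<Sum>i\<in>F. (norm (coord (X n) i - x i))\<^sup>2) \<le> e\<^sup>2" if "n \<ge> M" "finite F" for n F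
    proof (rule LIMSEQ_le_const2)
      show "(\<lambda>m. \<Sum>i\<in>F. (norm (coord (X n) i - coord (X m) i))\<^sup>2) \<longlonglongrightarrow> (\<Sum>i\<in>F. (norm (coord (X n) i - x i))\<^sup>2)"
        by (intro tendsto_intros x)
      have "(\<Sum>i\<in>F. (norm (coord (X n) i - coord (X m) i))\<^sup>2) \<le> e\<^sup>2" if "m \<ge> M" for m
      proof -
        have "(\<Sum>i\<in>F. (norm (coord (X n) i - coord (X m) i))\<^sup>2) \<le> (norm (X n - X m))\<^sup>2"
          using sum_coord_le[OF \<open>finite F\<close>, of "X n - X m"] by (simp add: minus_ell2.rep_eq)
        also have "\<dots> \<le> e\<^sup>2" using M[OF \<open>n \<ge> M\<close> that] by (intro power_mono) (auto simp: dist_norm)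
        finally show ?thesis .
      qed
      thus "\<exists>N. \<forall>m\<ge>N. (\<Sum>i\<in>F. (norm (coord (X n) i - coord (X m) i))\<^sup>2) \<le> e\<^sup>2" by blast
    qed
    thus ?thesis by blast
  qed
  have mem: "(\<lambda>i. (norm (x i))\<^sup>2) summable_on UNIV"
  proof -
    obtain n where n: "\<And>F. finite F \<Longrightarrow> (\<Sum>i\<in>F. (norm (coord (X n) i - x i))\<^sup>2) \<le> 1\<^sup>2"
      using bound[of 1] by (meson order_refl zero_less_one)
    have "(\<lambda>i. (norm (coord (X n) i - x i))\<^sup>2) summable_on UNIV"
    proof (rule nonneg_bdd_above_summable_on)
      show "bdd_above (sum (\<lambda>i. (norm (coord (X n) i - x i))\<^sup>2) ` {F. F \<subseteq> UNIV \<and> finite F})"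
        unfolding bdd_above_def using n by blast
    qed simp
    hence "(\<lambda>i. (norm (- (coord (X n) i - x i)))\<^sup>2) summable_on UNIV"
      by (simp only: norm_minus_cancel)
    from ell2_add_closed[OF coord_summable[of "X n"] this] show ?thesis by simp
  qed
  define y where "y = Abs_ell2 x"
  have y: "coord y = x" unfolding y_def using mem by (simp add: Abs_ell2_inverse)
  have "X \<longlonglongrightarrow> y"
  proof (rule metric_LIMSEQ_I)
    fix e :: real assume "0 < e"
    then obtain M where M: "\<And>n F. n \<ge> M \<Longrightarrow> finite F \<Longrightarrow> (\<Sum>i\<in>F. (norm (coord (X n) i - x i))\<^sup>2) \<le> (e/2)\<^sup>2"
      using bound[of "e/2"] by (metis half_gt_zero)
    have "norm (X n - y) < e" if "n \<ge> M" for n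
      using norm_ell2_le[of "X n - y" "e/2"] M[OF that] \<open>0 < e\<close> by (simp add: minus_ell2.rep_eq y)
    thus "\<exists>M. \<forall>n\<ge>M. dist (X n) y < e" by (auto simp: dist_norm)
  qed
  thus "convergent X" by (rule convergentI)
qed

section \<open>Complex scalars and the Banach algebra of complex-linear operators\<close>

lift_definition cmul :: "complex \<Rightarrow> 'i ell2 \<Rightarrow> 'i ell2" is "\<lambda>z f i. z * f i"
  by (simp add: norm_mult power_mult_distrib summable_on_cmult_right)

lemma norm_cmul: "norm (cmul z f) = norm z * norm f"
proof -
  have "(norm (cmul z f))\<^sup>2 = (norm z * norm f)\<^sup>2"
    by (simp add: norm_ell2_square cmul.rep_eq norm_mult power_mult_distrib infsum_cmult_right')
  thus ?thesis by (simp add: power2_eq_iff_nonneg)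
qed

lemma bounded_linear_cmul: "bounded_linear (cmul z)"
proof (rule bounded_linear_intro[where K = "norm z"])
  show "cmul z (f + g) = cmul z f + cmul z g" for f g :: "'i ell2" by transfer (simp add: algebra_simps)
  show "cmul z (r *\<^sub>R f) = r *\<^sub>R cmul z f" for r and f :: "'i ell2" by transfer simp
qed (simp add: norm_cmul)

lemma cmul_cmul: "cmul z (cmul w x) = cmul (z * w) x"
  by transfer (simp add: ac_simps)

lemma cmul_diff_left: "cmul (z - w) x = cmul z x - cmul w x"
  by transfer (simp add: algebra_simps)

lemma cmul_1 [simp]: "cmul 1 x = x"
  by transfer simp

lemma cmul_of_real: "cmul (of_real r) x = r *\<^sub>R x"
  by transfer (simp add: scaleR_conv_of_real)

text \<open>Elements of \<open>blinfun\<close> are only real-linear. Complex linearity is imposed so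
  that complex scalars are central in the algebra, which lets the phases of the Weyl relations be
  pulled out of products.\<close>

typedef 'i cop = "{f :: 'i ell2 \<Rightarrow>\<^sub>L 'i ell2. \<forall>z x. f (cmul z x) = cmul z (f x)}"
  by (rule exI[of _ 0]) (simp, transfer, simp)

lifting_forget ell2.lifting
setup_lifting type_definition_cop

lemma cop_eq_iff: "a = b \<longleftrightarrow> (\<forall>x. blinfun_apply (Rep_cop a) x = blinfun_apply (Rep_cop b) x)"
  by (auto simp flip: Rep_cop_inject intro: blinfun_eqI)

instantiation cop :: (type) real_algebra_1
begin

lift_definition zero_cop :: "'a cop" is 0
  by (simp add: bounded_linear.linear[OF bounded_linear_cmul, THEN linear_0])
lift_definition one_cop :: "'a cop" is id_blinfun by simp
lift_definition plus_cop :: "'a cop \<Rightarrow> 'a cop \<Rightarrow> 'a cop" is "(+)"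
  by (simp add: blinfun.add_left bounded_linear.linear[OF bounded_linear_cmul, THEN linear_add])
lift_definition uminus_cop :: "'a cop \<Rightarrow> 'a cop" is uminus
  by (simp add: blinfun.minus_left bounded_linear.linear[OF bounded_linear_cmul, THEN linear_neg])
lift_definition minus_cop :: "'a cop \<Rightarrow> 'a cop \<Rightarrow> 'a cop" is "(-)"
  by (simp add: blinfun.diff_left bounded_linear.linear[OF bounded_linear_cmul, THEN linear_diff])
lift_definition scaleR_cop :: "real \<Rightarrow> 'a cop \<Rightarrow> 'a cop" is scaleR
  by (simp add: blinfun.scaleR_left bounded_linear.linear[OF bounded_linear_cmul, THEN linear_scale])
lift_definition times_cop :: "'a cop \<Rightarrow> 'a cop \<Rightarrow> 'a cop" is blinfun_compose by simp

instance
proof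
  fix a b c :: "'a cop" and r s :: real
  show "(0 :: 'a cop) \<noteq> 1"
  proof transfer
    \<comment> \<open>The unit vector at the index \<open>undefined\<close> separates the identity
      from 0.\<close>
    have "(\<lambda>i::'a. (norm (1::complex))\<^sup>2 * (if i = undefined then 1 else 0)) summable_on UNIV"
      by (rule summable_on_cmult_right) (auto intro: finite_nonzero_values_imp_summable_on)
    hence *: "(\<lambda>i::'a. (norm (if i = undefined then 1 else 0 :: complex))\<^sup>2) summable_on UNIV"
      by (rule summable_on_cong[THEN iffD1, rotated]) auto
    have "coord (Abs_ell2 (\<lambda>i. if i = undefined then 1 else 0)) (undefined::'a) = 1"
      by (subst Abs_ell2_inverse) (use * in auto)
    hence "id_blinfun (Abs_ell2 (\<lambda>i::'a. if i = undefined then 1 else 0)) \<noteq> 0"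
      by (auto simp: zero_ell2.rep_eq)
    thus "(0 :: 'a ell2 \<Rightarrow>\<^sub>L 'a ell2) \<noteq> id_blinfun" by (metis blinfun.zero_left)
  qed
  note s = cop_eq_iff plus_cop.rep_eq minus_cop.rep_eq uminus_cop.rep_eq zero_cop.rep_eq one_cop.rep_eq
    scaleR_cop.rep_eq times_cop.rep_eq blinfun.add_left blinfun.add_right blinfun.diff_left blinfun.minus_left
    blinfun.scaleR_left blinfun.scaleR_right blinfun.zero_left scaleR_add_left scaleR_add_right
  show "a + b + c = a + (b + c)" by (simp add: s)
  show "a + b = b + a" by (simp add: s)
  show "0 + a = a" by (simp add: s)
  show "- a + a = 0" by (simp add: s)
  show "a - b = a + - b" by (simp add: s)
  show "r *\<^sub>R (a + b) = r *\<^sub>R a + r *\<^sub>R b" by (simp add: s)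
  show "(r + s) *\<^sub>R a = r *\<^sub>R a + s *\<^sub>R a" by (simp add: s)
  show "r *\<^sub>R s *\<^sub>R a = (r * s) *\<^sub>R a" by (simp add: s)
  show "1 *\<^sub>R a = a" by (simp add: s)
  show "a * b * c = a * (b * c)" by (simp add: s)
  show "(a + b) * c = a * c + b * c" by (simp add: s)
  show "a * (b + c) = a * b + a * c" by (simp add: s)
  show "r *\<^sub>R a * b = r *\<^sub>R (a * b)" by (simp add: s)
  show "a * r *\<^sub>R b = r *\<^sub>R (a * b)" by (simp add: s)
  show "1 * a = a" by (simp add: s)
  show "a * 1 = a" by (simp add: s)
qed
end

instantiation cop :: (type) real_normed_algebra_1
begin

lift_definition norm_cop :: "'a cop \<Rightarrow> real" is norm .
definition sgn_cop :: "'a cop \<Rightarrow> 'a cop" where "sgn_cop f = f /\<^sub>R norm f"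
definition dist_cop :: "'a cop \<Rightarrow> 'a cop \<Rightarrow> real" where "dist_cop f g = norm (f - g)"
definition uniformity_cop :: "('a cop \<times> 'a cop) filter" where
  "uniformity_cop = (INF e\<in>{0<..}. principal {(x, y). dist x y < e})"
definition open_cop :: "'a cop set \<Rightarrow> bool" where
  "open_cop S = (\<forall>x\<in>S. \<forall>\<^sub>F (x', y) in uniformity. x' = x \<longrightarrow> y \<in> S)"

instance
proof
  fix a b :: "'a cop" and r :: real
  show "norm (a + b) \<le> norm a + norm b" by transfer (rule norm_triangle_ineq)
  show "norm (a * b) \<le> norm a * norm b" by transfer (rule norm_blinfun_compose)
  have "(0 :: 'a ell2 \<Rightarrow>\<^sub>L 'a ell2) \<noteq> id_blinfun"
    using zero_neq_one[where 'a = "'a cop"] by (metis one_cop.rep_eq zero_cop.rep_eq Rep_cop_inject)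
  \<comment> \<open>A nonzero idempotent has norm at least 1 by submultiplicativity.\<close>
  hence "0 < norm (id_blinfun :: 'a ell2 \<Rightarrow>\<^sub>L 'a ell2)" by simp
  moreover have "norm (id_blinfun o\<^sub>L id_blinfun :: 'a ell2 \<Rightarrow>\<^sub>L 'a ell2)
      \<le> norm (id_blinfun :: 'a ell2 \<Rightarrow>\<^sub>L 'a ell2) * norm (id_blinfun :: 'a ell2 \<Rightarrow>\<^sub>L 'a ell2)"
    by (rule norm_blinfun_compose)
  moreover have "id_blinfun o\<^sub>L id_blinfun = (id_blinfun :: 'a ell2 \<Rightarrow>\<^sub>L 'a ell2)"
    by (rule blinfun_eqI) simp
  ultimately have "1 \<le> norm (id_blinfun :: 'a ell2 \<Rightarrow>\<^sub>L 'a ell2)"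
    by (simp add: mult_le_cancel_right1)
  moreover have "norm (id_blinfun :: 'a ell2 \<Rightarrow>\<^sub>L 'a ell2) \<le> 1"
    by (rule norm_blinfun_bound) auto
  ultimately show "norm (1 :: 'a cop) = 1" unfolding norm_cop.rep_eq one_cop.rep_eq by linarith
  show "norm a = 0 \<longleftrightarrow> a = 0" by transfer simp
  show "norm (r *\<^sub>R a) = \<bar>r\<bar> * norm a" by transfer simp
qed (simp_all add: sgn_cop_def dist_cop_def uniformity_cop_def open_cop_def)
end

lift_definition app :: "'i cop \<Rightarrow> 'i ell2 \<Rightarrow> 'i ell2" is blinfun_apply .

lemma app_simps [simp]:
  "app 0 x = 0" "app 1 x = x" "app (a + b) x = app a x + app b x" "app (a - b) x = app a x - app b x"
  "app (- a) x = - app a x" "app (r *\<^sub>R a) x = r *\<^sub>R app a x" "app (a * b) x = app a (app b x)"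
  by (transfer; simp add: blinfun.bilinear_simps)+

lemma app_cmul: "app a (cmul z x) = cmul z (app a x)"
  by transfer simp

lemma norm_app: "norm (app a x) \<le> norm a * norm x"
  by transfer (rule norm_blinfun)

lemma bounded_linear_app: "bounded_linear (app a)"
  by transfer (rule blinfun.bounded_linear_right)

lemma bounded_linear_app_left: "bounded_linear (\<lambda>a. app a x)"
  by (rule bounded_linear_intro[where K = "norm x"]) (auto intro: norm_app)

lemma cop_eqI: "(\<And>x. app a x = app b x) \<Longrightarrow> a = b"
  by transfer (auto intro: blinfun_eqI)

lemma norm_cop_bound: "0 \<le> B \<Longrightarrow> (\<And>x. norm (app a x) \<le> B * norm x) \<Longrightarrow> norm a \<le> B"
  unfolding norm_cop.rep_eq app.rep_eq by (rule norm_blinfun_bound)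

instance cop :: (type) banach
proof
  fix X :: "nat \<Rightarrow> 'a cop" assume C: "Cauchy X"
  define Y where "Y n = Rep_cop (X n)" for n
  have d: "dist (Y m) (Y n) = dist (X m) (X n)" for m n
    by (simp add: Y_def dist_norm norm_cop.rep_eq minus_cop.rep_eq)
  have "Cauchy Y" using C by (simp add: Cauchy_def d)
  then obtain g where g: "Y \<longlonglongrightarrow> g" by (auto simp: Cauchy_convergent_iff convergent_def)
  have "g (cmul z x) = cmul z (g x)" for z x
  proof (rule LIMSEQ_unique)
    show "(\<lambda>n. Y n (cmul z x)) \<longlonglongrightarrow> g (cmul z x)"
      by (rule blinfun.tendsto[OF g tendsto_const])
    have "(\<lambda>n. cmul z (Y n x)) \<longlonglongrightarrow> cmul z (g x)"
      by (rule bounded_linear.tendsto[OF bounded_linear_cmul blinfun.tendsto[OF g tendsto_const]])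
    moreover have "cmul z (Y n x) = Y n (cmul z x)" for n
      using Rep_cop[of "X n"] unfolding Y_def by auto
    ultimately show "(\<lambda>n. Y n (cmul z x)) \<longlonglongrightarrow> cmul z (g x)" by simp
  qed
  hence r: "Rep_cop (Abs_cop g) = g" by (simp add: Abs_cop_inverse)
  have "X \<longlonglongrightarrow> Abs_cop g"
  proof (rule metric_LIMSEQ_I)
    fix e :: real assume "0 < e"
    then obtain M where "\<And>n. n \<ge> M \<Longrightarrow> dist (Y n) g < e" using g by (metis metric_LIMSEQ_D)
    moreover have "dist (X n) (Abs_cop g) = dist (Y n) g" for n
      by (simp add: Y_def dist_norm norm_cop.rep_eq minus_cop.rep_eq r)
    ultimately show "\<exists>M. \<forall>n\<ge>M. dist (X n) (Abs_cop g) < e" by auto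
  qed
  thus "convergent X" by (rule convergentI)
qed

lemma cmul_blinfun_closed:
  fixes f :: "'i ell2 \<Rightarrow>\<^sub>L 'i ell2"
  assumes "\<forall>z x. f (cmul z x) = cmul z (f x)"
  shows "\<forall>w x. Blinfun (\<lambda>x. cmul z (f x)) (cmul w x) = cmul w (Blinfun (\<lambda>x. cmul z (f x)) x)"
proof -
  have "bounded_linear (\<lambda>x. cmul z (f x))"
    by (rule bounded_linear_compose[OF bounded_linear_cmul blinfun.bounded_linear_right])
  thus ?thesis using assms by (simp add: bounded_linear_Blinfun_apply cmul_cmul mult.commute)
qed

lift_definition csc :: "complex \<Rightarrow> 'i cop \<Rightarrow> 'i cop" is "\<lambda>z f. Blinfun (\<lambda>x. cmul z (blinfun_apply f x))"
  by (rule cmul_blinfun_closed[rule_format])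

lemma app_csc [simp]: "app (csc z a) x = cmul z (app a x)"
proof -
  have "bounded_linear (\<lambda>x. cmul z (Rep_cop a x))"
    by (rule bounded_linear_compose[OF bounded_linear_cmul blinfun.bounded_linear_right])
  thus ?thesis by (simp add: app.rep_eq csc.rep_eq bounded_linear_Blinfun_apply)
qed

lemma norm_csc: "norm (csc z a) \<le> norm z * norm a"
proof (rule norm_cop_bound)
  fix x
  have "norm z * norm (app a x) \<le> norm z * (norm a * norm x)"
    by (intro mult_left_mono norm_app) auto
  thus "norm (app (csc z a) x) \<le> norm z * norm a * norm x" by (simp add: norm_cmul mult.assoc)
qed simp

lemma bounded_linear_csc: "bounded_linear (csc z)"
proof (rule bounded_linear_intro[where K = "norm z"])
  show "csc z (a + b) = csc z a + csc z b" for a b :: "'i cop"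
    by (rule cop_eqI) (simp add: bounded_linear_cmul[THEN bounded_linear.linear, THEN linear_add])
  show "csc z (r *\<^sub>R a) = r *\<^sub>R csc z a" for r and a :: "'i cop"
    by (rule cop_eqI) (simp add: bounded_linear_cmul[THEN bounded_linear.linear, THEN linear_scale])
qed (metis norm_csc mult.commute)

lemma csc_mult_left: "csc z a * b = csc z (a * b)"
  by (rule cop_eqI) simp

lemma csc_mult_right: "a * csc z b = csc z (a * b)"
  by (rule cop_eqI) (simp add: app_cmul)

lemma csc_csc: "csc z (csc w a) = csc (z * w) a"
  by (rule cop_eqI) (simp add: cmul_cmul)

lemma csc_diff: "csc (z - w) a = csc z a - csc w a"
  by (rule cop_eqI) (simp add: cmul_diff_left)

lemma csc_1 [simp]: "csc 1 a = a"
  by (rule cop_eqI) simp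

lemma csc_of_real: "csc (of_real r) a = r *\<^sub>R a"
  by (rule cop_eqI) (simp add: cmul_of_real)

lemma csc_power: "csc z a ^ k = csc (z ^ k) (a ^ k)"
  by (induction k) (simp_all add: csc_mult_left csc_mult_right csc_csc mult.commute)

section \<open>Fourier series\<close>

definition e :: "real \<Rightarrow> complex" where "e t = cis (2 * pi * t)"

lemma e_0 [simp]: "e 0 = 1" by (simp add: e_def)
lemma e_add: "e (s + t) = e s * e t" by (simp add: e_def cis_mult distrib_left)
lemma e_minus: "e (- t) = cnj (e t)" by (simp add: e_def cis_cnj)
lemma e_int [simp]: "e (of_int n) = 1" by (simp add: e_def cis_multiple_2pi)
lemma norm_e [simp]: "norm (e t) = 1" by (simp add: e_def)
lemma e_neq_0 [simp]: "e t \<noteq> 0" by (simp add: e_def)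

lemma e_sum: "finite A \<Longrightarrow> e (\<Sum>x\<in>A. f x) = (\<Prod>x\<in>A. e (f x))"
  by (induction rule: finite_induct) (simp_all add: e_add)

lemma e_power: "e t ^ n = e (real n * t)"
  by (induction n) (simp_all add: e_add algebra_simps)

lemma continuous_on_e [continuous_intros]: "continuous_on S f \<Longrightarrow> continuous_on S (\<lambda>x. e (f x))"
  unfolding e_def by (intro continuous_intros)

lemma tendsto_e [tendsto_intros]: "(f \<longlongrightarrow> l) F \<Longrightarrow> ((\<lambda>x. e (f x)) \<longlongrightarrow> e l) F"
  unfolding e_def cis_conv_exp by (intro tendsto_intros)

text \<open>A weak form of Jordan's inequality. Up to \<open>pi / 3\<close> the mean value theorem
  applies with a cosine of at least 1/2; beyond it the sine already exceeds \<open>pi / 4\<close>,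
  the largest possible value of \<open>x / 2\<close>.\<close>

lemma half_le_sin:
  fixes x :: real assumes "0 \<le> x" "x \<le> pi / 2" shows "x / 2 \<le> sin x"
proof (cases "x \<le> pi / 3")
  case True
  show ?thesis
  proof (cases "x = 0")
    case False
    hence "0 < x" using assms by simp
    have d: "(sin has_real_derivative cos y) (at y)" for y by (auto intro!: derivative_eq_intros)
    obtain z where z: "0 < z" "z < x" "sin x - sin 0 = (x - 0) * cos z"
      using MVT2[OF \<open>0 < x\<close> d] by auto
    have "cos (pi / 3) \<le> cos z" using z True by (intro cos_monotone_0_pi_le) (auto simp: field_simps)
    hence "1 / 2 \<le> cos z" by (simp add: cos_60)
    thus ?thesis using z assms mult_left_mono[of "1/2" "cos z" x] by simp
  qed simp
next
  case False
  have "sin (pi / 3) \<le> sin x" using assms False by (intro sin_monotone_2pi_le) auto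
  moreover have "17 / 10 \<le> sqrt 3" by (rule real_le_rsqrt) (simp add: power2_eq_square)
  hence "17 / 20 \<le> sin (pi / 3)" by (simp add: sin_60)
  moreover have "x / 2 \<le> 4 / 4 * 0.8" using assms pi_less_4 pi_approx by simp
  ultimately show ?thesis by simp
qed

lemma norm_e_minus_1: "norm (e t - 1) = 2 * \<bar>sin (pi * t)\<bar>"
proof -
  have "(norm (e t - 1))\<^sup>2 = (cos (2 * (pi * t)) - 1)\<^sup>2 + (sin (2 * (pi * t)))\<^sup>2"
    by (simp add: e_def cmod_power2 mult.assoc)
  also have "\<dots> = 2 - 2 * cos (2 * (pi * t))"
    using sin_cos_squared_add[of "2 * (pi * t)"] by (simp add: power2_eq_square algebra_simps)
  also have "\<dots> = (2 * \<bar>sin (pi * t)\<bar>)\<^sup>2"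
    by (simp add: cos_double_sin power_mult_distrib)
  finally show ?thesis by (rule power2_eq_imp_eq) simp_all
qed

text \<open>A finite difference multiplies a Fourier coefficient by a factor \<open>e t - 1\<close>;
  the lower bound allows dividing by it, and half a period is the range on which it cannot
  degenerate.\<close>

lemma norm_e_minus_1_ge: assumes "\<bar>t\<bar> \<le> 1 / 2" shows "\<bar>t\<bar> \<le> norm (e t - 1)"
proof -
  have "\<bar>sin (pi * t)\<bar> = sin (pi * \<bar>t\<bar>)"
  proof -
    have "0 \<le> sin (pi * \<bar>t\<bar>)" using assms by (intro sin_ge_zero) auto
    thus ?thesis by (cases "0 \<le> t") auto
  qed
  moreover have "pi * \<bar>t\<bar> / 2 \<le> sin (pi * \<bar>t\<bar>)"
    using assms by (intro half_le_sin) (auto simp: field_simps)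
  moreover have "1 * \<bar>t\<bar> \<le> pi * \<bar>t\<bar>" using pi_gt3 by (intro mult_right_mono) auto
  ultimately show ?thesis by (simp add: norm_e_minus_1)
qed

lemma norm_e_minus_1_le: "norm (e t - 1) \<le> 2 * pi * \<bar>t\<bar>"
  using abs_sin_x_le_abs_x[of "pi * t"] by (simp add: norm_e_minus_1 abs_mult)

subsection \<open>Partial derivatives of smooth functions\<close>

lemma partials_append: "partials (vs @ ws) f = partials vs (partials ws f)"
  by (induction vs) simp_all

lemma smooth_partials: "smooth f \<Longrightarrow> set ws \<subseteq> Basis \<Longrightarrow> smooth (partials ws f)"
  unfolding smooth_def by (simp flip: partials_append)

lemma smooth_differentiable: "smooth f \<Longrightarrow> f differentiable (at x)"
  unfolding smooth_def by (metis empty_subsetI list.set(1) partials.simps(1))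

lemma smooth_continuous_on: "smooth f \<Longrightarrow> continuous_on S f"
  by (meson differentiable_imp_continuous_within continuous_at_imp_continuous_on smooth_differentiable)

lemma has_derivative_shift:
  "(f has_derivative D) (at (x + v)) \<Longrightarrow> ((\<lambda>x. f (x + v)) has_derivative D) (at x)"
  by (rule has_derivative_compose[where f = "\<lambda>x. x + v" and f' = "\<lambda>h. h" and g = f, simplified])
     (auto intro!: derivative_eq_intros)

lemma partials_shift:
  assumes "smooth f" "set vs \<subseteq> Basis"
  shows "partials vs (\<lambda>x. f (x + v)) = (\<lambda>x. partials vs f (x + v))"
  using assms(2)
proof (induction vs)
  case (Cons b vs)
  have "frechet_derivative (\<lambda>x. partials vs f (x + v)) (at x) = frechet_derivative (partials vs f) (at (x + v))" for x
    by (rule frechet_derivative_at[symmetric], rule has_derivative_shift)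
       (use Cons assms in \<open>auto simp: smooth_def frechet_derivative_works[symmetric]\<close>)
  thus ?case using Cons by simp
qed simp

lemma partials_shift_diff:
  assumes "smooth f" "set vs \<subseteq> Basis"
  shows "partials vs (\<lambda>x. f (x + v) - f x) = (\<lambda>x. partials vs f (x + v) - partials vs f x)"
  using assms(2)
proof (induction vs)
  case (Cons b vs)
  have D: "(partials vs f has_derivative frechet_derivative (partials vs f) (at x)) (at x)" for x
    using Cons assms by (auto simp: smooth_def frechet_derivative_works[symmetric])
  have "frechet_derivative (\<lambda>x. partials vs f (x + v) - partials vs f x) (at x) =
      (\<lambda>h. frechet_derivative (partials vs f) (at (x + v)) h - frechet_derivative (partials vs f) (at x) h)" for x
    by (rule frechet_derivative_at[symmetric]) (intro has_derivative_diff has_derivative_shift D)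
  thus ?case using Cons by simp
qed simp

lemma smooth_shift_diff:
  assumes "smooth f" shows "smooth (\<lambda>x. f (x + v) - f x)"
  unfolding smooth_def
proof (intro allI impI)
  fix vs :: "'a list" and x assume vs: "set vs \<subseteq> Basis"
  have D: "partials vs f differentiable (at x)" for x
    using assms vs by (auto simp: smooth_def)
  have "(\<lambda>x. partials vs f (x + v)) differentiable (at x)"
    using D[of "x + v"] has_derivative_shift unfolding differentiable_def by blast
  thus "partials vs (\<lambda>x. f (x + v) - f x) differentiable (at x)"
    by (simp add: partials_shift_diff[OF assms vs] D)
qed

lemma shift_diff_bound:
  assumes "\<And>x. g differentiable (at x)" "0 \<le> d"
    and "\<And>t. 0 \<le> t \<Longrightarrow> t \<le> d \<Longrightarrow> norm (frechet_derivative g (at (x + t *\<^sub>R b)) b) \<le> B"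
  shows "norm (g (x + d *\<^sub>R b) - g x) \<le> d * B"
proof -
  define p where "p t = g (x + t *\<^sub>R b)" for t
  have p: "(p has_derivative (\<lambda>h. h *\<^sub>R frechet_derivative g (at (x + t *\<^sub>R b)) b)) (at t within {0..d})" for t
  proof -
    have D: "(g has_derivative frechet_derivative g (at (x + t *\<^sub>R b))) (at (x + t *\<^sub>R b))"
      using assms(1) by (simp add: frechet_derivative_works)
    have "((\<lambda>t. x + t *\<^sub>R b) has_derivative (\<lambda>h. h *\<^sub>R b)) (at t)"
      by (auto intro!: derivative_eq_intros)
    from has_derivative_compose[OF this D]
    have "(p has_derivative (\<lambda>h. frechet_derivative g (at (x + t *\<^sub>R b)) (h *\<^sub>R b))) (at t)"
      by (simp add: p_def[abs_def])
    moreover have "frechet_derivative g (at (x + t *\<^sub>R b)) (h *\<^sub>R b) = h *\<^sub>R frechet_derivative g (at (x + t *\<^sub>R b)) b" for h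
      using has_derivative_linear[OF D] by (simp add: linear_scale)
    ultimately show ?thesis by (simp add: has_derivative_at_withinI)
  qed
  have "norm (p d - p 0) \<le> B * norm (d - 0)"
  proof (rule differentiable_bound[where S = "{0..d}"])
    show "onorm (\<lambda>h. h *\<^sub>R frechet_derivative g (at (x + t *\<^sub>R b)) b) \<le> B" if "t \<in> {0..d}" for t
      using assms(3)[of t] that by (intro onorm_le) (auto simp: mult.commute[of B] intro: mult_left_mono)
  qed (use p assms(2) in auto)
  thus ?thesis using assms(2) by (simp add: p_def mult.commute)
qed

text \<open>The discrete substitute for \<open>q\<close> integrations by parts. Differences commute
  with partial derivatives, so each application of the mean value inequality converts one derivative
  into one factor \<open>d\<close>.\<close>

lemma shift_diff_power_bound:
  assumes "smooth f" "b \<in> Basis" "0 \<le> d" "\<And>x. norm (partials (replicate q b) f x) \<le> B"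
  shows "norm (((\<lambda>g x. g (x + d *\<^sub>R b) - g x) ^^ q) f x) \<le> d ^ q * B"
  using assms(1,4)
proof (induction q arbitrary: f B)
  case (Suc q)
  let ?f = "\<lambda>x. f (x + d *\<^sub>R b) - f x"
  have rep: "set (replicate q b) \<subseteq> Basis" using assms(2) by auto
  have "norm (((\<lambda>g x. g (x + d *\<^sub>R b) - g x) ^^ q) ?f x) \<le> d ^ q * (d * B)"
  proof (rule Suc.IH)
    show "smooth ?f" by (rule smooth_shift_diff[OF Suc.prems(1)])
    show "norm (partials (replicate q b) ?f x) \<le> d * B" for x
      unfolding partials_shift_diff[OF Suc.prems(1) rep]
      by (rule shift_diff_bound)
         (use Suc.prems rep assms(3) in \<open>auto simp: smooth_def\<close>)
  qed
  thus ?case by (simp add: funpow_Suc_right mult.assoc mult.left_commute del: funpow.simps)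
qed simp

subsection \<open>Discrete Fourier coefficients of smooth periodic functions\<close>

definition lat :: "('a::euclidean_space \<Rightarrow> int) \<Rightarrow> 'a" where
  "lat m = (\<Sum>b\<in>Basis. of_int (m b) *\<^sub>R b)"

lemma lat_inner [simp]: "b \<in> Basis \<Longrightarrow> lat m \<bullet> b = of_int (m b)"
  by (simp add: lat_def)

lemma inner_lat: "lat m \<bullet> x = (\<Sum>b\<in>Basis. of_int (m b) * (x \<bullet> b))"
  unfolding lat_def inner_sum_left by (simp add: inner_commute[of x])

definition periodic :: "('a::euclidean_space \<Rightarrow> 'b) \<Rightarrow> bool" where
  "periodic f \<longleftrightarrow> (\<forall>x m. f (x + lat m) = f x)"

lemma periodic_partials:
  assumes "smooth f" "periodic f" "set vs \<subseteq> Basis"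
  shows "periodic (partials vs f)"
  unfolding periodic_def
proof (intro allI)
  fix x m
  have "(\<lambda>x. f (x + lat m)) = f" using assms(2) by (auto simp: periodic_def)
  thus "partials vs f (x + lat m) = partials vs f x"
    using partials_shift[OF assms(1,3), of "lat m"] by metis
qed

lemma periodic_bounded:
  fixes f :: "'a::euclidean_space \<Rightarrow> 'b::real_normed_vector"
  assumes "continuous_on UNIV f" "periodic f"
  obtains B where "\<And>x. norm (f x) \<le> B"
proof -
  have "compact (f ` cbox 0 (\<Sum>b\<in>Basis. b))"
    by (intro compact_continuous_image continuous_on_subset[OF assms(1)]) auto
  then obtain B where B: "\<And>y. y \<in> f ` cbox 0 (\<Sum>b\<in>Basis. b) \<Longrightarrow> norm y \<le> B"
    using compact_imp_bounded bounded_iff by metis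
  have "norm (f x) \<le> B" for x
  proof -
    define m :: "'a \<Rightarrow> int" where "m b = - \<lfloor>x \<bullet> b\<rfloor>" for b
    have "x + lat m \<in> cbox 0 (\<Sum>b\<in>Basis. b)"
      by (auto simp: mem_box inner_add_left m_def inner_sum_left_Basis[where f = "\<lambda>_. 1", simplified]) linarith+
    hence "norm (f (x + lat m)) \<le> B" by (intro B imageI)
    thus ?thesis using assms(2) by (simp add: periodic_def)
  qed
  thus thesis using that by blast
qed

definition grid :: "nat \<Rightarrow> ('a::euclidean_space \<Rightarrow> int) set" where
  "grid M = PiE Basis (\<lambda>_. {0..<int M})"

text \<open>A Riemann sum with mesh \<open>1 / M\<close> for the Fourier coefficient over the unit
  cube.\<close>

definition dft :: "nat \<Rightarrow> ('a::euclidean_space \<Rightarrow> complex) \<Rightarrow> ('a \<Rightarrow> int) \<Rightarrow> complex" where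
  "dft M f m = (\<Sum>g\<in>grid M. f (lat g /\<^sub>R M) * e (- (lat m \<bullet> lat g) / M)) / of_nat (M ^ DIM('a))"

lemma finite_grid [simp]: "finite (grid M)"
  by (simp add: grid_def finite_PiE)

lemma card_grid: "card (grid M :: ('a::euclidean_space \<Rightarrow> int) set) = M ^ DIM('a)"
  by (simp add: grid_def card_PiE)

lemma dft_bound:
  assumes "\<And>x. norm (f x) \<le> B" "0 < M"
  shows "norm (dft M f m) \<le> B"
proof -
  have "norm (\<Sum>g\<in>grid M. f (lat g /\<^sub>R M) * e (- (lat m \<bullet> lat g) / M)) \<le> (\<Sum>g\<in>(grid M :: ('a \<Rightarrow> int) set). B)"
    by (rule sum_norm_le) (simp add: norm_mult assms)
  thus ?thesis using assms(2) by (simp add: dft_def norm_divide card_grid field_simps norm_power)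
qed

lemma dft_shift:
  assumes f: "periodic f" and b: "b \<in> Basis" and M: "0 < M"
  shows "dft M (\<lambda>x. f (x + (1 / M) *\<^sub>R b)) m = e (of_int (m b) / M) * dft M f m"
proof -
  \<comment> \<open>\<open>s\<close> moves the grid cyclically by one step in direction
    \<open>b\<close>, \<open>r\<close> undoes it, and \<open>n g\<close> is minus the number of
    periods crossed. After division by \<open>M\<close>, wrapping around is a lattice translation,
    which \<open>f\<close> does not see.\<close>
  define s where "s g = g(b := (g b + 1) mod int M)" for g :: "'a \<Rightarrow> int"
  define r where "r g = g(b := (g b - 1) mod int M)" for g :: "'a \<Rightarrow> int"
  define n where "n g = - ((g b + 1) div int M)" for g :: "'a \<Rightarrow> int"
  have lat_s: "lat (s g) = lat g + b + of_int (n g * int M) *\<^sub>R b" for g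
  proof (rule euclidean_eqI)
    fix c :: 'a assume c: "c \<in> Basis"
    have "(g b + 1) mod int M = g b + 1 + n g * int M"
      using div_mult_mod_eq[of "g b + 1" "int M"] by (simp add: n_def algebra_simps)
    thus "lat (s g) \<bullet> c = (lat g + b + of_int (n g * int M) *\<^sub>R b) \<bullet> c"
      using b c by (simp add: s_def inner_add_left inner_Basis)
  qed
  have term_eq: "f (lat (s g) /\<^sub>R M) * e (- (lat m \<bullet> lat (s g)) / M) * e (of_int (m b) / M)
     = f (lat g /\<^sub>R M + (1 / M) *\<^sub>R b) * e (- (lat m \<bullet> lat g) / M)" for g
  proof -
    have "lat (s g) /\<^sub>R M = (lat g /\<^sub>R M + (1 / M) *\<^sub>R b) + lat (\<lambda>c. if c = b then n g else 0)"
    proof -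
      have "lat (\<lambda>c. if c = b then n g else 0) = of_int (n g) *\<^sub>R b"
        using b by (simp add: lat_def if_distrib[of of_int] if_distrib[of "\<lambda>x. x *\<^sub>R _"] sum.delta cong: if_cong)
      thus ?thesis using M by (simp add: lat_s scaleR_add_right divide_inverse mult.assoc)
    qed
    hence 1: "f (lat (s g) /\<^sub>R M) = f (lat g /\<^sub>R M + (1 / M) *\<^sub>R b)"
      using f by (simp add: periodic_def)
    have "- (lat m \<bullet> lat (s g)) / M + of_int (m b) / M = - (lat m \<bullet> lat g) / M + of_int (- (m b * n g))"
      using M b by (simp add: lat_s inner_add_right field_simps)
    hence "e (- (lat m \<bullet> lat (s g)) / M) * e (of_int (m b) / M) = e (- (lat m \<bullet> lat g) / M)"
      unfolding e_add[symmetric] by (metis e_add e_int mult.right_neutral)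
    thus ?thesis using 1 by (simp add: mult.assoc)
  qed
  have "(\<Sum>g\<in>grid M. f (lat g /\<^sub>R M + (1 / M) *\<^sub>R b) * e (- (lat m \<bullet> lat g) / M))
     = (\<Sum>g\<in>grid M. f (lat g /\<^sub>R M) * e (- (lat m \<bullet> lat g) / M) * e (of_int (m b) / M))"
  proof (rule sum.reindex_bij_witness[of _ r s])
    show "r (s g) = g" if "g \<in> grid M" for g
    proof -
      have "0 \<le> g b" "g b < int M" using that b by (auto simp: grid_def PiE_iff)
      hence "((g b + 1) mod int M - 1) mod int M = g b" by (simp add: mod_diff_left_eq)
      thus ?thesis by (simp add: r_def s_def)
    qed
    show "s (r g) = g" if "g \<in> grid M" for g
    proof -
      have "0 \<le> g b" "g b < int M" using that b by (auto simp: grid_def PiE_iff)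
      hence "((g b - 1) mod int M + 1) mod int M = g b" by (simp add: mod_add_left_eq)
      thus ?thesis by (simp add: r_def s_def)
    qed
    show "s g \<in> grid M" "r g \<in> grid M" if "g \<in> grid M" for g
      using that b M by (auto simp: grid_def s_def r_def PiE_iff extensional_def)
  qed (rule term_eq)
  thus ?thesis unfolding dft_def sum_distrib_right[symmetric] by simp
qed

lemma dft_diff: "dft M (\<lambda>x. f x - g x) m = dft M f m - dft M g m"
  by (simp add: dft_def left_diff_distrib sum_subtractf diff_divide_distrib)

lemma dft_shift_diff_power:
  assumes f: "periodic f" and b: "b \<in> Basis" and M: "0 < M"
  shows "dft M (((\<lambda>g x. g (x + (1 / M) *\<^sub>R b) - g x) ^^ q) f) m = (e (of_int (m b) / M) - 1) ^ q * dft M f m"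
  using f
proof (induction q arbitrary: f)
  case (Suc q)
  have "periodic (\<lambda>x. f (x + (1 / M) *\<^sub>R b) - f x)"
    using Suc.prems unfolding periodic_def by (metis add.assoc add.commute)
  from Suc.IH[OF this] show ?case
    by (simp add: funpow_Suc_right dft_diff dft_shift[OF Suc.prems b M] algebra_simps del: funpow.simps)
qed simp

text \<open>The \<open>q\<close>-fold difference has size \<open>M^-q\<close>, and its effect on the
  coefficient is at least \<open>|m b / M|^q\<close>; the powers of \<open>M\<close> cancel, so the
  decay is uniform in the grid.\<close>

lemma dft_decay:
  assumes f: "smooth f" "periodic f" and b: "b \<in> Basis" and M: "0 < M"
    and m: "2 * \<bar>m b\<bar> \<le> int M" and B: "\<And>x. norm (partials (replicate q b) f x) \<le> B"
  shows "\<bar>of_int (m b)\<bar> ^ q * norm (dft M f m) \<le> B"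
proof -
  have "\<bar>of_int (m b) / real M\<bar> \<le> 1 / 2"
  proof -
    have "2 * \<bar>of_int (m b)\<bar> \<le> real M" using m by linarith
    thus ?thesis using M by (simp add: field_simps)
  qed
  hence "\<bar>of_int (m b) / real M\<bar> ^ q \<le> norm (e (of_int (m b) / M) - 1) ^ q"
    by (intro power_mono norm_e_minus_1_ge) auto
  hence "\<bar>of_int (m b) / real M\<bar> ^ q * norm (dft M f m) \<le> norm (dft M (((\<lambda>g x. g (x + (1 / M) *\<^sub>R b) - g x) ^^ q) f) m)"
    unfolding dft_shift_diff_power[OF f(2) b M] norm_mult norm_power by (rule mult_right_mono) simp
  also have "\<dots> \<le> (1 / M) ^ q * B"
    by (rule dft_bound[OF shift_diff_power_bound[OF f(1) b _ B] M]) simp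
  finally show ?thesis using M by (simp add: power_divide field_simps)
qed

text \<open>The window is centred because the decay estimate holds for frequencies of size at most
  \<open>M / 2\<close>. Moving it to \<open>0..<M\<close> costs only a phase and leaves a geometric
  sum.\<close>

lemma sum_roots_of_unity:
  assumes H: "0 < H" and M: "M = 2 * H"
  shows "(\<Sum>n\<in>{- int H..<int H}. e (of_int n * of_int t / M)) = (if int M dvd t then of_nat M else 0)"
proof (cases "int M dvd t")
  case True
  then obtain s where "t = int M * s" by blast
  hence "e (of_int n * of_int t / M) = 1" for n
    using H M e_int[of "n * s"] by (simp add: field_simps)
  thus ?thesis using True M by simp
next
  case False
  define z where "z = e (of_int t / M)"
  have z1: "z \<noteq> 1"
  proof
    assume "z = 1"
    hence "sin (pi * (of_int t / M)) = 0" using norm_e_minus_1[of "of_int t / M"] by (simp add: z_def)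
    then obtain i where "pi * (of_int t / M) = of_int i * pi" using sin_zero_iff_int2 by blast
    hence "of_int t = of_int i * real M" using H M by (simp add: field_simps)
    hence "t = i * int M" by (metis of_int_eq_iff of_int_mult of_int_of_nat_eq)
    thus False using False by simp
  qed
  have "(\<Sum>n\<in>{- int H..<int H}. e (of_int n * of_int t / M)) = (\<Sum>j<M. e (- real H * of_int t / M) * z ^ j)"
  proof (rule sum.reindex_bij_witness[of _ "\<lambda>j. int j - int H" "\<lambda>n. nat (n + int H)"])
    fix n assume n: "n \<in> {- int H..<int H}"
    hence "real (nat (n + int H)) = of_int n + real H" by simp
    hence "- real H * of_int t / M + real (nat (n + int H)) * (of_int t / M) = of_int n * of_int t / M"
      by (simp add: algebra_simps add_divide_distrib)
    thus "e (- real H * of_int t / M) * z ^ nat (n + int H) = e (of_int n * of_int t / M)"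
      unfolding z_def e_power e_add[symmetric] by simp
  qed (auto simp: M)
  also have "\<dots> = e (- real H * of_int t / M) * ((z ^ M - 1) / (z - 1))"
    by (simp add: sum_distrib_left[symmetric] geometric_sum[OF z1])
  also have "z ^ M = 1" using H M by (simp add: z_def e_power)
  finally show ?thesis using False by simp
qed

lemma dft_inversion:
  fixes f :: "'a::euclidean_space \<Rightarrow> complex"
  assumes f: "periodic f" and H: "0 < H" and M: "M = 2 * H"
  shows "(\<Sum>m\<in>PiE Basis (\<lambda>_. {- int H..<int H}). dft M f m * e (lat m \<bullet> (lat g /\<^sub>R M))) = f (lat g /\<^sub>R M)"
proof -
  let ?X = "PiE Basis (\<lambda>_::'a. {- int H..<int H})"
  have M0: "0 < M" using H M by simp
  have orth: "(\<Sum>m\<in>?X. e (lat m \<bullet> (lat g - lat h) / M)) = (\<Prod>b\<in>Basis. if int M dvd g b - h b then of_nat M else 0)" for h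
  proof -
    have "e (lat m \<bullet> (lat g - lat h) / M) = (\<Prod>b\<in>Basis. e (of_int (m b) * of_int (g b - h b) / M))" for m
      unfolding inner_lat sum_divide_distrib by (subst e_sum) (simp_all add: inner_diff_left)
    hence "(\<Sum>m\<in>?X. e (lat m \<bullet> (lat g - lat h) / M))
       = (\<Prod>b\<in>Basis. \<Sum>n\<in>{- int H..<int H}. e (of_int n * of_int (g b - h b) / M))"
      by (subst prod_sum_PiE) auto
    thus ?thesis by (simp add: sum_roots_of_unity[OF H M] del: of_int_diff)
  qed
  \<comment> \<open>The point \<open>g\<close> may lie outside the grid; orthogonality picks out its
    residue \<open>g0\<close>, and periodicity of \<open>f\<close> removes the difference.\<close>
  define g0 where "g0 = restrict (\<lambda>b. g b mod int M) Basis"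
  have g0: "g0 \<in> grid M" using M0 by (simp add: g0_def grid_def)
  have dvd: "(\<forall>b\<in>Basis. int M dvd g b - h b) \<longleftrightarrow> h = g0" if "h \<in> grid M" for h
  proof
    assume *: "\<forall>b\<in>Basis. int M dvd g b - h b"
    show "h = g0"
    proof
      fix b show "h b = g0 b"
      proof (cases "b \<in> Basis")
        case True
        hence "h b = h b mod int M" using that by (auto simp: grid_def PiE_iff)
        also have "\<dots> = g b mod int M" using * True by (metis mod_eq_dvd_iff)
        finally show ?thesis using True by (simp add: g0_def)
      qed (use that in \<open>auto simp: grid_def g0_def PiE_iff extensional_def\<close>)
    qed
  qed (auto simp: g0_def mod_eq_dvd_iff[symmetric])
  have "(\<Sum>m\<in>?X. dft M f m * e (lat m \<bullet> (lat g /\<^sub>R M)))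
      = (\<Sum>m\<in>?X. \<Sum>h\<in>grid M. f (lat h /\<^sub>R M) / of_nat (M ^ DIM('a)) * e (lat m \<bullet> (lat g - lat h) / M))"
  proof (rule sum.cong[OF refl])
    fix m
    have "e (- (lat m \<bullet> lat h) / M) * e (lat m \<bullet> (lat g /\<^sub>R M)) = e (lat m \<bullet> (lat g - lat h) / M)" for h
      unfolding e_add[symmetric] by (simp add: inner_diff_right field_simps diff_divide_distrib)
    thus "dft M f m * e (lat m \<bullet> (lat g /\<^sub>R M))
      = (\<Sum>h\<in>grid M. f (lat h /\<^sub>R M) / of_nat (M ^ DIM('a)) * e (lat m \<bullet> (lat g - lat h) / M))"
      by (simp add: dft_def sum_distrib_right sum_divide_distrib mult.assoc)
  qed
  also have "\<dots> = (\<Sum>h\<in>grid M. f (lat h /\<^sub>R M) / of_nat (M ^ DIM('a)) * (\<Sum>m\<in>?X. e (lat m \<bullet> (lat g - lat h) / M)))"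
    by (subst sum.swap) (simp add: sum_distrib_left)
  also have "\<dots> = (\<Sum>h\<in>grid M. if h = g0 then f (lat h /\<^sub>R M) else 0)"
  proof (rule sum.cong[OF refl])
    fix h :: "'a \<Rightarrow> int" assume h: "h \<in> grid M"
    have "(\<Prod>b\<in>(Basis::'a set). if int M dvd g b - h b then of_nat M else 0 :: complex)
       = (if h = g0 then of_nat (M ^ DIM('a)) else 0)"
      unfolding dvd[OF h, symmetric] by (auto intro: prod_zero)
    thus "f (lat h /\<^sub>R M) / of_nat (M ^ DIM('a)) * (\<Sum>m\<in>?X. e (lat m \<bullet> (lat g - lat h) / M))
      = (if h = g0 then f (lat h /\<^sub>R M) else 0)"
      unfolding orth using M0 by simp
  qed
  also have "\<dots> = f (lat g0 /\<^sub>R M)" using g0 by (simp add: sum.delta)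
  also have "\<dots> = f (lat g /\<^sub>R M)"
  proof -
    have "lat g /\<^sub>R M = lat g0 /\<^sub>R M + lat (\<lambda>b. g b div int M)"
    proof (rule euclidean_eqI)
      fix b :: 'a assume b: "b \<in> Basis"
      define q r where "q = g b div int M" and "r = g b mod int M"
      have g: "g b = q * int M + r" by (simp add: q_def r_def)
      have "(lat g0 /\<^sub>R M + lat (\<lambda>b. g b div int M)) \<bullet> b = of_int r / M + of_int q"
        using b by (simp add: inner_add_left g0_def field_simps del: of_int_div flip: q_def r_def)
      also have "\<dots> = (lat g /\<^sub>R M) \<bullet> b" using b M0 by (simp add: g field_simps)
      finally show "(lat g /\<^sub>R M) \<bullet> b = (lat g0 /\<^sub>R M + lat (\<lambda>b. g b div int M)) \<bullet> b" by (rule sym)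
    qed
    thus ?thesis using f by (simp add: periodic_def)
  qed
  finally show ?thesis .
qed

subsection \<open>Fourier series of smooth periodic functions\<close>

text \<open>Any finite set of functions lies in a finite product box, over which the sum factorizes
  into one-dimensional sums.\<close>

lemma summable_on_prod_PiE:
  fixes f :: "'b \<Rightarrow> real"
  assumes A: "finite A" and nonneg: "\<And>x. 0 \<le> f x" and f: "f summable_on B"
  shows "(\<lambda>g. \<Prod>a\<in>A. f (g a)) summable_on (PiE A (\<lambda>_. B))"
proof (rule nonneg_bdd_above_summable_on)
  show "bdd_above (sum (\<lambda>g. \<Prod>a\<in>A. f (g a)) ` {F. F \<subseteq> PiE A (\<lambda>_. B) \<and> finite F})"
  proof (rule bdd_aboveI2)
    fix F assume F: "F \<in> {F. F \<subseteq> PiE A (\<lambda>_. B) \<and> finite F}"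
    define C where "C = (\<Union>g\<in>F. g ` A)"
    have C: "finite C" "C \<subseteq> B" using F A by (auto simp: C_def)
    have sub: "F \<subseteq> PiE A (\<lambda>_. C)"
    proof
      fix g assume g: "g \<in> F"
      hence "g \<in> PiE A (\<lambda>_. B)" using F by blast
      moreover have "g a \<in> C" if "a \<in> A" for a using g that unfolding C_def by blast
      ultimately show "g \<in> PiE A (\<lambda>_. C)" by (simp add: PiE_iff)
    qed
    have "(\<Sum>g\<in>F. \<Prod>a\<in>A. f (g a)) \<le> (\<Sum>g\<in>PiE A (\<lambda>_. C). \<Prod>a\<in>A. f (g a))"
      by (rule sum_mono2) (use sub C A nonneg in \<open>auto intro!: finite_PiE prod_nonneg\<close>)
    also have "\<dots> = (\<Prod>a\<in>A. \<Sum>x\<in>C. f x)"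
      using prod_sum_PiE[of A "\<lambda>_. C" "\<lambda>_. f"] A C by simp
    also have "\<dots> \<le> (\<Prod>a\<in>A. infsum f B)"
      using C f nonneg by (intro prod_mono) (auto intro!: sum_nonneg finite_sum_le_infsum)
    finally show "(\<Sum>g\<in>F. \<Prod>a\<in>A. f (g a)) \<le> (\<Prod>a\<in>A. infsum f B)" .
  qed
qed (simp add: nonneg prod_nonneg)

lemma summable_on_int_inverse_square: "(\<lambda>n::int. 1 / (1 + (of_int n)\<^sup>2) :: real) summable_on UNIV"
proof -
  have s: "summable (\<lambda>n::nat. 1 / (1 + (real n)\<^sup>2))"
  proof (rule summable_comparison_test_ev)
    show "summable (\<lambda>n. inverse (real n ^ 2))" by (rule inverse_power_summable) simp
    show "\<forall>\<^sub>F n in sequentially. norm (1 / (1 + (real n)\<^sup>2)) \<le> inverse (real n ^ 2)"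
      using eventually_gt_at_top[of 0]
      by eventually_elim (auto simp: divide_inverse intro!: le_imp_inverse_le)
  qed
  have nat: "(\<lambda>n::nat. 1 / (1 + (real n)\<^sup>2)) summable_on UNIV"
    using s by (subst summable_on_UNIV_nonneg_real_iff) auto
  have 1: "(\<lambda>n::int. 1 / (1 + (of_int n)\<^sup>2) :: real) summable_on range int"
    by (subst summable_on_reindex) (use nat in \<open>auto simp: o_def\<close>)
  have 2: "(\<lambda>n::int. 1 / (1 + (of_int n)\<^sup>2) :: real) summable_on range (\<lambda>n. - int n)"
    by (subst summable_on_reindex) (use nat in \<open>auto simp: o_def inj_on_def\<close>)
  have "UNIV = range int \<union> range (\<lambda>n. - int n)"
    by (auto simp: image_iff) (metis nonneg_int_cases nonpos_int_cases linear)
  thus ?thesis using summable_on_union[OF 1 2] by metis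
qed

text \<open>Frequencies are carried as a sequence, so that all series run over \<open>nat\<close>.
  Repetitions are allowed, and a constant \<open>m\<close> describes a single exponential.\<close>

definition rapid :: "(nat \<Rightarrow> complex) \<Rightarrow> (nat \<Rightarrow> 'a::real_normed_vector) \<Rightarrow> bool" where
  "rapid c m \<longleftrightarrow> (\<forall>p::nat. summable (\<lambda>j. norm (c j) * (1 + norm (m j)) ^ p))"

text \<open>The coefficients are limits of discrete Fourier coefficients along a diagonal subsequence of
  grids. Their decay is uniform in the grid, which allows passing to the limit in the sum.\<close>

theorem smooth_periodic_Fourier_series:
  fixes f :: "'a::euclidean_space \<Rightarrow> complex"
  assumes f: "smooth f" "periodic f"
  obtains c and m :: "nat \<Rightarrow> 'a \<Rightarrow> int"
  where "rapid c (\<lambda>j. lat (m j))" and "\<And>x. (\<lambda>j. c j * e (lat (m j) \<bullet> x)) sums f x"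
proof -
  define X where "X = PiE (Basis :: 'a set) (\<lambda>_. UNIV :: int set)"
  define box where "box H = PiE (Basis :: 'a set) (\<lambda>_. {- int H..<int H})" for H
  have box: "finite (box H)" "box H \<subseteq> X" for H
    by (auto simp: box_def X_def intro!: finite_PiE)
  have X: "countable X" "infinite X"
  proof -
    show "countable X" unfolding X_def by (intro countable_PiE) auto
    have "inj (\<lambda>n::int. restrict (\<lambda>_. n) (Basis :: 'a set))"
      by (rule injI) (metis SOME_Basis restrict_apply')
    moreover have "range (\<lambda>n::int. restrict (\<lambda>_. n) (Basis :: 'a set)) \<subseteq> X" by (auto simp: X_def)
    ultimately show "infinite X" by (meson infinite_UNIV_int finite_imageD finite_subset)
  qed
  define m where "m = from_nat_into X"
  have m: "bij_betw m UNIV X" unfolding m_def by (rule bij_betw_from_nat_into[OF X])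
  define s where "s k = 1 + (\<Sum>b\<in>Basis. \<bar>real_of_int (k b)\<bar>)" for k :: "'a \<Rightarrow> int"
  have s1: "1 \<le> s k" for k by (simp add: s_def sum_nonneg)
  let ?D = "DIM('a)"
  \<comment> \<open>The box has half-width \<open>r + 1\<close> and the grid twice that size, so
    every frequency kept satisfies the restriction of \<open>dft_decay\<close>.\<close>
  define a where "a r k = (if k \<in> box (r + 1) then dft (2 * (r + 1)) f k else 0)" for r k
  have "\<exists>K. \<forall>r k. s k ^ q * norm (a r k) \<le> K" for q
  proof -
    have ex: "\<exists>B. \<forall>x. norm (partials (replicate n b) f x) \<le> B" if "b \<in> Basis" for n b
    proof -
      have sub: "set (replicate n b) \<subseteq> Basis" using that by auto
      show ?thesis
        by (rule periodic_bounded[OF smooth_continuous_on[OF smooth_partials[OF f(1) sub]]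
              periodic_partials[OF f sub]]) blast
    qed
    define B where "B n b = (SOME B. \<forall>x. norm (partials (replicate n b) f x) \<le> B)" for n b
    have B: "norm (partials (replicate n b) f x) \<le> B n b" if "b \<in> Basis" for n b x
      using someI_ex[OF ex[OF that, of n]] unfolding B_def by blast
    \<comment> \<open>The bound of order 0 covers the frequency 0, at which powers of the components
      yield nothing.\<close>
    define B' where "B' = (\<Sum>b\<in>Basis. B 0 b + B q b)"
    have B0: "0 \<le> B n b" if "b \<in> Basis" for n b using B[OF that] norm_ge_zero order_trans by blast
    have le: "B 0 b \<le> B'" "B q b \<le> B'" if "b \<in> Basis" for b
      using member_le_sum[of b Basis "\<lambda>b. B 0 b + B q b"] that B0[of b 0] B0[of b q] B0
      by (fastforce simp: B'_def)+
    have "0 \<le> B'" unfolding B'_def by (intro sum_nonneg add_nonneg_nonneg B0)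
    have "s k ^ q * norm (a r k) \<le> (1 + real ?D) ^ q * B'" for r k
    proof (cases "k \<in> box (r + 1)")
      case True
      have k: "2 * \<bar>k b\<bar> \<le> int (2 * (r + 1))" if "b \<in> Basis" for b
        using True that by (force simp: box_def PiE_iff)
      \<comment> \<open>The largest component dominates \<open>s k\<close>, so decay in that single
        direction is enough.\<close>
      obtain b where b: "b \<in> Basis" "\<And>c. c \<in> Basis \<Longrightarrow> \<bar>k c\<bar> \<le> \<bar>k b\<bar>"
      proof -
        have "Max ((\<lambda>b. \<bar>k b\<bar>) ` (Basis :: 'a set)) \<in> (\<lambda>b. \<bar>k b\<bar>) ` Basis" by (intro Max_in) auto
        then obtain b where b: "Max ((\<lambda>b. \<bar>k b\<bar>) ` (Basis :: 'a set)) = \<bar>k b\<bar>" "b \<in> Basis"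
          by (rule imageE)
        show thesis
        proof (rule that[OF b(2)])
          fix c :: 'a assume "c \<in> Basis"
          thus "\<bar>k c\<bar> \<le> \<bar>k b\<bar>" unfolding b(1)[symmetric] by (intro Max_ge) auto
        qed
      qed
      have 0: "norm (a r k) \<le> B'"
        using dft_decay[where M = "2 * (r + 1)" and m = k and q = 0, OF f b(1) _ k[OF b(1)] B[OF b(1)]]
          True le(1)[OF b(1)] by (simp add: a_def)
      have q: "\<bar>real_of_int (k b)\<bar> ^ q * norm (a r k) \<le> B'"
        using dft_decay[where M = "2 * (r + 1)" and m = k and q = q, OF f b(1) _ k[OF b(1)] B[OF b(1)]]
          True le(2)[OF b(1)] by (simp add: a_def)
      have "s k \<le> 1 + real ?D * \<bar>real_of_int (k b)\<bar>"
        unfolding s_def using sum_bounded_above[of Basis "\<lambda>c. \<bar>real_of_int (k c)\<bar>" "\<bar>real_of_int (k b)\<bar>"] b(2)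
        by (auto simp flip: of_int_abs)
      show ?thesis
      proof (cases "k b = 0")
        case True
        hence "s k ^ q \<le> 1" using \<open>s k \<le> _\<close> s1[of k] by (intro power_le_one) auto
        moreover have "1 \<le> (1 + real ?D) ^ q" by (rule one_le_power) simp
        ultimately have "s k ^ q \<le> (1 + real ?D) ^ q" by linarith
        thus ?thesis using 0 s1[of k] by (intro mult_mono) auto
      next
        case False
        hence "1 \<le> \<bar>real_of_int (k b)\<bar>" by linarith
        hence "s k \<le> (1 + real ?D) * \<bar>real_of_int (k b)\<bar>" using \<open>s k \<le> _\<close> by (simp add: algebra_simps)
        hence "s k ^ q \<le> ((1 + real ?D) * \<bar>real_of_int (k b)\<bar>) ^ q" using s1[of k] by (intro power_mono) auto
        hence "s k ^ q * norm (a r k) \<le> ((1 + real ?D) * \<bar>real_of_int (k b)\<bar>) ^ q * norm (a r k)"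
          by (rule mult_right_mono) simp
        also have "\<dots> = (1 + real ?D) ^ q * (\<bar>real_of_int (k b)\<bar> ^ q * norm (a r k))" by (simp add: power_mult_distrib)
        also have "\<dots> \<le> (1 + real ?D) ^ q * B'" using q by (intro mult_left_mono) auto
        finally show ?thesis .
      qed
    qed (use \<open>0 \<le> B'\<close> in \<open>simp add: a_def\<close>)
    thus ?thesis by blast
  qed
  then obtain K where K: "\<And>q r k. s k ^ q * norm (a r k) \<le> K q" by metis
  have K0: "0 \<le> K q" for q
    using K[of undefined q 0] s1[of undefined] by (smt (verit) mult_nonneg_nonneg norm_ge_zero zero_le_power)
  obtain d :: "nat \<Rightarrow> nat" where d: "strict_mono d" and conv: "\<And>j. convergent (\<lambda>r. a (d r) (m j))"
  proof -
    interpret subseqs "\<lambda>j d. convergent (\<lambda>r. a (d r) (m j))"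
    proof
      fix j and d :: "nat \<Rightarrow> nat" assume "strict_mono d"
      have "bounded (range (\<lambda>r. a (d r) (m j)))"
        using K[of "m j" 0] by (auto simp: bounded_iff)
      then obtain l r where "strict_mono r" "((\<lambda>r. a (d r) (m j)) \<circ> r) \<longlonglongrightarrow> l"
        using bounded_imp_convergent_subsequence by blast
      thus "\<exists>r. strict_mono r \<and> convergent (\<lambda>i. a ((d \<circ> r) i) (m j))"
        by (auto simp: o_def convergent_def)
    qed
    have "convergent (\<lambda>r. a (diagseq r) (m j))" for j
    proof -
      have "convergent (\<lambda>r. a ((diagseq \<circ> (+) (Suc j)) r) (m j))"
      proof (rule diagseq_holds)
        show "convergent (\<lambda>i. a ((s \<circ> r) i) (m n))" if "strict_mono r" "convergent (\<lambda>i. a (s i) (m n))" for r s n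
          using convergent_subseq_convergent[OF that(2,1)] by (simp add: o_def)
      qed
      hence "convergent (\<lambda>r. a (diagseq (r + Suc j)) (m j))" by (simp add: o_def add.commute)
      thus ?thesis using convergent_ignore_initial_segment[of "\<lambda>r. a (diagseq r) (m j)" "Suc j"] by simp
    qed
    thus thesis using that[OF subseq_diagseq] by blast
  qed
  define c where "c j = lim (\<lambda>r. a (d r) (m j))" for j
  have c: "(\<lambda>r. a (d r) (m j)) \<longlonglongrightarrow> c j" for j
    using conv by (simp add: c_def convergent_LIMSEQ_iff)
  have Kc: "s (m j) ^ q * norm (c j) \<le> K q" for j q
    by (rule LIMSEQ_le_const2[OF tendsto_mult_left[OF tendsto_norm[OF c]]]) (use K in auto)
  \<comment> \<open>The exponent \<open>2 * ?D\<close> makes \<open>W\<close> smaller than the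
    product over coordinates of \<open>1 / (1 + n^2)\<close>, which is summable over the lattice.
    Every polynomial weight is therefore handled by spending \<open>2 * ?D\<close> extra powers of
    decay.\<close>
  define W where "W j = 1 / s (m j) ^ (2 * ?D)" for j
  have W: "summable W"
  proof -
    have "(\<lambda>k. \<Prod>b\<in>Basis. 1 / (1 + (real_of_int (k b))\<^sup>2)) summable_on X"
      unfolding X_def by (rule summable_on_prod_PiE[OF _ _ summable_on_int_inverse_square]) auto
    hence "(\<lambda>j. \<Prod>b\<in>Basis. 1 / (1 + (real_of_int (m j b))\<^sup>2)) summable_on UNIV"
      using summable_on_reindex_bij_betw[OF m, of "\<lambda>k. \<Prod>b\<in>Basis. 1 / (1 + (real_of_int (k b))\<^sup>2)"] by simp
    hence "summable (\<lambda>j. \<Prod>b\<in>Basis. 1 / (1 + (real_of_int (m j b))\<^sup>2))"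
      by (subst (asm) summable_on_UNIV_nonneg_real_iff) (auto intro!: prod_nonneg)
    moreover have "norm (W j) \<le> (\<Prod>b\<in>Basis. 1 / (1 + (real_of_int (m j b))\<^sup>2))" for j
    proof -
      have "(\<Prod>b\<in>Basis. 1 + (real_of_int (m j b))\<^sup>2) \<le> (\<Prod>b\<in>(Basis::'a set). (s (m j))\<^sup>2)"
      proof (intro prod_mono conjI)
        fix b :: 'a assume b: "b \<in> Basis"
        have "1 + \<bar>real_of_int (m j b)\<bar> \<le> s (m j)"
          unfolding s_def using member_le_sum[of b Basis "\<lambda>b. \<bar>real_of_int (m j b)\<bar>"] b by auto
        hence "(1 + \<bar>real_of_int (m j b)\<bar>)\<^sup>2 \<le> (s (m j))\<^sup>2" by (intro power_mono) auto
        thus "1 + (real_of_int (m j b))\<^sup>2 \<le> (s (m j))\<^sup>2" by (simp add: power2_eq_square algebra_simps)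
      qed auto
      also have "\<dots> = s (m j) ^ (2 * ?D)" by (simp add: power_mult)
      finally have "1 / s (m j) ^ (2 * ?D) \<le> 1 / (\<Prod>b\<in>Basis. 1 + (real_of_int (m j b))\<^sup>2)"
        by (intro divide_left_mono mult_pos_pos prod_pos)
           (use s1[of "m j"] in \<open>auto intro!: add_pos_nonneg zero_less_power\<close>)
      thus ?thesis using s1[of "m j"] by (simp add: W_def prod_dividef)
    qed
    ultimately show ?thesis using summable_comparison_test' by blast
  qed
  have bound: "norm z * s (m j) ^ p \<le> K (p + 2 * ?D) * W j" if "s (m j) ^ (p + 2 * ?D) * norm z \<le> K (p + 2 * ?D)" for z :: complex and j p
    using that s1[of "m j"] by (simp add: W_def power_add field_simps)
  have "rapid c (\<lambda>j. lat (m j))"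
    unfolding rapid_def
  proof
    fix p
    show "summable (\<lambda>j. norm (c j) * (1 + norm (lat (m j))) ^ p)"
    proof (rule summable_comparison_test')
      show "summable (\<lambda>j. K (p + 2 * ?D) * W j)" using W by (rule summable_mult)
      fix j
      have "norm (lat (m j)) \<le> (\<Sum>b\<in>Basis. \<bar>real_of_int (m j b)\<bar>)"
        unfolding lat_def by (rule order_trans[OF norm_sum]) (auto intro!: sum_mono)
      hence "(1 + norm (lat (m j))) ^ p \<le> s (m j) ^ p" by (intro power_mono) (auto simp: s_def)
      hence "norm (c j) * (1 + norm (lat (m j))) ^ p \<le> norm (c j) * s (m j) ^ p" by (rule mult_left_mono) simp
      also have "\<dots> \<le> K (p + 2 * ?D) * W j" by (rule bound[OF Kc])
      finally show "norm (norm (c j) * (1 + norm (lat (m j))) ^ p) \<le> K (p + 2 * ?D) * W j" by simp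
    qed
  qed
  moreover have "(\<lambda>j. c j * e (lat (m j) \<bullet> x)) sums f x" for x
  proof -
    define M where "M r = 2 * (d r + 1)" for r
    \<comment> \<open>Discrete inversion is exact at grid points, so \<open>x\<close> is approached
      by its roundings to the grids.\<close>
    define g where "g r b = \<lfloor>real (M r) * (x \<bullet> b)\<rfloor>" for r and b :: 'a
    define y where "y r = lat (g r) /\<^sub>R M r" for r
    have "(\<lambda>r. y r \<bullet> b) \<longlonglongrightarrow> x \<bullet> b" if "b \<in> Basis" for b
    proof (rule Lim_null_comparison[THEN LIM_zero_cancel])
      have "\<bar>y r \<bullet> b - x \<bullet> b\<bar> \<le> 1 / real (Suc r)" for r
      proof -
        have "\<bar>real_of_int (g r b) - real (M r) * (x \<bullet> b)\<bar> \<le> 1" unfolding g_def by linarith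
        moreover have M0: "0 < real (M r)" by (simp add: M_def)
        moreover have "real (M r) * (y r \<bullet> b - x \<bullet> b) = real_of_int (g r b) - real (M r) * (x \<bullet> b)"
          using M0 that by (simp add: y_def field_simps)
        ultimately have "real (M r) * \<bar>y r \<bullet> b - x \<bullet> b\<bar> \<le> 1" by (metis abs_mult abs_of_pos)
        moreover have "Suc r \<le> M r" using strict_mono_imp_increasing[OF d, of r] by (simp add: M_def)
        hence "real (Suc r) * \<bar>y r \<bullet> b - x \<bullet> b\<bar> \<le> real (M r) * \<bar>y r \<bullet> b - x \<bullet> b\<bar>"
          by (intro mult_right_mono) auto
        ultimately show ?thesis by (simp add: field_simps)
      qed
      thus "\<forall>\<^sub>F r in sequentially. norm (y r \<bullet> b - x \<bullet> b) \<le> 1 / real (Suc r)" by simp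
      show "(\<lambda>r. 1 / real (Suc r)) \<longlonglongrightarrow> 0" by (rule LIMSEQ_Suc[OF lim_1_over_n])
    qed
    hence y: "y \<longlonglongrightarrow> x" by (subst tendsto_componentwise_iff) auto
    have "isCont f x" using smooth_continuous_on[OF f(1), of UNIV] by (simp add: continuous_on_eq_continuous_at)
    hence fy: "(\<lambda>r. f (y r)) \<longlonglongrightarrow> f x" using y by (rule isCont_tendsto_compose)
    have sums: "(\<lambda>j. a (d r) (m j) * e (lat (m j) \<bullet> y r)) sums f (y r)" for r
    proof -
      define J where "J = {j. m j \<in> box (d r + 1)}"
      have bij: "bij_betw m J (box (d r + 1))"
        using m box(2)[of "d r + 1"] unfolding J_def bij_betw_def by (auto simp: inj_on_def)
      hence "finite J" using box(1) bij_betw_finite by blast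
      hence "(\<lambda>j. a (d r) (m j) * e (lat (m j) \<bullet> y r)) sums (\<Sum>j\<in>J. a (d r) (m j) * e (lat (m j) \<bullet> y r))"
        by (rule sums_finite) (simp add: a_def J_def)
      also have "(\<Sum>j\<in>J. a (d r) (m j) * e (lat (m j) \<bullet> y r)) = (\<Sum>k\<in>box (d r + 1). a (d r) k * e (lat k \<bullet> y r))"
        by (rule sum.reindex_bij_betw[OF bij])
      also have "\<dots> = (\<Sum>k\<in>box (d r + 1). dft (M r) f k * e (lat k \<bullet> y r))"
        by (rule sum.cong) (auto simp: a_def M_def)
      also have "\<dots> = f (y r)"
        unfolding box_def y_def by (rule dft_inversion[OF f(2)]) (auto simp: M_def)
      finally show ?thesis .
    qed
    have ev: "\<forall>\<^sub>F (j, r) in at_top \<times>\<^sub>F sequentially. norm (a (d r) (m j) * e (lat (m j) \<bullet> y r)) \<le> K (2 * ?D) * W j"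
      using bound[where p = 0, simplified, OF K] by (intro always_eventually) (auto simp: norm_mult)
    have lim: "(\<lambda>r. a (d r) (m j) * e (lat (m j) \<bullet> y r)) \<longlonglongrightarrow> c j * e (lat (m j) \<bullet> x)" for j
      by (intro tendsto_intros c y)
    from tannerys_theorem[OF lim ev summable_mult[OF W]]
    have sm: "summable (\<lambda>j. norm (c j * e (lat (m j) \<bullet> x)))"
      and l: "(\<lambda>r. \<Sum>j. a (d r) (m j) * e (lat (m j) \<bullet> y r)) \<longlonglongrightarrow> (\<Sum>j. c j * e (lat (m j) \<bullet> x))" by auto
    have "(\<Sum>j. a (d r) (m j) * e (lat (m j) \<bullet> y r)) = f (y r)" for r
      using sums_unique[OF sums] by (rule sym)
    from l[unfolded this] have "(\<Sum>j. c j * e (lat (m j) \<bullet> x)) = f x"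
      using fy by (rule LIMSEQ_unique)
    thus ?thesis using summable_sums[OF summable_norm_cancel[OF sm]] by simp
  qed
  ultimately show thesis by (rule that)
qed

section \<open>Schwartz functions and the Fourier transform\<close>

subsection \<open>Closure properties of Schwartz functions\<close>

text \<open>Higher partial derivatives need not be computed if the function lies in a class that is
  stable under first derivatives and decays rapidly.\<close>

lemma schwartzI_class:
  fixes f :: "'a::euclidean_space \<Rightarrow> complex"
  assumes f: "P f"
    and diff: "\<And>f x. P f \<Longrightarrow> f differentiable (at x)"
    and deriv: "\<And>f b. P f \<Longrightarrow> b \<in> Basis \<Longrightarrow> P (\<lambda>x. frechet_derivative f (at x) b)"
    and bound: "\<And>f m. P f \<Longrightarrow> \<exists>C. \<forall>x. norm x ^ m * norm (f x) \<le> C"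
  shows "schwartz f"
proof -
  have P: "P (partials vs f)" if "set vs \<subseteq> Basis" for vs
    using that by (induction vs) (auto intro: f deriv)
  show ?thesis
    unfolding schwartz_def smooth_def
  proof (intro conjI allI impI)
    fix vs :: "'a list" and m assume vs: "set vs \<subseteq> Basis"
    obtain C where "\<forall>x. norm x ^ m * norm (partials vs f x) \<le> C" using bound[OF P[OF vs]] by blast
    thus "bounded (range (\<lambda>x. norm x ^ m * norm (partials vs f x)))"
      by (auto simp: bounded_iff abs_mult)
  qed (use P diff in blast)
qed

lemma schwartz_differentiable: "schwartz f \<Longrightarrow> f differentiable (at x)"
  by (simp add: schwartz_def smooth_differentiable)

lemma schwartz_has_derivative: "schwartz f \<Longrightarrow> (f has_derivative frechet_derivative f (at x)) (at x)"
  using schwartz_differentiable frechet_derivative_works by blast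

lemma schwartz_continuous_on: "schwartz f \<Longrightarrow> continuous_on S f"
  by (simp add: schwartz_def smooth_continuous_on)

lemma schwartz_measurable: "schwartz f \<Longrightarrow> f \<in> borel_measurable borel"
  by (simp add: borel_measurable_continuous_onI schwartz_continuous_on)

lemma schwartz_deriv:
  assumes "schwartz f" "b \<in> Basis"
  shows "schwartz (\<lambda>x. frechet_derivative f (at x) b)"
proof -
  have eq: "partials vs (\<lambda>x. frechet_derivative f (at x) b) = partials (vs @ [b]) f" for vs
    by (simp add: partials_append)
  show ?thesis using assms unfolding schwartz_def smooth_def eq by auto
qed

lemma schwartz_norm_power_bound:
  assumes "schwartz f" shows "\<exists>C. \<forall>x. norm x ^ m * norm (f x) \<le> C"
proof -
  have "bounded (range (\<lambda>x. norm x ^ m * norm (partials [] f x)))"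
    using assms unfolding schwartz_def by (metis empty_subsetI list.set(1))
  then obtain C where "\<And>x. norm (norm x ^ m * norm (f x)) \<le> C" by (auto simp: bounded_iff)
  thus ?thesis by (metis abs_le_D1 real_norm_def)
qed

lemma schwartz_bound:
  assumes "schwartz f"
  obtains C where "0 \<le> C" "\<And>x. (1 + norm x) ^ m * norm (f x) \<le> C"
proof -
  obtain C0 Cm where C: "\<And>x. norm x ^ 0 * norm (f x) \<le> C0" "\<And>x. norm x ^ m * norm (f x) \<le> Cm"
    using schwartz_norm_power_bound[OF assms] by metis
  have "(1 + norm x) ^ m * norm (f x) \<le> 2 ^ m * (C0 + Cm)" for x
  proof -
    have "(1 + norm x) ^ m \<le> (2 * max 1 (norm x)) ^ m" by (intro power_mono) auto
    also have "\<dots> = 2 ^ m * max 1 (norm x) ^ m" by (simp add: power_mult_distrib)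
    also have "max 1 (norm x) ^ m \<le> 1 + norm x ^ m" by (auto simp: max_def)
    finally have "(1 + norm x) ^ m \<le> 2 ^ m * (1 + norm x ^ m)" by simp
    hence "(1 + norm x) ^ m * norm (f x) \<le> 2 ^ m * (1 + norm x ^ m) * norm (f x)" by (rule mult_right_mono) simp
    also have "\<dots> = 2 ^ m * (norm x ^ 0 * norm (f x) + norm x ^ m * norm (f x))" by (simp add: algebra_simps)
    also have "\<dots> \<le> 2 ^ m * (C0 + Cm)" by (intro mult_left_mono add_mono C) auto
    finally show ?thesis .
  qed
  moreover from this[of 0] have "0 \<le> 2 ^ m * (C0 + Cm)"
    by (smt (verit) mult_nonneg_nonneg norm_ge_zero zero_le_power)
  ultimately show thesis using that by blast
qed

lemma schwartz_bounded:
  assumes "schwartz f" obtains C where "0 \<le> C" "\<And>x. norm (f x) \<le> C"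
  using schwartz_bound[OF assms, where m = 0] by auto

lemma schwartz_frechet_bound:
  fixes f :: "'a::euclidean_space \<Rightarrow> complex"
  assumes "schwartz f" obtains C where "0 \<le> C" "\<And>x h. norm (frechet_derivative f (at x) h) \<le> C * norm h"
proof -
  have "\<exists>C. \<forall>x. norm (frechet_derivative f (at x) b) \<le> C" if "b \<in> Basis" for b :: 'a
    by (rule schwartz_bounded[OF schwartz_deriv[OF assms that]]) blast
  then obtain C where C: "\<And>x b. b \<in> Basis \<Longrightarrow> norm (frechet_derivative f (at x) b) \<le> C b" by metis
  have "norm (frechet_derivative f (at x) h) \<le> (\<Sum>b\<in>Basis. C b) * norm h" for x h
  proof -
    have lin: "linear (frechet_derivative f (at x))"
      using has_derivative_linear[OF schwartz_has_derivative[OF assms]] .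
    have "frechet_derivative f (at x) h = (\<Sum>b\<in>Basis. (h \<bullet> b) *\<^sub>R frechet_derivative f (at x) b)"
      using linear_sum[OF lin, of "\<lambda>b. (h \<bullet> b) *\<^sub>R b" Basis] 
      by (simp add: euclidean_representation linear_scale[OF lin])
    also have "norm \<dots> \<le> (\<Sum>b\<in>Basis. norm h * C b)"
      by (rule sum_norm_le) (auto intro!: mult_mono C Basis_le_norm)
    finally show ?thesis by (simp add: sum_distrib_left mult.commute)
  qed
  moreover have "0 \<le> (\<Sum>b\<in>Basis. C b)"
    using C norm_ge_zero order_trans by (intro sum_nonneg) blast
  ultimately show thesis using that by blast
qed

lemma schwartz_add:
  fixes f g :: "'a::euclidean_space \<Rightarrow> complex"
  assumes "schwartz f" "schwartz g" shows "schwartz (\<lambda>x. f x + g x)"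
proof (rule schwartzI_class[where P = "\<lambda>h. \<exists>f g. schwartz f \<and> schwartz g \<and> h = (\<lambda>x. f x + g x)"])
  fix h :: "'a \<Rightarrow> complex" assume "\<exists>f g. schwartz f \<and> schwartz g \<and> h = (\<lambda>x. f x + g x)"
  then obtain f g where h: "schwartz f" "schwartz g" "h = (\<lambda>x. f x + g x)" by blast
  have D: "(h has_derivative (\<lambda>y. frechet_derivative f (at x) y + frechet_derivative g (at x) y)) (at x)" for x
    unfolding h(3) by (intro has_derivative_add schwartz_has_derivative h)
  thus "h differentiable (at x)" for x by (metis differentiable_def)
  have "frechet_derivative h (at x) = (\<lambda>y. frechet_derivative f (at x) y + frechet_derivative g (at x) y)" for x
    by (rule frechet_derivative_at[symmetric, OF D])
  thus "\<exists>f g. schwartz f \<and> schwartz g \<and> (\<lambda>x. frechet_derivative h (at x) b) = (\<lambda>x. f x + g x)" if "b \<in> Basis" for b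
    using schwartz_deriv[OF h(1) that] schwartz_deriv[OF h(2) that] by auto
  fix m
  obtain A B where "\<And>x. norm x ^ m * norm (f x) \<le> A" "\<And>x. norm x ^ m * norm (g x) \<le> B"
    using schwartz_norm_power_bound h by metis
  hence "norm x ^ m * norm (h x) \<le> A + B" for x
    using mult_left_mono[OF norm_triangle_ineq[of "f x" "g x"], of "norm x ^ m"] 
    unfolding h(3) by (smt (verit) distrib_left zero_le_power norm_ge_zero)
  thus "\<exists>C. \<forall>x. norm x ^ m * norm (h x) \<le> C" by blast
qed (use assms in blast)

lemma schwartz_bounded_linear:
  fixes f :: "'a::euclidean_space \<Rightarrow> complex"
  assumes L: "bounded_linear L" and "schwartz f" shows "schwartz (\<lambda>x. L (f x))"
proof (rule schwartzI_class[where P = "\<lambda>h. \<exists>f. schwartz f \<and> h = (\<lambda>x. L (f x))"])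
  fix h :: "'a \<Rightarrow> complex" assume "\<exists>f. schwartz f \<and> h = (\<lambda>x. L (f x))"
  then obtain f where h: "schwartz f" "h = (\<lambda>x. L (f x))" by blast
  have D: "(h has_derivative (\<lambda>y. L (frechet_derivative f (at x) y))) (at x)" for x
    unfolding h(2) by (intro bounded_linear.has_derivative[OF L] schwartz_has_derivative h)
  thus "h differentiable (at x)" for x by (metis differentiable_def)
  have "frechet_derivative h (at x) = (\<lambda>y. L (frechet_derivative f (at x) y))" for x
    by (rule frechet_derivative_at[symmetric, OF D])
  thus "\<exists>f. schwartz f \<and> (\<lambda>x. frechet_derivative h (at x) b) = (\<lambda>x. L (f x))" if "b \<in> Basis" for b
    using schwartz_deriv[OF h(1) that] by auto
  fix m
  obtain K where K: "0 < K" "\<And>z. norm (L z) \<le> norm z * K" using bounded_linear.pos_bounded[OF L] by blast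
  obtain A where A: "\<And>x. norm x ^ m * norm (f x) \<le> A" using schwartz_norm_power_bound h by metis
  have "norm x ^ m * norm (h x) \<le> A * K" for x
  proof -
    have "norm x ^ m * norm (h x) \<le> norm x ^ m * (norm (f x) * K)" unfolding h(2) by (intro mult_left_mono K) auto
    also have "\<dots> \<le> A * K" using mult_right_mono[OF A[of x], of K] K(1) by (simp add: mult.assoc)
    finally show ?thesis .
  qed
  thus "\<exists>C. \<forall>x. norm x ^ m * norm (h x) \<le> C" by blast
qed (use assms in blast)

lemmas schwartz_cnj = schwartz_bounded_linear[OF bounded_linear_cnj]
lemmas schwartz_mult_left = schwartz_bounded_linear[OF bounded_linear_mult_right]

lemma schwartz_diff:
  fixes f g :: "'a::euclidean_space \<Rightarrow> complex"
  assumes "schwartz f" "schwartz g" shows "schwartz (\<lambda>x. f x - g x)"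
  using schwartz_add[OF assms(1) schwartz_mult_left[OF assms(2), of "- 1"]] by simp

text \<open>The majorant \<open>w\<close> does not depend on the point, so the tails of the
  derivative series are small uniformly in \<open>x\<close>, which justifies termwise
  differentiation.\<close>

lemma has_derivative_suminf:
  fixes f :: "nat \<Rightarrow> 'a::real_normed_vector \<Rightarrow> 'b::banach"
  assumes D: "\<And>j x. (f j has_derivative f' j x) (at x)"
    and B: "\<And>j x h. norm (f' j x h) \<le> w j * norm h" and w: "summable w"
    and s: "\<And>x. summable (\<lambda>j. f j x)"
  shows "((\<lambda>x. \<Sum>j. f j x) has_derivative (\<lambda>h. \<Sum>j. f' j x h)) (at x)"
proof -
  have s': "summable (\<lambda>j. f' j x h)" for x h
    by (rule summable_comparison_test'[OF summable_mult2[OF w, of "norm h"]]) (rule B)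
  have "\<exists>g. \<forall>x\<in>UNIV. (\<lambda>j. f j x) sums g x \<and> (g has_derivative (\<lambda>h. \<Sum>j. f' j x h)) (at x within UNIV)"
  proof (rule has_derivative_series[where x = 0])
    fix \<epsilon> :: real assume "0 < \<epsilon>"
    have w0: "0 \<le> w j" if "(h::'a) \<noteq> 0" for j h
      using order_trans[OF norm_ge_zero B[of j 0 h]] that by (simp add: zero_le_mult_iff)
    have "(\<lambda>n. (\<Sum>j. w j) - (\<Sum>j<n. w j)) \<longlonglongrightarrow> (\<Sum>j. w j) - (\<Sum>j. w j)"
      by (intro tendsto_intros summable_LIMSEQ w)
    hence "\<forall>\<^sub>F n in sequentially. (\<Sum>j. w j) - (\<Sum>j<n. w j) < \<epsilon>"
      by (rule order_tendstoD) (use \<open>0 < \<epsilon>\<close> in simp)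
    thus "\<forall>\<^sub>F n in sequentially. \<forall>x\<in>UNIV. \<forall>h. norm ((\<Sum>j<n. f' j x h) - (\<Sum>j. f' j x h)) \<le> \<epsilon> * norm h"
    proof (eventually_elim, intro ballI allI)
      fix n and x h :: 'a assume n: "(\<Sum>j. w j) - (\<Sum>j<n. w j) < \<epsilon>"
      have "(\<Sum>j. f' j x h) - (\<Sum>j<n. f' j x h) = (\<Sum>j. f' (j + n) x h)"
        by (subst suminf_split_initial_segment[where k = n, OF s']) simp
      moreover have "norm (\<Sum>j. f' (j + n) x h) \<le> (\<Sum>j. w (j + n) * norm h)"
        by (rule norm_suminf_le[OF B]) (intro summable_mult2 summable_ignore_initial_segment w)
      moreover have "(\<Sum>j. w (j + n) * norm h) = ((\<Sum>j. w j) - (\<Sum>j<n. w j)) * norm h"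
        using suminf_mult2[OF summable_ignore_initial_segment[OF w, of n], of "norm h"]
          suminf_split_initial_segment[OF w, of n] by simp
      moreover have "((\<Sum>j. w j) - (\<Sum>j<n. w j)) * norm h \<le> \<epsilon> * norm h"
        using n by (intro mult_right_mono) auto
      ultimately show "norm ((\<Sum>j<n. f' j x h) - (\<Sum>j. f' j x h)) \<le> \<epsilon> * norm h"
        by (metis norm_minus_commute order_trans)
    qed
  qed (use D s summable_sums in auto)
  then obtain g where g: "\<And>x. (\<lambda>j. f j x) sums g x" "\<And>x. (g has_derivative (\<lambda>h. \<Sum>j. f' j x h)) (at x)" by auto
  have "g = (\<lambda>x. \<Sum>j. f j x)" using g(1) by (auto simp: sums_iff)
  thus ?thesis using g(2) by simp
qed

section \<open>Series of modulated translates of a Schwartz function\<close>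

lemma has_derivative_e:
  "((\<lambda>x. e (k \<bullet> x)) has_derivative (\<lambda>h. 2 * pi * \<i> * of_real (k \<bullet> h) * e (k \<bullet> x))) (at x)"
proof -
  have "((\<lambda>x. \<i> * of_real (2 * pi * (k \<bullet> x))) has_derivative (\<lambda>h. \<i> * of_real (2 * pi * (k \<bullet> h)))) (at x)"
    by (intro derivative_intros has_derivative_mult_right has_derivative_of_real)
  from has_derivative_compose[OF this DERIV_exp[unfolded has_field_derivative_def]]
  show ?thesis by (simp add: e_def cis_conv_exp algebra_simps)
qed

text \<open>Superpositions of phase-space translates of \<open>\<phi>\<close>. The Weyl quantization
  of a Fourier series and its transpose both have this form, with different phases and opposite
  translations.\<close>

definition wseries :: "(nat \<Rightarrow> complex) \<Rightarrow> (nat \<Rightarrow> 'a::euclidean_space) \<Rightarrow> (nat \<Rightarrow> 'a) \<Rightarrow> ('a \<Rightarrow> complex) \<Rightarrow> 'a \<Rightarrow> complex" where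
  "wseries c k t \<phi> x = (\<Sum>j. c j * e (k j \<bullet> x) * \<phi> (x - t j))"

lemma rapid_summable:
  assumes "rapid c m" shows "summable (\<lambda>j. norm (c j) * (1 + norm (m j)) ^ p)"
  using assms by (simp add: rapid_def)

lemma rapid_summable_norm:
  assumes "rapid c m" shows "summable (\<lambda>j. norm (c j))"
  using rapid_summable[OF assms, of 0] by simp

lemma rapid_mult:
  assumes "rapid c m" "\<And>j. norm (d j) \<le> K * (1 + norm (m j)) * norm (c j)"
  shows "rapid d m"
  unfolding rapid_def
proof
  fix p
  show "summable (\<lambda>j. norm (d j) * (1 + norm (m j)) ^ p)"
  proof (rule summable_comparison_test')
    show "summable (\<lambda>j. K * (norm (c j) * (1 + norm (m j)) ^ Suc p))"
      by (intro summable_mult rapid_summable assms)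
    show "norm (norm (d j) * (1 + norm (m j)) ^ p) \<le> K * (norm (c j) * (1 + norm (m j)) ^ Suc p)" for j
      using mult_right_mono[OF assms(2), of "(1 + norm (m j)) ^ p" j] by (simp add: algebra_simps)
  qed
qed

lemma wseries_summable:
  assumes "rapid c m" "schwartz \<phi>"
  shows "summable (\<lambda>j. norm (c j * e (k j \<bullet> x) * \<phi> (x - t j)))"
proof -
  obtain B where B: "0 \<le> B" "\<And>x. norm (\<phi> x) \<le> B" using schwartz_bounded[OF assms(2)] by blast
  show ?thesis
    by (rule summable_comparison_test'[OF summable_mult2[OF rapid_summable_norm[OF assms(1)], of B]])
       (auto simp: norm_mult intro!: mult_left_mono B)
qed

text \<open>A derivative falls either on \<open>\<phi>\<close> or on the exponential. The first case
  keeps the coefficients, the second multiplies them by a frequency component; hence the closure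
  under sums and the freedom in \<open>c\<close> and \<open>\<phi>\<close>.\<close>

inductive wseries_class :: "(nat \<Rightarrow> 'a::euclidean_space) \<Rightarrow> (nat \<Rightarrow> 'a) \<Rightarrow> (nat \<Rightarrow> 'm::real_normed_vector) \<Rightarrow> ('a \<Rightarrow> complex) \<Rightarrow> bool"
  for k t m where
  base: "rapid c m \<Longrightarrow> schwartz \<phi> \<Longrightarrow> wseries_class k t m (wseries c k t \<phi>)"
| add: "wseries_class k t m f \<Longrightarrow> wseries_class k t m g \<Longrightarrow> wseries_class k t m (\<lambda>x. f x + g x)"


lemma wseries_has_derivative:
  fixes k t :: "nat \<Rightarrow> 'a::euclidean_space" and m :: "nat \<Rightarrow> 'm::real_normed_vector"
  assumes c: "rapid c m" and phi: "schwartz \<phi>" and k: "\<And>j. norm (k j) \<le> norm (m j)"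
  shows "(wseries c k t \<phi> has_derivative
    (\<lambda>h. \<Sum>j. c j * (e (k j \<bullet> x) * frechet_derivative \<phi> (at (x - t j)) h
      + 2 * pi * \<i> * of_real (k j \<bullet> h) * e (k j \<bullet> x) * \<phi> (x - t j)))) (at x)"
proof -
  obtain B0 where B0: "0 \<le> B0" "\<And>x. norm (\<phi> x) \<le> B0" using schwartz_bounded[OF phi] by blast
  obtain B1 where B1: "0 \<le> B1" "\<And>x h. norm (frechet_derivative \<phi> (at x) h) \<le> B1 * norm h"
    using schwartz_frechet_bound[OF phi] by blast
  have "((\<lambda>x. \<Sum>j. c j * (e (k j \<bullet> x) * \<phi> (x - t j))) has_derivative
    (\<lambda>h. \<Sum>j. c j * (e (k j \<bullet> x) * frechet_derivative \<phi> (at (x - t j)) h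
      + 2 * pi * \<i> * of_real (k j \<bullet> h) * e (k j \<bullet> x) * \<phi> (x - t j)))) (at x)"
  proof (rule has_derivative_suminf)
    fix j and x h :: 'a
    have "((\<lambda>x. \<phi> (x - t j)) has_derivative frechet_derivative \<phi> (at (x - t j))) (at x)"
      using has_derivative_shift[of \<phi> _ x "- t j"] schwartz_has_derivative[OF phi, of "x - t j"] by simp
    from has_derivative_mult_right[OF has_derivative_mult[OF has_derivative_e this]]
    show "((\<lambda>x. c j * (e (k j \<bullet> x) * \<phi> (x - t j))) has_derivative
      (\<lambda>h. c j * (e (k j \<bullet> x) * frechet_derivative \<phi> (at (x - t j)) h
      + 2 * pi * \<i> * of_real (k j \<bullet> h) * e (k j \<bullet> x) * \<phi> (x - t j)))) (at x)" .
    have "norm (e (k j \<bullet> x) * frechet_derivative \<phi> (at (x - t j)) h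
      + 2 * pi * \<i> * of_real (k j \<bullet> h) * e (k j \<bullet> x) * \<phi> (x - t j)) \<le> B1 * norm h + 2 * pi * (norm (m j) * norm h) * B0"
    proof (rule order_trans[OF norm_triangle_ineq add_mono])
      have "\<bar>k j \<bullet> h\<bar> \<le> norm (k j) * norm h" by (rule Cauchy_Schwarz_ineq2)
      also have "\<dots> \<le> norm (m j) * norm h" by (intro mult_right_mono k) simp
      finally show "norm (2 * pi * \<i> * of_real (k j \<bullet> h) * e (k j \<bullet> x) * \<phi> (x - t j)) \<le> 2 * pi * (norm (m j) * norm h) * B0"
        using mult_mono[OF mult_left_mono B0(2)[of "x - t j"], of "\<bar>k j \<bullet> h\<bar>" "norm (m j) * norm h" "2 * pi"]
        by (simp add: norm_mult)
    qed (simp add: norm_mult B1)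
    also have "\<dots> \<le> (B1 + 2 * pi * B0) * (1 + norm (m j)) * norm h"
      using B0(1) B1(1) by (simp add: algebra_simps)
    finally have "norm (c j) * norm (e (k j \<bullet> x) * frechet_derivative \<phi> (at (x - t j)) h
      + 2 * pi * \<i> * of_real (k j \<bullet> h) * e (k j \<bullet> x) * \<phi> (x - t j))
      \<le> norm (c j) * ((B1 + 2 * pi * B0) * (1 + norm (m j)) * norm h)" by (rule mult_left_mono) simp
    thus "norm (c j * (e (k j \<bullet> x) * frechet_derivative \<phi> (at (x - t j)) h
      + 2 * pi * \<i> * of_real (k j \<bullet> h) * e (k j \<bullet> x) * \<phi> (x - t j)))
      \<le> ((B1 + 2 * pi * B0) * (norm (c j) * (1 + norm (m j)) ^ 1)) * norm h"
      by (subst norm_mult) (simp only: ac_simps power_one_right)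
  next
    show "summable (\<lambda>j. (B1 + 2 * pi * B0) * (norm (c j) * (1 + norm (m j)) ^ 1))"
      by (intro summable_mult rapid_summable[OF c])
    show "summable (\<lambda>j. c j * (e (k j \<bullet> x) * \<phi> (x - t j)))" for x
      using summable_norm_cancel[OF wseries_summable[OF c phi, of k x t]] by (simp add: mult.assoc)
  qed
  thus ?thesis by (simp add: wseries_def[abs_def] mult.assoc)
qed

lemma schwartz_wseries:
  fixes k t :: "nat \<Rightarrow> 'a::euclidean_space" and m :: "nat \<Rightarrow> 'm::real_normed_vector"
  assumes c: "rapid c m" and phi: "schwartz \<phi>"
    and k: "\<And>j. norm (k j) \<le> norm (m j)" and t: "\<And>j. norm (t j) \<le> norm (m j)"
  shows "schwartz (wseries c k t \<phi>)"
proof (rule schwartzI_class[where P = "wseries_class k t m"])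
  show "wseries_class k t m (wseries c k t \<phi>)" by (rule wseries_class.base[OF c phi])
  show D: "f differentiable (at x)" if "wseries_class k t m f" for f x
    using that
  proof (induction)
    case (base c \<phi>)
    show ?case unfolding differentiable_def using wseries_has_derivative[OF base(1,2) k] by blast
  qed simp
  show "wseries_class k t m (\<lambda>x. frechet_derivative f (at x) b)" if "wseries_class k t m f" "b \<in> Basis" for f b
    using that(1)
  proof (induction)
    case (base c \<phi>)
    define d where "d j = 2 * pi * \<i> * of_real (k j \<bullet> b) * c j" for j
    have d: "rapid d m"
    proof (rule rapid_mult[OF base(1)])
      fix j
      have "\<bar>k j \<bullet> b\<bar> \<le> 1 + norm (m j)" using Basis_le_norm[OF that(2), of "k j"] k[of j] by simp
      thus "norm (d j) \<le> 2 * pi * (1 + norm (m j)) * norm (c j)"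
        by (auto simp: d_def norm_mult intro!: mult_right_mono mult_left_mono)
    qed
    have phi': "schwartz (\<lambda>x. frechet_derivative \<phi> (at x) b)" by (rule schwartz_deriv[OF base(2) that(2)])
    have "frechet_derivative (wseries c k t \<phi>) (at x) b
      = wseries c k t (\<lambda>x. frechet_derivative \<phi> (at x) b) x + wseries d k t \<phi> x" for x
    proof -
      have "frechet_derivative (wseries c k t \<phi>) (at x) b = (\<Sum>j. c j * (e (k j \<bullet> x) * frechet_derivative \<phi> (at (x - t j)) b
        + 2 * pi * \<i> * of_real (k j \<bullet> b) * e (k j \<bullet> x) * \<phi> (x - t j)))"
        by (subst frechet_derivative_at[OF wseries_has_derivative[OF base(1,2) k], symmetric]) simp
      also have "\<dots> = (\<Sum>j. c j * e (k j \<bullet> x) * frechet_derivative \<phi> (at (x - t j)) b + d j * e (k j \<bullet> x) * \<phi> (x - t j))"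
        by (rule suminf_cong) (simp add: d_def algebra_simps)
      also have "\<dots> = wseries c k t (\<lambda>x. frechet_derivative \<phi> (at x) b) x + wseries d k t \<phi> x"
        unfolding wseries_def
        by (intro suminf_add[symmetric] summable_norm_cancel[OF wseries_summable[OF base(1) phi']]
             summable_norm_cancel[OF wseries_summable[OF d base(2)]])
      finally show ?thesis .
    qed
    thus ?case using wseries_class.add[OF wseries_class.base[OF base(1) phi'] wseries_class.base[OF d base(2)]] by simp
  next
    case (add f g)
    have "frechet_derivative (\<lambda>x. f x + g x) (at x) b = frechet_derivative f (at x) b + frechet_derivative g (at x) b" for x
    proof -
      have "((\<lambda>x. f x + g x) has_derivative (\<lambda>h. frechet_derivative f (at x) h + frechet_derivative g (at x) h)) (at x)"
        using D[OF add(1), of x] D[OF add(2), of x] by (intro has_derivative_add) (simp_all add: frechet_derivative_works)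
      from frechet_derivative_at[OF this, symmetric] show ?thesis by simp
    qed
    thus ?case using wseries_class.add[OF add.IH] by simp
  qed
  show "\<exists>C. \<forall>x. norm x ^ p * norm (f x) \<le> C" if "wseries_class k t m f" for f p
    using that
  proof (induction)
    case (base c \<phi>)
    obtain B where B: "0 \<le> B" "\<And>x. (1 + norm x) ^ p * norm (\<phi> x) \<le> B" using schwartz_bound[OF base(2)] by blast
    have "norm x ^ p * norm (wseries c k t \<phi> x) \<le> (\<Sum>j. B * (norm (c j) * (1 + norm (m j)) ^ p))" for x
    proof -
      have "norm (\<Sum>j. of_real (norm x ^ p) * (c j * e (k j \<bullet> x) * \<phi> (x - t j))) \<le> (\<Sum>j. B * (norm (c j) * (1 + norm (m j)) ^ p))"
      proof (rule norm_suminf_le)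
        fix j
        \<comment> \<open>A polynomial weight at \<open>x\<close> is split between the translated
          function and the translation itself; the latter is paid for by the rapid decay of
          \<open>c\<close>.\<close>
        have "norm x \<le> norm (x - t j) + norm (m j)" using norm_triangle_ineq[of "x - t j" "t j"] t[of j] by simp
        also have "\<dots> \<le> (1 + norm (m j)) * (1 + norm (x - t j))" by (simp add: algebra_simps)
        finally have "norm x ^ p \<le> ((1 + norm (m j)) * (1 + norm (x - t j))) ^ p" by (intro power_mono) auto
        hence "norm x ^ p * norm (\<phi> (x - t j)) \<le> ((1 + norm (m j)) * (1 + norm (x - t j))) ^ p * norm (\<phi> (x - t j))"
          by (rule mult_right_mono) simp
        also have "\<dots> = (1 + norm (m j)) ^ p * ((1 + norm (x - t j)) ^ p * norm (\<phi> (x - t j)))"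
          by (simp add: power_mult_distrib)
        also have "\<dots> \<le> (1 + norm (m j)) ^ p * B" by (intro mult_left_mono B) auto
        finally have "norm (c j) * (norm x ^ p * norm (\<phi> (x - t j))) \<le> norm (c j) * ((1 + norm (m j)) ^ p * B)"
          by (rule mult_left_mono) simp
        thus "norm (of_real (norm x ^ p) * (c j * e (k j \<bullet> x) * \<phi> (x - t j))) \<le> B * (norm (c j) * (1 + norm (m j)) ^ p)"
          by (simp add: norm_mult norm_power ac_simps)
      qed (intro summable_mult rapid_summable[OF base(1)])
      also have "(\<Sum>j. of_real (norm x ^ p) * (c j * e (k j \<bullet> x) * \<phi> (x - t j))) = of_real (norm x ^ p) * wseries c k t \<phi> x"
        unfolding wseries_def by (rule suminf_mult[OF summable_norm_cancel[OF wseries_summable[OF base]]])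
      finally show ?thesis by (simp add: norm_mult norm_power)
    qed
    thus ?case by blast
  next
    case (add f g)
    then obtain A B where "\<And>x. norm x ^ p * norm (f x) \<le> A" "\<And>x. norm x ^ p * norm (g x) \<le> B" by blast
    hence "norm x ^ p * norm (f x + g x) \<le> A + B" for x
      using mult_left_mono[OF norm_triangle_ineq[of "f x" "g x"], of "norm x ^ p"]
      by (smt (verit) distrib_left zero_le_power norm_ge_zero)
    thus ?case by blast
  qed
qed

subsection \<open>The Gaussian is a Schwartz function\<close>

text \<open>Polynomial multiples of the Gaussian, generated by rules under which the product rule
  stays inside the class.\<close>

inductive gauss_class :: "('a::euclidean_space \<Rightarrow> complex) \<Rightarrow> bool" where
  gauss: "gauss_class (\<lambda>x. of_real (exp (- (x \<bullet> x))))"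
| coord: "gauss_class f \<Longrightarrow> gauss_class (\<lambda>x. of_real (x \<bullet> b) * f x)"
| scale: "gauss_class f \<Longrightarrow> gauss_class (\<lambda>x. of_real r * f x)"
| add: "gauss_class f \<Longrightarrow> gauss_class g \<Longrightarrow> gauss_class (\<lambda>x. f x + g x)"

lemma power_le_fact_exp: assumes "0 \<le> (x::real)" shows "x ^ n \<le> fact n * exp x"
proof -
  have "(\<Sum>k\<in>{n}. x ^ k /\<^sub>R fact k) \<le> (\<Sum>k. x ^ k /\<^sub>R fact k)"
    using assms by (intro sum_le_suminf summable_exp_generic) auto
  thus ?thesis by (simp add: exp_def field_simps)
qed

lemma schwartz_gauss: "schwartz (\<lambda>x::'a::euclidean_space. complex_of_real (exp (- (x \<bullet> x))))"
proof (rule schwartzI_class[where P = gauss_class, OF gauss_class.gauss])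
  have D: "(\<forall>x. f differentiable (at x)) \<and> (\<forall>v\<in>Basis. gauss_class (\<lambda>x. frechet_derivative f (at x) v))"
    if "gauss_class f" for f :: "'a \<Rightarrow> complex"
    using that
  proof (induction)
    case gauss
    have D: "((\<lambda>x. complex_of_real (exp (- (x \<bullet> x)))) has_derivative
      (\<lambda>h. complex_of_real (- (2 * (x \<bullet> h)) * exp (- (x \<bullet> x))))) (at x)" for x :: 'a
      by (rule has_derivative_of_real) (auto intro!: derivative_eq_intros simp: fun_eq_iff inner_commute algebra_simps)
    have "frechet_derivative (\<lambda>x. complex_of_real (exp (- (x \<bullet> x)))) (at x) v
      = of_real (- 2) * (of_real (x \<bullet> v) * complex_of_real (exp (- (x \<bullet> x))))" for x v :: 'a
      by (subst frechet_derivative_at[OF D, symmetric]) simp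
    thus ?case
      using gauss_class.scale[OF gauss_class.coord[OF gauss_class.gauss], of "-2"] D unfolding differentiable_def
      by (intro conjI ballI allI) (blast, simp)
  next
    case (coord f b)
    hence f: "(f has_derivative frechet_derivative f (at x)) (at x)" for x by (simp add: frechet_derivative_works)
    have D: "((\<lambda>x. complex_of_real (x \<bullet> b) * f x) has_derivative
       (\<lambda>h. of_real (x \<bullet> b) * frechet_derivative f (at x) h + of_real (h \<bullet> b) * f x)) (at x)" for x
      by (intro has_derivative_mult has_derivative_of_real f has_derivative_inner_left has_derivative_ident)
    have "frechet_derivative (\<lambda>x. complex_of_real (x \<bullet> b) * f x) (at x) v
      = of_real (x \<bullet> b) * frechet_derivative f (at x) v + of_real (v \<bullet> b) * f x" for x v
      by (subst frechet_derivative_at[OF D, symmetric]) simp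
    thus ?case
      using D coord unfolding differentiable_def
      by (intro conjI ballI allI) (blast, simp, intro gauss_class.add gauss_class.coord gauss_class.scale, auto)
  next
    case (scale f r)
    hence f: "(f has_derivative frechet_derivative f (at x)) (at x)" for x by (simp add: frechet_derivative_works)
    have D: "((\<lambda>x. complex_of_real r * f x) has_derivative (\<lambda>h. of_real r * frechet_derivative f (at x) h)) (at x)" for x
      by (intro has_derivative_mult_right f)
    have "frechet_derivative (\<lambda>x. complex_of_real r * f x) (at x) v = of_real r * frechet_derivative f (at x) v" for x v
      by (subst frechet_derivative_at[OF D, symmetric]) simp
    thus ?case
      using D scale unfolding differentiable_def
      by (intro conjI ballI allI) (blast, simp, intro gauss_class.scale, auto)
  next
    case (add f g)
    hence f: "(f has_derivative frechet_derivative f (at x)) (at x)" "(g has_derivative frechet_derivative g (at x)) (at x)" for x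
      by (simp_all add: frechet_derivative_works)
    have D: "((\<lambda>x. f x + g x) has_derivative (\<lambda>h. frechet_derivative f (at x) h + frechet_derivative g (at x) h)) (at x)" for x
      by (intro has_derivative_add f)
    have "frechet_derivative (\<lambda>x. f x + g x) (at x) v = frechet_derivative f (at x) v + frechet_derivative g (at x) v" for x v
      by (subst frechet_derivative_at[OF D, symmetric]) simp
    thus ?case
      using D add unfolding differentiable_def
      by (intro conjI ballI allI) (blast, simp, intro gauss_class.add, auto)
  qed
  show "f differentiable (at x)" if "gauss_class f" for f :: "'a \<Rightarrow> complex" and x using D[OF that] by blast
  show "gauss_class (\<lambda>x. frechet_derivative f (at x) b)" if "gauss_class f" "b \<in> Basis" for f :: "'a \<Rightarrow> complex" and b
    using D[OF that(1)] that(2) by blast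
  show "\<exists>C. \<forall>x. norm x ^ m * norm (f x) \<le> C" if "gauss_class f" for f :: "'a \<Rightarrow> complex" and m
  proof -
    have "\<exists>q C. \<forall>x. norm (f x) \<le> C * (1 + norm x) ^ q * exp (- (x \<bullet> x))"
      using that
    proof (induction)
      case gauss show ?case by (rule exI[of _ 0], rule exI[of _ 1]) simp
    next
      case (coord f b)
      then obtain q C where f: "\<And>x. norm (f x) \<le> C * (1 + norm x) ^ q * exp (- (x \<bullet> x))" by blast
      have "norm (of_real (x \<bullet> b) * f x) \<le> (norm b * C) * (1 + norm x) ^ Suc q * exp (- (x \<bullet> x))" for x
      proof -
        have "\<bar>x \<bullet> b\<bar> \<le> norm x * norm b" by (rule Cauchy_Schwarz_ineq2)
        also have "\<dots> \<le> (1 + norm x) * norm b" by (intro mult_right_mono) auto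
        finally have "norm (of_real (x \<bullet> b) * f x) \<le> ((1 + norm x) * norm b) * (C * (1 + norm x) ^ q * exp (- (x \<bullet> x)))"
          unfolding norm_mult by (intro mult_mono f) auto
        thus ?thesis by (simp add: algebra_simps)
      qed
      thus ?case by blast
    next
      case (scale f r)
      then obtain q C where f: "\<And>x. norm (f x) \<le> C * (1 + norm x) ^ q * exp (- (x \<bullet> x))" by blast
      have "norm (of_real r * f x) \<le> (\<bar>r\<bar> * C) * (1 + norm x) ^ q * exp (- (x \<bullet> x))" for x
        using mult_left_mono[OF f[of x], of "\<bar>r\<bar>"] by (simp add: norm_mult algebra_simps)
      thus ?case by blast
    next
      case (add f g)
      then obtain q C q' C' where f: "\<And>x. norm (f x) \<le> C * (1 + norm x) ^ q * exp (- (x \<bullet> x))"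
         "\<And>x. norm (g x) \<le> C' * (1 + norm x) ^ q' * exp (- (x \<bullet> x))" by metis
      have le: "C * (1 + norm x) ^ q * exp (- (x \<bullet> x)) \<le> \<bar>C\<bar> * (1 + norm x) ^ (q + q') * exp (- (x \<bullet> x))" for C q q' and x :: 'a
        by (intro mult_right_mono mult_mono power_increasing) auto
      have "norm (f x + g x) \<le> (\<bar>C\<bar> + \<bar>C'\<bar>) * (1 + norm x) ^ (q + q') * exp (- (x \<bullet> x))" for x
        using norm_triangle_ineq[of "f x" "g x"] f(1)[of x] f(2)[of x] le[of C x q q']
          le[of C' x q' q, unfolded add.commute[of q' q]]
        unfolding distrib_right by linarith
      thus ?case by blast
    qed
    then obtain q C where f: "\<And>x. norm (f x) \<le> C * (1 + norm x) ^ q * exp (- (x \<bullet> x))" by blast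
    \<comment> \<open>A power of \<open>1 + norm x\<close> costs at most
      \<open>exp (1 + norm x)\<close> up to a factorial, and \<open>1 + norm x - (norm x)^2\<close>
      is at most 5/4, rounded up to 2.\<close>
    have "norm x ^ m * norm (f x) \<le> \<bar>C\<bar> * (fact (m + q) * exp 2)" for x
    proof -
      have "norm x ^ m * norm (f x) \<le> (1 + norm x) ^ m * (\<bar>C\<bar> * (1 + norm x) ^ q * exp (- (x \<bullet> x)))"
        by (intro mult_mono power_mono order_trans[OF f] mult_right_mono) auto
      also have "\<dots> = \<bar>C\<bar> * ((1 + norm x) ^ (m + q) * exp (- (x \<bullet> x)))" by (simp add: power_add)
      also have "\<dots> \<le> \<bar>C\<bar> * (fact (m + q) * exp (1 + norm x) * exp (- (x \<bullet> x)))"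
        by (intro mult_left_mono mult_right_mono power_le_fact_exp) auto
      also have "fact (m + q) * exp (1 + norm x) * exp (- (x \<bullet> x)) = fact (m + q) * exp (1 + norm x - (x \<bullet> x))"
        by (simp add: exp_diff exp_minus field_simps)
      also have "1 + norm x - (x \<bullet> x) \<le> 2"
        using zero_le_power2[of "norm x - 1 / 2"] by (simp add: power2_norm_eq_inner[symmetric] power2_eq_square algebra_simps)
      hence "\<bar>C\<bar> * (fact (m + q) * exp (1 + norm x - (x \<bullet> x))) \<le> \<bar>C\<bar> * (fact (m + q) * exp 2)"
        by (intro mult_left_mono) auto
      finally show ?thesis .
    qed
    thus ?thesis by blast
  qed
qed

subsection \<open>The Fourier transform of Schwartz functions\<close>

interpretation lborel_prod: product_sigma_finite "\<lambda>_::'a. lborel :: real measure" ..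

lemma
  fixes g :: "'a::euclidean_space \<Rightarrow> real \<Rightarrow> 'b::{real_normed_field,banach,second_countable_topology}"
  assumes g: "\<And>b. b \<in> Basis \<Longrightarrow> integrable lborel (g b)"
  shows integrable_prod_lborel: "integrable lborel (\<lambda>x. \<Prod>b\<in>Basis. g b (x \<bullet> b))"
    and integral_prod_lborel: "(LINT x|lborel. (\<Prod>b\<in>Basis. g b (x \<bullet> b))) = (\<Prod>b\<in>Basis. (LINT t|lborel. g b t))"
proof -
  have [measurable]: "g b \<in> borel_measurable borel" if "b \<in> Basis" for b
    using borel_measurable_integrable[OF g[OF that]] by simp
  have meas: "(\<lambda>x. \<Prod>b\<in>Basis. g b (x \<bullet> b)) \<in> borel_measurable borel"
    by (intro borel_measurable_prod) measurable
  have T: "(\<lambda>f. \<Sum>b\<in>Basis. f b *\<^sub>R b) \<in> measurable (\<Pi>\<^sub>M b\<in>(Basis::'a set). lborel) borel"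
    by measurable
  have eq: "(\<Prod>b\<in>Basis. g b ((\<Sum>c\<in>Basis. f c *\<^sub>R c) \<bullet> b)) = (\<Prod>b\<in>Basis. g b (f b))" for f
    by (intro prod.cong) auto
  show "integrable lborel (\<lambda>x. \<Prod>b\<in>Basis. g b (x \<bullet> b))"
    by (subst lborel_eq, subst integrable_distr_eq[OF T meas], unfold eq)
       (rule lborel_prod.product_integrable_prod[OF finite_Basis g])
  show "(LINT x|lborel. (\<Prod>b\<in>Basis. g b (x \<bullet> b))) = (\<Prod>b\<in>Basis. (LINT t|lborel. g b t))"
    by (subst lborel_eq, subst integral_distr[OF T meas], unfold eq)
       (rule lborel_prod.product_integral_prod[OF finite_Basis g])
qed

lemma integrable_scaleR_iff:
  fixes f :: "'a \<Rightarrow> 'b::{banach,second_countable_topology}"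
  assumes "c \<noteq> 0" shows "integrable M (\<lambda>x. c *\<^sub>R f x) \<longleftrightarrow> integrable M f"
  using integrable_scaleR_right[of "inverse c" M "\<lambda>x. c *\<^sub>R f x"] assms by auto

lemma
  fixes f :: "'a::euclidean_space \<Rightarrow> 'b::{banach,second_countable_topology}"
  assumes c: "c \<noteq> (0::real)" and f: "f \<in> borel_measurable borel"
  shows integral_lborel_affine: "integral\<^sup>L lborel f = \<bar>c\<bar> ^ DIM('a) *\<^sub>R (LINT x|lborel. f (t + c *\<^sub>R x))"
    and integrable_lborel_affine: "integrable lborel (\<lambda>x. f (t + c *\<^sub>R x)) \<longleftrightarrow> integrable lborel f"
proof -
  have T: "(\<lambda>x. t + c *\<^sub>R x) \<in> measurable lborel borel" by measurable
  have f': "f \<in> borel_measurable (distr lborel borel (\<lambda>x. t + c *\<^sub>R x))" using f by simp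
  have "integral\<^sup>L lborel f = integral\<^sup>L (density (distr lborel borel (\<lambda>x. t + c *\<^sub>R x)) (\<lambda>_. \<bar>c\<bar> ^ DIM('a))) f"
    using lborel_affine[OF c, of t] by simp
  thus "integral\<^sup>L lborel f = \<bar>c\<bar> ^ DIM('a) *\<^sub>R (LINT x|lborel. f (t + c *\<^sub>R x))"
    by (simp add: integral_density[OF f'] integral_distr[OF T] f)
  have "integrable lborel f = integrable (density (distr lborel borel (\<lambda>x. t + c *\<^sub>R x)) (\<lambda>_. \<bar>c\<bar> ^ DIM('a))) f"
    using lborel_affine[OF c, of t] by simp
  moreover have "(\<lambda>x. \<bar>c\<bar> ^ DIM('a) *\<^sub>R f x) \<in> borel_measurable borel" using f by measurable
  ultimately show "integrable lborel (\<lambda>x. f (t + c *\<^sub>R x)) \<longleftrightarrow> integrable lborel f"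
    using c by (simp add: integrable_density[OF f'] integrable_distr_eq[OF T] f integrable_scaleR_iff)
qed

text \<open>This weight factorizes over the coordinates, unlike a power of the norm, so both its
  integral and its sum over the lattice reduce to dimension one.\<close>

definition wt :: "'a::euclidean_space \<Rightarrow> real" where
  "wt x = (\<Prod>b\<in>Basis. 1 / (1 + (x \<bullet> b)\<^sup>2))"

lemma wt_pos: "0 < wt x"
  unfolding wt_def by (intro prod_pos) (auto intro!: divide_pos_pos add_pos_nonneg)

lemma integrable_wt: "integrable lborel (wt :: 'a::euclidean_space \<Rightarrow> real)"
proof -
  have "integrable lborel (\<lambda>x::real. 1 / (1 + x\<^sup>2))"
    using integrable_inverse_1_plus_square by (simp add: set_integrable_def divide_inverse)
  thus ?thesis unfolding wt_def[abs_def] by (rule integrable_prod_lborel)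
qed

lemma inverse_wt_le: "1 \<le> (1 + norm x) ^ (2 * DIM('a)) * wt (x::'a::euclidean_space)"
proof -
  have "(\<Prod>b\<in>(Basis::'a set). 1 + (x \<bullet> b)\<^sup>2) \<le> (\<Prod>b\<in>(Basis::'a set). (1 + norm x)\<^sup>2)"
  proof (intro prod_mono conjI)
    fix b :: 'a assume "b \<in> Basis"
    hence "\<bar>x \<bullet> b\<bar>\<^sup>2 \<le> (norm x)\<^sup>2" by (intro power_mono Basis_le_norm) auto
    hence "1 + (x \<bullet> b)\<^sup>2 \<le> 1 + 2 * norm x + (norm x)\<^sup>2"
      unfolding power2_abs using norm_ge_zero[of x] by linarith
    also have "\<dots> = (1 + norm x)\<^sup>2" by (simp add: power2_sum)
    finally show "1 + (x \<bullet> b)\<^sup>2 \<le> (1 + norm x)\<^sup>2" .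
  qed auto
  also have "\<dots> = (1 + norm x) ^ (2 * DIM('a))" by (simp add: power_mult)
  finally have "(\<Prod>b\<in>(Basis::'a set). 1 + (x \<bullet> b)\<^sup>2) \<le> (1 + norm x) ^ (2 * DIM('a))" .
  moreover have "0 < (\<Prod>b\<in>(Basis::'a set). 1 + (x \<bullet> b)\<^sup>2)" by (intro prod_pos) (auto intro: add_pos_nonneg)
  ultimately show ?thesis by (simp add: wt_def prod_dividef field_simps)
qed

lemma schwartz_wt_bound:
  fixes u :: "'a::euclidean_space \<Rightarrow> complex"
  assumes "schwartz u" obtains C where "0 \<le> C" "\<And>x. norm (u x) \<le> C * wt x"
proof -
  obtain C where C: "0 \<le> C" "\<And>x. (1 + norm x) ^ (2 * DIM('a)) * norm (u x) \<le> C"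
    using schwartz_bound[OF assms] by blast
  have "norm (u x) \<le> C * wt x" for x
  proof -
    have "norm (u x) \<le> norm (u x) * ((1 + norm x) ^ (2 * DIM('a)) * wt x)"
      using mult_left_mono[OF inverse_wt_le[of x], of "norm (u x)"] by simp
    also have "\<dots> = ((1 + norm x) ^ (2 * DIM('a)) * norm (u x)) * wt x" by simp
    also have "\<dots> \<le> C * wt x" using C(2)[of x] wt_pos[of x] by (intro mult_right_mono) auto
    finally show ?thesis .
  qed
  thus thesis using that C by blast
qed

lemma integrable_wt_bound:
  fixes f :: "'a::euclidean_space \<Rightarrow> complex"
  assumes "f \<in> borel_measurable borel" "\<And>x. norm (f x) \<le> C * wt x"
  shows "integrable lborel f"
proof (rule Bochner_Integration.integrable_bound)
  show "integrable lborel (\<lambda>x::'a. C * wt x)" by (intro integrable_mult_right integrable_wt)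
  show "AE x in lborel. norm (f x) \<le> norm (C * wt x)"
    using assms(2) by (auto intro: order_trans[OF _ abs_ge_self])
qed (use assms in simp)

lemma schwartz_integrable: "schwartz u \<Longrightarrow> integrable lborel u"
  by (meson integrable_wt_bound schwartz_measurable schwartz_wt_bound)

lemma e_measurable [measurable]: "e \<in> borel_measurable borel"
  by (intro borel_measurable_continuous_onI continuous_intros)

definition ft :: "('a::euclidean_space \<Rightarrow> complex) \<Rightarrow> 'a \<Rightarrow> complex" where
  "ft u \<eta> = (LINT y|lborel. u y * e (- (y \<bullet> \<eta>)))"

lemma integrable_mult_e:
  fixes f :: "'a::euclidean_space \<Rightarrow> complex"
  assumes "integrable lborel f" "g \<in> borel_measurable borel" shows "integrable lborel (\<lambda>y. f y * e (g y))"
proof (rule Bochner_Integration.integrable_bound[OF assms(1)])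
  show "(\<lambda>y. f y * e (g y)) \<in> borel_measurable lborel"
    using borel_measurable_integrable[OF assms(1)] assms(2) by measurable
qed (simp add: norm_mult)

lemma integrable_ft_integrand:
  "integrable lborel u \<Longrightarrow> integrable lborel (\<lambda>y. u y * e (- (y \<bullet> \<eta>)))"
  by (rule integrable_mult_e) measurable

lemma ft_measurable:
  assumes [measurable]: "u \<in> borel_measurable borel" shows "ft u \<in> borel_measurable borel"
  unfolding ft_def[abs_def] by (intro lborel.borel_measurable_lebesgue_integral) measurable

lemma norm_ft_le: "norm (ft u \<eta>) \<le> (LINT y|lborel. norm (u y))"
  unfolding ft_def by (rule order_trans[OF integral_norm_bound]) (simp add: norm_mult)

lemma ft_diff:
  "integrable lborel u \<Longrightarrow> integrable lborel v \<Longrightarrow> ft (\<lambda>y. u y - v y) \<eta> = ft u \<eta> - ft v \<eta>"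
  by (simp add: ft_def left_diff_distrib integrable_ft_integrand)

lemma ft_shift:
  assumes "u \<in> borel_measurable borel"
  shows "ft (\<lambda>y. u (y + v)) \<eta> = e (v \<bullet> \<eta>) * ft u \<eta>"
proof -
  have "ft u \<eta> = (LINT y|lborel. u (v + 1 *\<^sub>R y) * e (- ((v + 1 *\<^sub>R y) \<bullet> \<eta>)))"
    using assms unfolding ft_def by (subst integral_lborel_affine[where c = 1 and t = v]) auto
  also have "\<dots> = (LINT y|lborel. e (- (v \<bullet> \<eta>)) * (u (y + v) * e (- (y \<bullet> \<eta>))))"
  proof (rule Bochner_Integration.integral_cong[OF refl])
    fix y
    have "e (- ((v + 1 *\<^sub>R y) \<bullet> \<eta>)) = e (- (v \<bullet> \<eta>)) * e (- (y \<bullet> \<eta>))"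
      by (simp only: scaleR_one inner_add_left minus_add_distrib e_add)
    thus "u (v + 1 *\<^sub>R y) * e (- ((v + 1 *\<^sub>R y) \<bullet> \<eta>)) = e (- (v \<bullet> \<eta>)) * (u (y + v) * e (- (y \<bullet> \<eta>)))"
      by (simp only: scaleR_one add.commute[of v] mult.left_commute)
  qed
  also have "\<dots> = e (- (v \<bullet> \<eta>)) * ft (\<lambda>y. u (y + v)) \<eta>" by (simp add: ft_def)
  finally show ?thesis by (simp add: mult.assoc[symmetric] e_add[symmetric])
qed

text \<open>Values of the weight at distance at most one are comparable, which provides a majorant
  for difference quotients and, one coordinate at a time, for shifted lattice sums. The 3 comes from
  \<open>t^2 \<le> 2 (t + s)^2 + 2 s^2\<close>.\<close>

lemma wt_shift_le:
  fixes y b :: "'a::euclidean_space"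
  assumes "b \<in> Basis" "\<bar>s\<bar> \<le> 1" shows "wt (y + s *\<^sub>R b) \<le> 3 * wt y"
proof -
  have 1: "1 / (1 + (t + s)\<^sup>2) \<le> 3 / (1 + t\<^sup>2)" for t
  proof -
    define A where "A = (t + s)\<^sup>2"
    have "t\<^sup>2 \<le> 2 * A + 2 * s\<^sup>2"
      using zero_le_power2[of "t + 2 * s"] by (simp add: A_def power2_eq_square algebra_simps)
    moreover have "s\<^sup>2 \<le> 1" using assms(2) by (simp add: abs_square_le_1)
    moreover have "0 \<le> A" by (simp add: A_def)
    ultimately have "1 + t\<^sup>2 \<le> 3 * (1 + A)" by (smt (verit))
    hence "1 + t\<^sup>2 \<le> 3 * (1 + (t + s)\<^sup>2)" unfolding A_def .
    moreover have "0 < 1 + t\<^sup>2" "0 < 1 + (t + s)\<^sup>2" by (auto intro: add_pos_nonneg)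
    ultimately show ?thesis by (simp add: divide_simps)
  qed
  have "wt (y + s *\<^sub>R b) = (1 / (1 + (y \<bullet> b + s)\<^sup>2)) * (\<Prod>c\<in>Basis - {b}. 1 / (1 + (y \<bullet> c)\<^sup>2))"
    unfolding wt_def using assms(1)
    by (subst prod.remove[of _ b]) (auto simp: inner_add_left inner_Basis intro!: prod.cong split: if_splits)
  also have "\<dots> \<le> (3 / (1 + (y \<bullet> b)\<^sup>2)) * (\<Prod>c\<in>Basis - {b}. 1 / (1 + (y \<bullet> c)\<^sup>2))"
    by (intro mult_right_mono 1 prod_nonneg) auto
  also have "\<dots> = 3 * wt y"
    unfolding wt_def using assms(1) by (subst prod.remove[of _ b]) auto
  finally show ?thesis .
qed

lemma difference_quotient_tendsto:
  assumes f: "(f has_derivative D) (at x)" and d: "d \<longlonglongrightarrow> 0" "\<And>n. 0 < d n"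
  shows "(\<lambda>n. (f (x + d n *\<^sub>R b) - f x) /\<^sub>R d n) \<longlonglongrightarrow> D b"
proof -
  have "((\<lambda>t. x + t *\<^sub>R b) has_derivative (\<lambda>h. h *\<^sub>R b)) (at 0)" by (auto intro!: derivative_eq_intros)
  from has_derivative_compose[OF this, of f D] f
  have p: "((\<lambda>t. f (x + t *\<^sub>R b)) has_derivative (\<lambda>h. D (h *\<^sub>R b))) (at 0)" by simp
  hence "((\<lambda>t. (1 / norm (t - 0)) *\<^sub>R (f (x + t *\<^sub>R b) - (f (x + 0 *\<^sub>R b) + D ((t - 0) *\<^sub>R b)))) \<longlongrightarrow> 0) (at 0)"
    unfolding has_derivative_within' has_derivative_def by (simp add: divide_inverse_commute diff_diff_eq algebra_simps)
  hence "(\<lambda>n. (1 / norm (d n - 0)) *\<^sub>R (f (x + d n *\<^sub>R b) - (f (x + 0 *\<^sub>R b) + D ((d n - 0) *\<^sub>R b)))) \<longlonglongrightarrow> 0"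
    by (rule filterlim_compose) (use d in \<open>auto simp: filterlim_at less_imp_neq[symmetric] eventually_sequentially\<close>)
  moreover have "(1 / norm (d n - 0)) *\<^sub>R (f (x + d n *\<^sub>R b) - (f (x + 0 *\<^sub>R b) + D ((d n - 0) *\<^sub>R b)))
     = (f (x + d n *\<^sub>R b) - f x) /\<^sub>R d n - D b" for n
    using d(2)[of n] has_derivative_linear[OF f]
    by (simp add: linear_scale scaleR_diff_right diff_diff_eq[symmetric] divide_inverse)
  ultimately show ?thesis by (simp add: LIM_zero_iff)
qed

text \<open>Integration by parts is replaced by a limit of difference quotients: their transforms
  are explicit by translation, and the comparability of the weight under small shifts gives
  dominated convergence.\<close>

lemma ft_deriv:
  fixes u :: "'a::euclidean_space \<Rightarrow> complex"
  assumes u: "schwartz u" and b: "b \<in> Basis"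
  shows "ft (\<lambda>y. frechet_derivative u (at y) b) \<eta> = 2 * pi * \<i> * of_real (b \<bullet> \<eta>) * ft u \<eta>"
proof -
  define d :: "nat \<Rightarrow> real" where "d n = 1 / real (Suc n)" for n
  have d: "d \<longlonglongrightarrow> 0" "\<And>n. 0 < d n" "\<And>n. d n \<le> 1"
    unfolding d_def by (rule LIMSEQ_Suc[OF lim_1_over_n]) simp_all
  define q where "q n y = (u (y + d n *\<^sub>R b) - u y) /\<^sub>R d n" for n y
  have [measurable]: "u \<in> borel_measurable borel" by (rule schwartz_measurable[OF u])
  obtain C where C: "0 \<le> C" "\<And>x. norm (frechet_derivative u (at x) b) \<le> C * wt x"
    using schwartz_wt_bound[OF schwartz_deriv[OF u b]] by blast
  have qb: "norm (q n y) \<le> C * (3 * wt y)" for n y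
  proof -
    have "norm (u (y + d n *\<^sub>R b) - u y) \<le> d n * (C * (3 * wt y))"
    proof (rule shift_diff_bound)
      show "norm (frechet_derivative u (at (y + t *\<^sub>R b)) b) \<le> C * (3 * wt y)" if "0 \<le> t" "t \<le> d n" for t
        using C(2)[of "y + t *\<^sub>R b"] mult_left_mono[OF wt_shift_le[OF b, of t y] C(1)] that d(3)[of n]
        by (smt (verit))
    qed (use d(2)[of n] schwartz_differentiable[OF u] in auto)
    moreover have "norm (q n y) = norm (u (y + d n *\<^sub>R b) - u y) / d n"
      using d(2)[of n] by (simp add: q_def divide_inverse_commute)
    ultimately have "d n * norm (q n y) \<le> d n * (C * (3 * wt y))" using d(2)[of n] by (simp add: field_simps)
    thus ?thesis using d(2)[of n] by (simp only: mult_le_cancel_left_pos)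
  qed
  have "(\<lambda>n. ft (q n) \<eta>) \<longlonglongrightarrow> ft (\<lambda>y. frechet_derivative u (at y) b) \<eta>"
    unfolding ft_def
  proof (rule integral_dominated_convergence[where w = "\<lambda>y. C * (3 * wt y)"])
    show "integrable lborel (\<lambda>y::'a. C * (3 * wt y))" by (intro integrable_mult_right integrable_wt)
    show "AE y in lborel. (\<lambda>n. q n y * e (- (y \<bullet> \<eta>))) \<longlonglongrightarrow> frechet_derivative u (at y) b * e (- (y \<bullet> \<eta>))"
      unfolding q_def
      by (intro AE_I2 tendsto_intros difference_quotient_tendsto[OF schwartz_has_derivative[OF u] d(1,2)])
    show "AE y in lborel. norm (q n y * e (- (y \<bullet> \<eta>))) \<le> C * (3 * wt y)" for n
      using qb by (simp add: norm_mult)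
    show "(\<lambda>y. q n y * e (- (y \<bullet> \<eta>))) \<in> borel_measurable lborel" for n
      unfolding q_def by measurable
    show "(\<lambda>y. frechet_derivative u (at y) b * e (- (y \<bullet> \<eta>))) \<in> borel_measurable lborel"
      using schwartz_measurable[OF schwartz_deriv[OF u b]] by measurable
  qed
  moreover have "ft (q n) \<eta> = (e (d n * (b \<bullet> \<eta>)) - 1) /\<^sub>R d n * ft u \<eta>" for n
  proof -
    have i: "integrable lborel (\<lambda>y. u (y + d n *\<^sub>R b))"
      using integrable_lborel_affine[where c = 1 and t = "d n *\<^sub>R b" and f = u] schwartz_integrable[OF u] by (simp add: add.commute)
    have "ft (q n) \<eta> = (ft (\<lambda>y. u (y + d n *\<^sub>R b) - u y) \<eta>) /\<^sub>R d n"
      by (simp add: ft_def q_def)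
    also have "ft (\<lambda>y. u (y + d n *\<^sub>R b) - u y) \<eta> = (e (d n * (b \<bullet> \<eta>)) - 1) * ft u \<eta>"
      by (subst ft_diff[OF i schwartz_integrable[OF u]]) (simp add: ft_shift algebra_simps)
    finally show ?thesis by simp
  qed
  moreover have "(\<lambda>n. (e (d n * (b \<bullet> \<eta>)) - 1) /\<^sub>R d n * ft u \<eta>) \<longlonglongrightarrow> 2 * pi * \<i> * of_real (b \<bullet> \<eta>) * ft u \<eta>"
    using tendsto_mult_right[OF difference_quotient_tendsto[OF has_derivative_e[of "b \<bullet> \<eta>" 0] d(1,2), of 1], of "ft u \<eta>"]
    by (simp add: mult.commute)
  ultimately show ?thesis by (simp add: LIMSEQ_unique)
qed

text \<open>Subtracting the second derivative in direction \<open>b\<close> multiplies the transform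
  by \<open>1 + (2 pi (b \<bullet> \<eta>))^2\<close>. Doing so once for every \<open>b\<close>
  produces a denominator at least as large as that of \<open>wt\<close>.\<close>

lemma ft_decay:
  fixes u :: "'a::euclidean_space \<Rightarrow> complex"
  assumes u: "schwartz u" obtains C where "\<And>\<eta>. norm (ft u \<eta>) \<le> C * wt \<eta>"
proof -
  have "\<exists>v. schwartz v \<and> (\<forall>\<eta>. of_real (\<Prod>b\<in>S. 1 + (2 * pi * (b \<bullet> \<eta>))\<^sup>2) * ft u \<eta> = ft v \<eta>)" if "finite S" "S \<subseteq> Basis" for S :: "'a set"
    using that
  proof (induction S rule: finite_induct)
    case empty thus ?case using u by auto
  next
    case (insert b S)
    then obtain v where v: "schwartz v" "\<And>\<eta>. of_real (\<Prod>b\<in>S. 1 + (2 * pi * (b \<bullet> \<eta>))\<^sup>2) * ft u \<eta> = ft v \<eta>" by auto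
    define v' where "v' = (\<lambda>y. frechet_derivative v (at y) b)"
    define v'' where "v'' = (\<lambda>y. frechet_derivative v' (at y) b)"
    have b: "b \<in> Basis" using insert by simp
    have s: "schwartz v'" "schwartz v''" unfolding v'_def v''_def using v b by (auto intro!: schwartz_deriv)
    have 1: "ft (\<lambda>y. v y - v'' y) \<eta> = ft v \<eta> - ft v'' \<eta>" for \<eta>
      by (intro ft_diff schwartz_integrable v s)
    have 2: "ft v'' \<eta> = - of_real ((2 * pi * (b \<bullet> \<eta>))\<^sup>2) * ft v \<eta>" for \<eta>
      unfolding v''_def ft_deriv[OF s(1) b] unfolding v'_def ft_deriv[OF v(1) b]
      by (simp add: power2_eq_square algebra_simps)
    have "ft (\<lambda>y. v y - v'' y) \<eta> = of_real (1 + (2 * pi * (b \<bullet> \<eta>))\<^sup>2) * ft v \<eta>" for \<eta>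
      unfolding 1 2 by (simp add: algebra_simps)
    hence "of_real (\<Prod>b\<in>insert b S. 1 + (2 * pi * (b \<bullet> \<eta>))\<^sup>2) * ft u \<eta> = ft (\<lambda>y. v y - v'' y) \<eta>" for \<eta>
      using insert.hyps by (simp add: v(2)[symmetric] mult.assoc)
    thus ?case using schwartz_diff[OF v(1) s(2)] by blast
  qed
  from this[of Basis] obtain v where v: "schwartz v"
    "\<And>\<eta>. of_real (\<Prod>b\<in>Basis. 1 + (2 * pi * (b \<bullet> \<eta>))\<^sup>2) * ft u \<eta> = ft v \<eta>" by auto
  define C where "C = (LINT y|lborel. norm (v y))"
  have "norm (ft u \<eta>) \<le> C * wt \<eta>" for \<eta>
  proof -
    define P where "P = (\<Prod>b\<in>(Basis::'a set). 1 + (2 * pi * (b \<bullet> \<eta>))\<^sup>2)"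
    define R where "R = (\<Prod>b\<in>(Basis::'a set). 1 + (\<eta> \<bullet> b)\<^sup>2)"
    have "R \<le> P" unfolding P_def R_def
    proof (intro prod_mono conjI)
      fix b :: 'a
      have "1\<^sup>2 \<le> (2 * pi)\<^sup>2" using pi_gt3 by (intro power_mono) auto
      hence "1 * (b \<bullet> \<eta>)\<^sup>2 \<le> (2 * pi)\<^sup>2 * (b \<bullet> \<eta>)\<^sup>2" by (intro mult_right_mono) auto
      thus "1 + (\<eta> \<bullet> b)\<^sup>2 \<le> 1 + (2 * pi * (b \<bullet> \<eta>))\<^sup>2" by (simp add: power_mult_distrib inner_commute)
    qed auto
    have "0 < R" unfolding R_def by (intro prod_pos) (auto intro: add_pos_nonneg)
    have "P * norm (ft u \<eta>) = norm (ft v \<eta>)"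
      using v(2)[of \<eta>] \<open>0 < R\<close> \<open>R \<le> P\<close> unfolding P_def[symmetric]
      by (metis abs_of_pos less_le_trans norm_mult norm_of_real)
    also have "\<dots> \<le> C" unfolding C_def by (rule norm_ft_le)
    finally have "R * norm (ft u \<eta>) \<le> C" using mult_right_mono[OF \<open>R \<le> P\<close>, of "norm (ft u \<eta>)"] by simp
    thus ?thesis using \<open>0 < R\<close> by (simp add: wt_def R_def prod_dividef field_simps)
  qed
  thus thesis using that by blast
qed

lemma ft_integrable: "schwartz u \<Longrightarrow> integrable lborel (ft u)"
  by (meson ft_decay ft_measurable integrable_wt_bound schwartz_measurable)

subsection \<open>Fourier inversion\<close>

definition gam :: "'a::euclidean_space \<Rightarrow> real" where
  "gam x = (\<Prod>b\<in>Basis. std_normal_density (x \<bullet> b))"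

lemma gam_eq: "gam (x::'a::euclidean_space) = (1 / sqrt (2 * pi)) ^ DIM('a) * exp (- (x \<bullet> x) / 2)"
proof -
  have "x \<bullet> x = (\<Sum>b\<in>Basis. (x \<bullet> b)\<^sup>2)" by (subst euclidean_inner) (simp add: power2_eq_square)
  hence "exp (- (x \<bullet> x) / 2) = (\<Prod>b\<in>Basis. exp (- (x \<bullet> b)\<^sup>2 / 2))"
    by (simp add: exp_sum[symmetric] sum_divide_distrib sum_negf)
  thus ?thesis unfolding gam_def std_normal_density_def prod.distrib by simp
qed

lemma gam_nonneg: "0 \<le> gam x"
  by (simp add: gam_def prod_nonneg)

lemma integrable_gam: "integrable lborel (gam :: 'a::euclidean_space \<Rightarrow> real)"
  unfolding gam_def[abs_def] by (rule integrable_prod_lborel) (rule integrable_normal_density, simp)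

lemma integral_gam: "(LINT x|lborel. gam (x::'a::euclidean_space)) = 1"
  unfolding gam_def[abs_def] by (subst integral_prod_lborel) (auto intro!: integrable_normal_density)

lemma gam_measurable [measurable]: "gam \<in> borel_measurable borel"
  using borel_measurable_integrable[OF integrable_gam] by simp

text \<open>The integral factorizes into characteristic functions of the standard normal
  distribution.\<close>

lemma integral_gam_exp:
  fixes t :: "'a::euclidean_space"
  shows "(LINT x|lborel. of_real (gam x) * exp (\<i> * of_real (t \<bullet> x))) = complex_of_real (exp (- (t \<bullet> t) / 2))"
proof -
  have i: "integrable lborel (\<lambda>x. complex_of_real (std_normal_density x) * exp (\<i> * of_real (s * x)))" for s
  proof (rule Bochner_Integration.integrable_bound)
    show "integrable lborel std_normal_density" by (rule integrable_normal_density) simp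
  qed (auto simp: norm_mult)
  have c: "(LINT x|lborel. complex_of_real (std_normal_density x) * exp (\<i> * of_real (s * x))) = exp (- s\<^sup>2 / 2)" for s
  proof -
    have "char std_normal_distribution s = (LINT x|lborel. std_normal_density x *\<^sub>R iexp (s * x))"
      unfolding char_def by (rule integral_density) auto
    thus ?thesis by (simp add: char_std_normal_distribution scaleR_conv_of_real)
  qed
  have "(\<Prod>b\<in>Basis. exp (\<i> * of_real ((t \<bullet> b) * (x \<bullet> b)))) = exp (\<i> * of_real (t \<bullet> x))" for x
    by (subst euclidean_inner) (simp add: exp_sum[symmetric] sum_distrib_left[symmetric])
  hence "of_real (gam x) * exp (\<i> * of_real (t \<bullet> x))
    = (\<Prod>b\<in>Basis. complex_of_real (std_normal_density (x \<bullet> b)) * exp (\<i> * of_real ((t \<bullet> b) * (x \<bullet> b))))" for x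
    by (simp add: gam_def prod.distrib)
  hence "(LINT x|lborel. of_real (gam x) * exp (\<i> * of_real (t \<bullet> x)))
    = (\<Prod>b\<in>Basis. complex_of_real (exp (- (t \<bullet> b)\<^sup>2 / 2)))"
    by (simp only: integral_prod_lborel[OF i] c)
  also have "\<dots> = complex_of_real (exp (- (t \<bullet> t) / 2))"
  proof -
    have "t \<bullet> t = (\<Sum>b\<in>Basis. (t \<bullet> b)\<^sup>2)" by (subst euclidean_inner) (simp add: power2_eq_square)
    thus ?thesis by (simp add: exp_sum[symmetric] sum_divide_distrib sum_negf flip: of_real_prod)
  qed
  finally show ?thesis .
qed

text \<open>A dilated Gaussian is the Fourier transform of a dilated Gaussian; this makes the
  regularized inversion integral an average of \<open>u\<close> near \<open>x\<close>.\<close>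

lemma ft_gaussian:
  fixes z :: "'a::euclidean_space"
  assumes \<epsilon>: "0 < \<epsilon>"
  shows "(LINT \<eta>|lborel. e ((\<epsilon> *\<^sub>R z) \<bullet> \<eta>) * of_real (exp (- (2 * pi\<^sup>2 * \<epsilon>\<^sup>2 * (\<eta> \<bullet> \<eta>))))) = of_real (gam z / \<epsilon> ^ DIM('a))"
proof -
  define K where "K = (1 / sqrt (2 * pi)) ^ DIM('a)"
  have K: "0 < K" by (simp add: K_def)
  have gK: "gam x = K * exp (- (x \<bullet> x) / 2)" for x :: 'a by (simp only: gam_eq K_def)
  let ?f = "\<lambda>x::'a. of_real (gam x) * exp (\<i> * of_real (z \<bullet> x))"
  let ?c = "2 * pi * \<epsilon>"
  have c: "0 < ?c" using \<epsilon> by simp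
  have "?f (0 + ?c *\<^sub>R \<eta>) = of_real K * (e ((\<epsilon> *\<^sub>R z) \<bullet> \<eta>) * of_real (exp (- (2 * pi\<^sup>2 * \<epsilon>\<^sup>2 * (\<eta> \<bullet> \<eta>)))))" for \<eta>
    by (simp add: gK e_def cis_conv_exp power2_eq_square algebra_simps)
  hence "of_real (exp (- (z \<bullet> z) / 2)) = \<bar>?c\<bar> ^ DIM('a) *\<^sub>R (LINT \<eta>|lborel. of_real K * (e ((\<epsilon> *\<^sub>R z) \<bullet> \<eta>) * of_real (exp (- (2 * pi\<^sup>2 * \<epsilon>\<^sup>2 * (\<eta> \<bullet> \<eta>))))))"
    unfolding integral_gam_exp[symmetric] using c \<epsilon> by (subst integral_lborel_affine[where c = ?c and t = 0]) simp_all
  also have "\<dots> = of_real (?c ^ DIM('a) * K) * (LINT \<eta>|lborel. e ((\<epsilon> *\<^sub>R z) \<bullet> \<eta>) * of_real (exp (- (2 * pi\<^sup>2 * \<epsilon>\<^sup>2 * (\<eta> \<bullet> \<eta>)))))"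
    using c by (simp add: scaleR_conv_of_real)
  finally have "(LINT \<eta>|lborel. e ((\<epsilon> *\<^sub>R z) \<bullet> \<eta>) * of_real (exp (- (2 * pi\<^sup>2 * \<epsilon>\<^sup>2 * (\<eta> \<bullet> \<eta>)))))
     = of_real (exp (- (z \<bullet> z) / 2) / (?c ^ DIM('a) * K))"
    using c K \<epsilon> by (simp add: field_simps)
  also have "exp (- (z \<bullet> z) / 2) = gam z / K" using K by (simp add: gK)
  also have "gam z / K / (?c ^ DIM('a) * K) = gam z / \<epsilon> ^ DIM('a)"
  proof -
    have "K * K * (2 * pi) ^ DIM('a) = 1"
      unfolding K_def power_mult_distrib[symmetric] by simp
    thus ?thesis using K \<epsilon> by (simp add: power_mult_distrib field_simps)
  qed
  finally show ?thesis .
qed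

text \<open>The Gaussian factor makes the double integrand absolutely integrable, so the integrals
  may be exchanged. After the substitution \<open>y = x - \<epsilon> z\<close> the inner one is
  \<open>ft_gaussian\<close>, whose power of \<open>\<epsilon>\<close> cancels the Jacobian.\<close>

lemma regularized_inversion:
  fixes u :: "'a::euclidean_space \<Rightarrow> complex"
  assumes u: "integrable lborel u" and \<epsilon>: "0 < \<epsilon>"
  shows "(LINT \<eta>|lborel. ft u \<eta> * e (x \<bullet> \<eta>) * of_real (exp (- (2 * pi\<^sup>2 * \<epsilon>\<^sup>2 * (\<eta> \<bullet> \<eta>)))))
    = (LINT z|lborel. u (x - \<epsilon> *\<^sub>R z) * of_real (gam z))"
proof -
  define G where "G \<eta> = exp (- (2 * pi\<^sup>2 * \<epsilon>\<^sup>2 * (\<eta> \<bullet> \<eta>)))" for \<eta> :: 'a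
  have [measurable]: "u \<in> borel_measurable borel" using borel_measurable_integrable[OF u] by simp
  have [measurable]: "G \<in> borel_measurable borel" unfolding G_def[abs_def] by measurable
  have G: "integrable lborel G"
  proof -
    define K where "K = (1 / sqrt (2 * pi)) ^ DIM('a)"
    have K: "K \<noteq> 0" by (simp add: K_def)
    have gK: "gam x = K * exp (- (x \<bullet> x) / 2)" for x :: 'a by (simp only: gam_eq K_def)
    have "integrable lborel (\<lambda>\<eta>::'a. gam (0 + (2 * pi * \<epsilon>) *\<^sub>R \<eta>))"
      using \<epsilon> by (subst integrable_lborel_affine) (auto intro: integrable_gam)
    hence "integrable lborel (\<lambda>\<eta>::'a. (1 / K) * gam (0 + (2 * pi * \<epsilon>) *\<^sub>R \<eta>))" by (rule integrable_mult_right)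
    moreover have "(1 / K) * gam (0 + (2 * pi * \<epsilon>) *\<^sub>R \<eta>) = G \<eta>" for \<eta> :: 'a
      using K by (simp add: gK G_def power2_eq_square algebra_simps)
    ultimately show ?thesis by simp
  qed
  define F where "F \<eta> y = u y * e (- (y \<bullet> \<eta>)) * e (x \<bullet> \<eta>) * of_real (G \<eta>)" for \<eta> y
  have intF: "integrable (lborel \<Otimes>\<^sub>M lborel) (case_prod F)"
  proof (rule lborel_pair.Fubini_integrable)
    show "case_prod F \<in> borel_measurable (lborel \<Otimes>\<^sub>M lborel)" unfolding F_def by measurable
    have "(\<lambda>\<eta>. LINT y|lborel. norm (case_prod F (\<eta>, y))) = (\<lambda>\<eta>. (LINT y|lborel. norm (u y)) * G \<eta>)"
      by (auto simp: F_def norm_mult G_def)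
    thus "integrable lborel (\<lambda>\<eta>. LINT y|lborel. norm (case_prod F (\<eta>, y)))"
      by (simp add: G)
    show "AE \<eta> in lborel. integrable lborel (\<lambda>y. case_prod F (\<eta>, y))"
      unfolding F_def by (auto intro!: integrable_mult_left integrable_ft_integrand u)
  qed
  have "(LINT \<eta>|lborel. ft u \<eta> * e (x \<bullet> \<eta>) * of_real (G \<eta>)) = (LINT \<eta>|lborel. LINT y|lborel. F \<eta> y)"
    unfolding F_def ft_def by (simp only: integral_mult_left_zero)
  also have "\<dots> = (LINT y|lborel. LINT \<eta>|lborel. F \<eta> y)"
    by (rule lborel_pair.Fubini_integral[OF intF, symmetric])
  also have "\<dots> = (LINT y|lborel. u y * (LINT \<eta>|lborel. e ((x - y) \<bullet> \<eta>) * of_real (G \<eta>)))"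
  proof (rule Bochner_Integration.integral_cong[OF refl])
    fix y
    have "F \<eta> y = u y * (e ((x - y) \<bullet> \<eta>) * of_real (G \<eta>))" for \<eta>
      using e_add[of "- (y \<bullet> \<eta>)" "x \<bullet> \<eta>"] by (simp add: F_def inner_diff_left mult.assoc[symmetric])
    thus "(LINT \<eta>|lborel. F \<eta> y) = u y * (LINT \<eta>|lborel. e ((x - y) \<bullet> \<eta>) * of_real (G \<eta>))" by simp
  qed
  also have "\<dots> = \<bar>- \<epsilon>\<bar> ^ DIM('a) *\<^sub>R (LINT z|lborel. u (x + (- \<epsilon>) *\<^sub>R z) * (LINT \<eta>|lborel. e ((x - (x + (- \<epsilon>) *\<^sub>R z)) \<bullet> \<eta>) * of_real (G \<eta>)))"
    by (rule integral_lborel_affine)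
       (use \<epsilon> in \<open>auto intro!: borel_measurable_times lborel.borel_measurable_lebesgue_integral\<close>)
  also have "\<dots> = \<epsilon> ^ DIM('a) *\<^sub>R (LINT z|lborel. u (x - \<epsilon> *\<^sub>R z) * of_real (gam z / \<epsilon> ^ DIM('a)))"
  proof -
    have "(LINT \<eta>|lborel. e ((x - (x + (- \<epsilon>) *\<^sub>R z)) \<bullet> \<eta>) * of_real (G \<eta>)) = of_real (gam z / \<epsilon> ^ DIM('a))" for z
      using ft_gaussian[OF \<epsilon>, of z] by (simp add: G_def)
    thus ?thesis using \<epsilon> by (simp only:) simp
  qed
  also have "\<dots> = (LINT z|lborel. u (x - \<epsilon> *\<^sub>R z) * of_real (gam z))"
    using \<epsilon> by (simp add: scaleR_conv_of_real)
  finally show ?thesis by (simp add: G_def)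
qed

text \<open>Both sides of \<open>regularized_inversion\<close> have limits as the regularization is
  removed, with majorants \<open>norm (ft u \<eta>)\<close> on the left and a multiple of the
  Gaussian density on the right.\<close>

theorem schwartz_Fourier_inversion:
  fixes u :: "'a::euclidean_space \<Rightarrow> complex"
  assumes u: "schwartz u"
  shows "(LINT \<eta>|lborel. ft u \<eta> * e (x \<bullet> \<eta>)) = u x"
proof (rule LIMSEQ_unique)
  define d :: "nat \<Rightarrow> real" where "d n = 1 / real (Suc n)" for n
  have d: "d \<longlonglongrightarrow> 0" "\<And>n. 0 < d n"
    unfolding d_def by (rule LIMSEQ_Suc[OF lim_1_over_n]) simp_all
  have [measurable]: "u \<in> borel_measurable borel" by (rule schwartz_measurable[OF u])
  have [measurable]: "ft u \<in> borel_measurable borel" by (rule ft_measurable) measurable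
  let ?I = "\<lambda>n. LINT \<eta>|lborel. ft u \<eta> * e (x \<bullet> \<eta>) * of_real (exp (- (2 * pi\<^sup>2 * (d n)\<^sup>2 * (\<eta> \<bullet> \<eta>))))"
  show "?I \<longlonglongrightarrow> (LINT \<eta>|lborel. ft u \<eta> * e (x \<bullet> \<eta>))"
  proof (rule integral_dominated_convergence[where w = "\<lambda>\<eta>. norm (ft u \<eta>)"])
    show "integrable lborel (\<lambda>\<eta>. norm (ft u \<eta>))" by (intro integrable_norm ft_integrable u)
    have "(\<lambda>n. ft u \<eta> * e (x \<bullet> \<eta>) * of_real (exp (- (2 * pi\<^sup>2 * (d n)\<^sup>2 * (\<eta> \<bullet> \<eta>)))))
       \<longlonglongrightarrow> ft u \<eta> * e (x \<bullet> \<eta>) * of_real (exp (- (2 * pi\<^sup>2 * 0\<^sup>2 * (\<eta> \<bullet> \<eta>))))" for \<eta>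
      by (intro tendsto_intros d)
    thus "AE \<eta> in lborel. (\<lambda>n. ft u \<eta> * e (x \<bullet> \<eta>) * of_real (exp (- (2 * pi\<^sup>2 * (d n)\<^sup>2 * (\<eta> \<bullet> \<eta>)))))
       \<longlonglongrightarrow> ft u \<eta> * e (x \<bullet> \<eta>)" by simp
    show "AE \<eta> in lborel. norm (ft u \<eta> * e (x \<bullet> \<eta>) * of_real (exp (- (2 * pi\<^sup>2 * (d n)\<^sup>2 * (\<eta> \<bullet> \<eta>))))) \<le> norm (ft u \<eta>)" for n
      by (auto simp: norm_mult intro!: mult_left_le)
  qed measurable
  obtain B where B: "0 \<le> B" "\<And>x. norm (u x) \<le> B" using schwartz_bounded[OF u] by blast
  have "(\<lambda>n. LINT z|lborel. u (x - d n *\<^sub>R z) * of_real (gam z)) \<longlonglongrightarrow> (LINT z|lborel. u x * of_real (gam (z::'a)))"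
  proof (rule integral_dominated_convergence[where w = "\<lambda>z. B * gam z"])
    show "integrable lborel (\<lambda>z::'a. B * gam z)" by (intro integrable_mult_right integrable_gam)
    have "isCont u x" using schwartz_continuous_on[OF u, of UNIV] by (simp add: continuous_on_eq_continuous_at)
    moreover have "(\<lambda>n. x - d n *\<^sub>R z) \<longlonglongrightarrow> x - 0 *\<^sub>R z" for z by (intro tendsto_intros d)
    ultimately have "(\<lambda>n. u (x - d n *\<^sub>R z)) \<longlonglongrightarrow> u x" for z
      by (intro isCont_tendsto_compose[where g = u]) simp_all
    thus "AE z in lborel. (\<lambda>n. u (x - d n *\<^sub>R z) * of_real (gam z)) \<longlonglongrightarrow> u x * of_real (gam z)"
      by (intro AE_I2 tendsto_mult_right)
    show "AE z in lborel. norm (u (x - d n *\<^sub>R z) * of_real (gam z)) \<le> B * gam z" for n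
      by (intro AE_I2) (auto simp: norm_mult abs_of_nonneg[OF gam_nonneg] intro!: mult_right_mono B gam_nonneg)
  qed measurable
  also have "(LINT z|lborel. u x * of_real (gam (z::'a))) = u x"
    by (simp add: integral_gam)
  finally show "?I \<longlonglongrightarrow> u x"
    using regularized_inversion[OF schwartz_integrable[OF u] d(2)] by simp
qed

section \<open>Quantization\<close>

subsection \<open>Weyl quantization of a Fourier series\<close>

lemma wseries_pairing:
  fixes k t :: "nat \<Rightarrow> 'a::euclidean_space"
  assumes c: "rapid c m" and u: "schwartz u" and phi: "schwartz \<phi>"
  shows "(LINT x|lborel. wseries c k t u x * \<phi> x) = (\<Sum>j. c j * (LINT x|lborel. e (k j \<bullet> x) * u (x - t j) * \<phi> x))"
proof -
  obtain B where B: "0 \<le> B" "\<And>x. norm (\<phi> x) \<le> B" using schwartz_bounded[OF phi] by blast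
  obtain A where A: "0 \<le> A" "\<And>x. norm (u x) \<le> A" using schwartz_bounded[OF u] by blast
  define f where "f j x = c j * (e (k j \<bullet> x) * u (x - t j) * \<phi> x)" for j x
  have [measurable]: "u \<in> borel_measurable borel" "\<phi> \<in> borel_measurable borel"
    using u phi by (simp_all add: schwartz_measurable)
  have bound: "norm (f j x) \<le> norm (c j) * (A * norm (\<phi> x))" for j x
    using A B by (auto simp: f_def norm_mult intro!: mult_left_mono mult_right_mono)
  have i\<phi>: "integrable lborel (\<lambda>x. norm (\<phi> x))" by (intro integrable_norm schwartz_integrable phi)
  have int: "integrable lborel (f j)" for j
  proof (rule Bochner_Integration.integrable_bound)
    show "integrable lborel (\<lambda>x. norm (c j) * (A * norm (\<phi> x)))" by (intro integrable_mult_right i\<phi>)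
    show "AE x in lborel. norm (f j x) \<le> norm (norm (c j) * (A * norm (\<phi> x)))"
      using bound A by (auto simp: abs_mult)
    show "f j \<in> borel_measurable lborel" unfolding f_def[abs_def] by measurable
  qed
  have "wseries c k t u x * \<phi> x = (\<Sum>j. f j x)" for x
    unfolding wseries_def suminf_mult2[OF summable_norm_cancel[OF wseries_summable[OF c u]]] f_def
    by (simp only: mult.assoc)
  hence "(LINT x|lborel. wseries c k t u x * \<phi> x) = (LINT x|lborel. (\<Sum>j. f j x))" by simp
  also have "\<dots> = (\<Sum>j. integral\<^sup>L lborel (f j))"
  proof (rule integral_suminf[OF int])
    show "AE x in lborel. summable (\<lambda>j. norm (f j x))"
      using bound by (intro AE_I2 summable_comparison_test'[OF summable_mult2[OF rapid_summable_norm[OF c]]]) auto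
    show "summable (\<lambda>j. LINT x|lborel. norm (f j x))"
    proof (rule summable_comparison_test'[OF summable_mult2[OF rapid_summable_norm[OF c]]])
      fix j
      have "(LINT x|lborel. norm (f j x)) \<le> (LINT x|lborel. norm (c j) * (A * norm (\<phi> x)))"
        by (intro integral_mono integrable_norm int integrable_mult_right i\<phi> bound)
      thus "norm (LINT x|lborel. norm (f j x)) \<le> norm (c j) * (A * (LINT x|lborel. norm (\<phi> x)))" by simp
    qed
  qed
  finally show ?thesis by (simp add: f_def[abs_def])
qed

lemma schwartz_mult_integrable:
  assumes "schwartz u" "schwartz v" shows "integrable lborel (\<lambda>x. u x * v x)"
proof -
  obtain A where A: "0 \<le> A" "\<And>x. norm (u x) \<le> A" using schwartz_bounded[OF assms(1)] by blast
  show ?thesis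
  proof (rule Bochner_Integration.integrable_bound)
    show "integrable lborel (\<lambda>x. A * norm (v x))" by (intro integrable_mult_right integrable_norm schwartz_integrable assms)
    show "AE x in lborel. norm (u x * v x) \<le> norm (A * norm (v x))"
      using A by (auto simp: norm_mult abs_mult intro!: mult_right_mono)
    show "(\<lambda>x. u x * v x) \<in> borel_measurable lborel"
      using schwartz_measurable[OF assms(1)] schwartz_measurable[OF assms(2)] by measurable
  qed
qed

text \<open>Testing with the complex conjugate of the difference yields its squared L2 norm, and a
  continuous function that vanishes almost everywhere vanishes. This is the uniqueness behind the
  description in \<open>transposed\<close>.\<close>

lemma schwartz_pairing_eqI:
  fixes \<psi> \<psi>' :: "'a::euclidean_space \<Rightarrow> complex"
  assumes "schwartz \<psi>" "schwartz \<psi>'"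
    and eq: "\<And>u. schwartz u \<Longrightarrow> (LINT x|lborel. u x * \<psi> x) = (LINT x|lborel. u x * \<psi>' x)"
  shows "\<psi> = \<psi>'"
proof -
  define D where "D x = \<psi> x - \<psi>' x" for x
  have D: "schwartz D" unfolding D_def[abs_def] by (intro schwartz_diff assms)
  have cD: "schwartz (\<lambda>x. cnj (D x))" by (rule schwartz_cnj[OF D])
  have "(LINT x|lborel. cnj (D x) * D x) = 0"
    using eq[OF cD] schwartz_mult_integrable[OF cD assms(1)] schwartz_mult_integrable[OF cD assms(2)]
    by (simp add: D_def right_diff_distrib)
  also have "(LINT x|lborel. cnj (D x) * D x) = (LINT x|lborel. complex_of_real ((norm (D x))\<^sup>2))"
    by (intro Bochner_Integration.integral_cong refl) (metis complex_norm_square mult.commute)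
  finally have 0: "(LINT x|lborel. (norm (D x))\<^sup>2) = 0"
    by (simp only: integral_complex_of_real of_real_eq_0_iff)
  have "integrable lborel (\<lambda>x. norm (cnj (D x) * D x))"
    by (intro integrable_norm schwartz_mult_integrable cD D)
  hence "integrable lborel (\<lambda>x. (norm (D x))\<^sup>2)" by (simp add: norm_mult power2_eq_square)
  hence "AE x in lborel. (norm (D x))\<^sup>2 = 0"
    using 0 by (subst (asm) integral_nonneg_eq_0_iff_AE) auto
  hence "AE x in lebesgue. x \<in> {x. D x = 0}" by (intro AE_completion) simp
  moreover have "closed {x. D x = 0}"
    using schwartz_continuous_on[OF D, of UNIV] by (intro closed_Collect_eq) auto
  ultimately have "D x = 0" for x
    using mem_closed_if_AE_lebesgue_open[of UNIV "{x. D x = 0}" x] by auto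
  thus ?thesis by (auto simp: D_def fun_eq_iff)
qed

text \<open>For a single exponential the \<open>y\<close>-integral is the Fourier transform of
  \<open>u\<close> at \<open>N \<xi> - k / 2\<close>, and the \<open>\<xi>\<close>-integral is
  Fourier inversion at \<open>x + l / N\<close>. The Jacobian of the scaling by \<open>N\<close>
  cancels the prefactor, and the midpoint \<open>(x + y) / 2\<close> leaves the phase
  \<open>k \<bullet> l / (2 N)\<close>.\<close>

lemma weyl_Fourier_series:
  fixes a :: "(real^'d) \<times> (real^'d) \<Rightarrow> complex" and u :: "real^'d \<Rightarrow> complex"
  assumes N: "1 \<le> N" and h: "h = 1 / (2 * pi * real N)" and c: "rapid c m"
    and a: "\<And>z. (\<lambda>j. c j * e (m j \<bullet> z)) sums a z" and u: "schwartz u"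
  shows "weyl h a u = wseries (\<lambda>j. c j * e (fst (m j) \<bullet> snd (m j) / (2 * N))) (\<lambda>j. fst (m j)) (\<lambda>j. - (snd (m j) /\<^sub>R N)) u"
proof
  fix x
  have N0: "0 < real N" using N by simp
  let ?k = "\<lambda>j. fst (m j)" and ?l = "\<lambda>j. snd (m j)" and ?D = "CARD('d)"
  have [measurable]: "u \<in> borel_measurable borel" by (rule schwartz_measurable[OF u])
  have iu: "integrable lborel u" by (rule schwartz_integrable[OF u])
  have ift: "integrable lborel (ft u)" by (rule ft_integrable[OF u])
  have [measurable]: "ft u \<in> borel_measurable borel" by (rule ft_measurable) measurable
  define g where "g j \<xi> = c j * e (N * (x \<bullet> \<xi>) + ?k j \<bullet> x / 2 + ?l j \<bullet> \<xi>)" for j \<xi>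
  define s where "s j \<xi> = N *\<^sub>R \<xi> - (1/2) *\<^sub>R ?k j" for j \<xi>
  have ng: "norm (g j \<xi>) = norm (c j)" for j \<xi> by (simp add: g_def norm_mult)
  have inner: "(LINT y|lborel. exp (\<i> / of_real h * of_real ((x - y) \<bullet> \<xi>)) * a ((1/2) *\<^sub>R (x + y), \<xi>) * u y)
     = (\<Sum>j. g j \<xi> * ft u (s j \<xi>))" for \<xi>
  proof -
    define f where "f j y = g j \<xi> * (u y * e (- (y \<bullet> s j \<xi>)))" for j y
    have exp: "exp (\<i> / of_real h * of_real ((x - y) \<bullet> \<xi>)) = e (N * ((x - y) \<bullet> \<xi>))" for y
      by (simp add: h e_def cis_conv_exp mult.assoc mult.left_commute)
    have "(\<lambda>j. e (N * ((x - y) \<bullet> \<xi>)) * (c j * e (m j \<bullet> ((1/2) *\<^sub>R (x + y), \<xi>))) * u y) sums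
        (e (N * ((x - y) \<bullet> \<xi>)) * a ((1/2) *\<^sub>R (x + y), \<xi>) * u y)" for y
      by (intro sums_mult sums_mult2 a)
    moreover have "e (N * ((x - y) \<bullet> \<xi>)) * (c j * e (m j \<bullet> ((1/2) *\<^sub>R (x + y), \<xi>))) * u y = f j y" for y j
    proof -
      have "N * ((x - y) \<bullet> \<xi>) + m j \<bullet> ((1/2) *\<^sub>R (x + y), \<xi>)
          = (N * (x \<bullet> \<xi>) + ?k j \<bullet> x / 2 + ?l j \<bullet> \<xi>) + - (y \<bullet> s j \<xi>)"
        by (simp add: inner_prod_def s_def inner_diff_left inner_diff_right inner_add_right algebra_simps inner_commute)
      hence "e (N * ((x - y) \<bullet> \<xi>)) * e (m j \<bullet> ((1/2) *\<^sub>R (x + y), \<xi>))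
          = e (N * (x \<bullet> \<xi>) + ?k j \<bullet> x / 2 + ?l j \<bullet> \<xi>) * e (- (y \<bullet> s j \<xi>))"
        by (simp only: e_add[symmetric])
      thus ?thesis by (simp add: f_def g_def mult.assoc mult.left_commute)
    qed
    ultimately have S: "exp (\<i> / of_real h * of_real ((x - y) \<bullet> \<xi>)) * a ((1/2) *\<^sub>R (x + y), \<xi>) * u y = (\<Sum>j. f j y)" for y
      unfolding exp by (simp add: sums_iff)
    have int: "integrable lborel (f j)" for j
      unfolding f_def[abs_def] by (intro integrable_mult_right integrable_ft_integrand iu)
    have nf: "norm (f j y) = norm (c j) * norm (u y)" for j y by (simp add: f_def norm_mult ng)
    have "(LINT y|lborel. (\<Sum>j. f j y)) = (\<Sum>j. integral\<^sup>L lborel (f j))"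
    proof (rule integral_suminf[OF int])
      show "AE y in lborel. summable (\<lambda>j. norm (f j y))"
        unfolding nf by (intro AE_I2 summable_mult2 rapid_summable_norm[OF c])
      show "summable (\<lambda>j. LINT y|lborel. norm (f j y))"
        unfolding nf by (simp add: summable_mult2 rapid_summable_norm[OF c])
    qed
    thus ?thesis unfolding S by (simp add: f_def[abs_def] ft_def)
  qed
  have int: "integrable lborel (\<lambda>\<xi>. ft u (s j \<xi>))" for j
    using integrable_lborel_affine[where c = "real N" and t = "- ((1/2) *\<^sub>R ?k j)" and f = "ft u"] N0 ift
    by (simp add: s_def add.commute)
  \<comment> \<open>All maps \<open>s j\<close> have the same Jacobian, so the absolute integrals of
    the terms are \<open>norm (c j)\<close> times one constant and the series may be integrated
    termwise.\<close>
  have outer: "(LINT \<xi>|lborel. (\<Sum>j. g j \<xi> * ft u (s j \<xi>))) = (\<Sum>j. (LINT \<xi>|lborel. g j \<xi> * ft u (s j \<xi>)))"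
  proof (rule integral_suminf)
    show "integrable lborel (\<lambda>\<xi>. g j \<xi> * ft u (s j \<xi>))" for j
    proof -
      have "integrable lborel (\<lambda>\<xi>. c j * (ft u (s j \<xi>) * e (N * (x \<bullet> \<xi>) + ?k j \<bullet> x / 2 + ?l j \<bullet> \<xi>)))"
        by (intro integrable_mult_right integrable_mult_e int) measurable
      thus ?thesis by (simp add: g_def ac_simps)
    qed
    obtain B where B: "\<And>\<eta>. norm (ft u \<eta>) \<le> B" using norm_ft_le by blast
    show "AE \<xi> in lborel. summable (\<lambda>j. norm (g j \<xi> * ft u (s j \<xi>)))"
      using B by (intro AE_I2 summable_comparison_test'[OF summable_mult2[OF rapid_summable_norm[OF c], of B]])
        (auto simp: norm_mult ng intro!: mult_left_mono)
    have "(LINT \<xi>|lborel. norm (ft u (s j \<xi>))) = (LINT \<eta>|lborel. norm (ft u \<eta>)) / N ^ ?D" for j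
      using integral_lborel_affine[where c = "real N" and t = "- ((1/2) *\<^sub>R ?k j)" and f = "\<lambda>\<eta>. norm (ft u \<eta>)"] N0
      by (simp add: s_def add.commute field_simps)
    thus "summable (\<lambda>j. LINT \<xi>|lborel. norm (g j \<xi> * ft u (s j \<xi>)))"
      unfolding norm_mult ng by (simp add: summable_mult2 rapid_summable_norm[OF c])
  qed
  have term_eq: "of_real (N ^ ?D) * (LINT \<xi>|lborel. g j \<xi> * ft u (s j \<xi>))
      = c j * e (?k j \<bullet> ?l j / (2 * N)) * e (?k j \<bullet> x) * u (x - - (?l j /\<^sub>R N))" for j
  proof -
    define x' where "x' = x + ?l j /\<^sub>R N"
    define F where "F \<eta> = ft u \<eta> * e (x' \<bullet> \<eta>)" for \<eta>
    have Fm: "F \<in> borel_measurable borel" unfolding F_def[abs_def] by measurable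
    have "u x' = integral\<^sup>L lborel F"
      unfolding F_def[abs_def] by (rule schwartz_Fourier_inversion[OF u, symmetric])
    also have "\<dots> = \<bar>real N\<bar> ^ DIM(real^'d) *\<^sub>R (LINT \<xi>|lborel. F (- ((1/2) *\<^sub>R ?k j) + N *\<^sub>R \<xi>))"
      using N0 by (intro integral_lborel_affine Fm) simp
    also have "\<dots> = real N ^ ?D *\<^sub>R (LINT \<xi>|lborel. F (- ((1/2) *\<^sub>R ?k j) + N *\<^sub>R \<xi>))" by simp
    finally have "u x' = real N ^ ?D *\<^sub>R (LINT \<xi>|lborel. F (- ((1/2) *\<^sub>R ?k j) + N *\<^sub>R \<xi>))" .
    moreover have "c j * e (?k j \<bullet> ?l j / (2 * N)) * e (?k j \<bullet> x) * F (- ((1/2) *\<^sub>R ?k j) + N *\<^sub>R \<xi>) = g j \<xi> * ft u (s j \<xi>)" for \<xi>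
    proof -
      have "?k j \<bullet> ?l j / (2 * N) + ?k j \<bullet> x + x' \<bullet> (- ((1/2) *\<^sub>R ?k j) + N *\<^sub>R \<xi>)
          = N * (x \<bullet> \<xi>) + ?k j \<bullet> x / 2 + ?l j \<bullet> \<xi>"
        using N0 by (simp add: x'_def inner_add_left inner_add_right inner_diff_right inner_commute field_simps)
      hence "e (?k j \<bullet> ?l j / (2 * N)) * e (?k j \<bullet> x) * e (x' \<bullet> (- ((1/2) *\<^sub>R ?k j) + N *\<^sub>R \<xi>))
          = e (N * (x \<bullet> \<xi>) + ?k j \<bullet> x / 2 + ?l j \<bullet> \<xi>)"
        by (simp only: e_add[symmetric])
      thus ?thesis by (simp add: F_def g_def s_def ac_simps)
    qed
    hence "(LINT \<xi>|lborel. g j \<xi> * ft u (s j \<xi>))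
      = c j * e (?k j \<bullet> ?l j / (2 * N)) * e (?k j \<bullet> x) * (LINT \<xi>|lborel. F (- ((1/2) *\<^sub>R ?k j) + N *\<^sub>R \<xi>))"
      by (simp only: integral_mult_right_zero[symmetric])
    ultimately show ?thesis by (simp add: x'_def scaleR_conv_of_real)
  qed
  have "weyl h a u x = of_real (N ^ ?D) * (\<Sum>j. (LINT \<xi>|lborel. g j \<xi> * ft u (s j \<xi>)))"
    unfolding weyl_def inner outer using N0 by (simp add: h power_one_over)
  also have "\<dots> = (\<Sum>j. of_real (N ^ ?D) * (LINT \<xi>|lborel. g j \<xi> * ft u (s j \<xi>)))"
  proof (rule suminf_mult[symmetric])
    have c': "rapid (\<lambda>j. c j * e (?k j \<bullet> ?l j / (2 * N))) m" using c by (simp add: rapid_def norm_mult)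
    have "summable (\<lambda>j. of_real (N ^ ?D) * (LINT \<xi>|lborel. g j \<xi> * ft u (s j \<xi>)))"
      unfolding term_eq by (rule summable_norm_cancel[OF wseries_summable[OF c' u]])
    thus "summable (\<lambda>j. (LINT \<xi>|lborel. g j \<xi> * ft u (s j \<xi>)))"
      using N0 by (subst (asm) summable_cmult_iff) auto
  qed
  also have "\<dots> = wseries (\<lambda>j. c j * e (?k j \<bullet> ?l j / (2 * N))) ?k (\<lambda>j. - (?l j /\<^sub>R N)) u x"
    unfolding term_eq wseries_def ..
  finally show "weyl h a u x = wseries (\<lambda>j. c j * e (?k j \<bullet> ?l j / (2 * N))) ?k (\<lambda>j. - (?l j /\<^sub>R N)) u x" .
qed

text \<open>A change of variables moves the shift by \<open>l / N\<close> from \<open>u\<close> to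
  \<open>\<phi>\<close>. The exponential is shifted along with it, which changes the sign of the
  phase \<open>k \<bullet> l / (2 N)\<close>.\<close>

lemma transposed_weyl_Fourier_series:
  fixes a :: "(real^'d) \<times> (real^'d) \<Rightarrow> complex" and \<phi> :: "real^'d \<Rightarrow> complex"
  assumes N: "1 \<le> N" and h: "h = 1 / (2 * pi * real N)" and c: "rapid c m"
    and a: "\<And>z. (\<lambda>j. c j * e (m j \<bullet> z)) sums a z" and phi: "schwartz \<phi>"
  shows "transposed (weyl h a) \<phi> = wseries (\<lambda>j. c j * e (- (fst (m j) \<bullet> snd (m j) / (2 * N)))) (\<lambda>j. fst (m j)) (\<lambda>j. snd (m j) /\<^sub>R N) \<phi>"
    (is "_ = ?\<psi>")
  unfolding transposed_def
proof (rule the_equality)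
  have N0: "0 < real N" using N by simp
  let ?k = "\<lambda>j. fst (m j)" and ?l = "\<lambda>j. snd (m j)"
  have r: "rapid (\<lambda>j. c j * e (x j)) m" for x using c by (simp add: rapid_def norm_mult)
  have psi: "schwartz ?\<psi>"
  proof (rule schwartz_wseries[OF r phi])
    show "norm (?k j) \<le> norm (m j)" for j by (metis norm_fst_le prod.collapse)
    have "norm (?l j /\<^sub>R N) \<le> norm (?l j)" for j
      using mult_right_mono[of 1 "real N" "norm (?l j)"] N N0 by (simp add: field_simps)
    moreover have "norm (?l j) \<le> norm (m j)" for j by (metis norm_snd_le prod.collapse)
    ultimately show "norm (?l j /\<^sub>R N) \<le> norm (m j)" for j using order_trans by blast
  qed
  have pair: "(LINT x|lborel. weyl h a u x * \<phi> x) = (LINT x|lborel. u x * ?\<psi> x)" if u: "schwartz u" for u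
  proof -
    have [measurable]: "u \<in> borel_measurable borel" "\<phi> \<in> borel_measurable borel"
      using u phi by (simp_all add: schwartz_measurable)
    have "(LINT x|lborel. weyl h a u x * \<phi> x) = (\<Sum>j. c j * e (?k j \<bullet> ?l j / (2 * N)) * (LINT x|lborel. e (?k j \<bullet> x) * u (x - - (?l j /\<^sub>R N)) * \<phi> x))"
      unfolding weyl_Fourier_series[OF N h c a u] by (rule wseries_pairing[OF r u phi])
    also have "\<dots> = (\<Sum>j. c j * e (- (?k j \<bullet> ?l j / (2 * N))) * (LINT x|lborel. e (?k j \<bullet> x) * \<phi> (x - ?l j /\<^sub>R N) * u x))"
    proof (rule suminf_cong)
      fix j
      define v where "v = ?l j /\<^sub>R N"
      have kv: "?k j \<bullet> v = ?k j \<bullet> ?l j / N" by (simp add: v_def field_simps)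
      have "(LINT x|lborel. e (?k j \<bullet> x) * u (x - - v) * \<phi> x)
         = (LINT x|lborel. e (?k j \<bullet> (- v + 1 *\<^sub>R x)) * u ((- v + 1 *\<^sub>R x) - - v) * \<phi> (- v + 1 *\<^sub>R x))"
        by (subst integral_lborel_affine[where c = 1 and t = "- v"]) simp_all
      also have "\<dots> = (LINT x|lborel. e (- (?k j \<bullet> v)) * (e (?k j \<bullet> x) * \<phi> (x - v) * u x))"
        by (simp add: inner_add_right inner_diff_right e_add[symmetric] mult.assoc[symmetric]) (simp add: ac_simps)
      finally have 1: "(LINT x|lborel. e (?k j \<bullet> x) * u (x - - v) * \<phi> x)
         = e (- (?k j \<bullet> v)) * (LINT x|lborel. e (?k j \<bullet> x) * \<phi> (x - v) * u x)" by simp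
      have 2: "e (?k j \<bullet> ?l j / (2 * N)) * e (- (?k j \<bullet> v)) = e (- (?k j \<bullet> ?l j / (2 * N)))"
        unfolding e_add[symmetric] kv by (simp add: field_simps)
      show "c j * e (?k j \<bullet> ?l j / (2 * N)) * (LINT x|lborel. e (?k j \<bullet> x) * u (x - - (?l j /\<^sub>R N)) * \<phi> x)
        = c j * e (- (?k j \<bullet> ?l j / (2 * N))) * (LINT x|lborel. e (?k j \<bullet> x) * \<phi> (x - ?l j /\<^sub>R N) * u x)"
        unfolding v_def[symmetric] 1 2[symmetric] by (simp only: mult.assoc)
    qed
    also have "\<dots> = (LINT x|lborel. ?\<psi> x * u x)" by (rule wseries_pairing[OF r phi u, symmetric])
    finally show ?thesis by (simp add: mult.commute)
  qed
  show "schwartz ?\<psi> \<and> (\<forall>u. schwartz u \<longrightarrow> (LINT x|lborel. weyl h a u x * \<phi> x) = (LINT x|lborel. u x * ?\<psi> x))"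
    using psi pair by blast
  fix \<psi> assume "schwartz \<psi> \<and> (\<forall>u. schwartz u \<longrightarrow> (LINT x|lborel. weyl h a u x * \<phi> x) = (LINT x|lborel. u x * \<psi> x))"
  thus "\<psi> = ?\<psi>" using psi pair by (intro schwartz_pairing_eqI) auto
qed

subsection \<open>Discrete Weyl operators\<close>

definition rv :: "int^'d \<Rightarrow> real^'d" where "rv k = (\<chi> i. of_int (k $ i))"

definition nr :: "nat^'d \<Rightarrow> real^'d" where "nr n = (\<chi> i. of_nat (n $ i))"

lemma rv_nth [simp]: "rv k $ i = of_int (k $ i)" by (simp add: rv_def)
lemma nr_nth [simp]: "nr n $ i = of_nat (n $ i)" by (simp add: nr_def)
lemma rv_add: "rv (k + l) = rv k + rv l" by (simp add: vec_eq_iff)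
lemma rv_minus [simp]: "rv (- k) = - rv k" by (simp add: vec_eq_iff)

lemma rv_inner_rv: "rv k \<bullet> rv l = of_int (\<Sum>i\<in>UNIV. k $ i * l $ i)"
  by (simp add: inner_vec_def)

lemma e_add_rv_inner: "e (s + rv k \<bullet> rv l) = e s"
  by (simp add: e_add rv_inner_rv del: of_int_sum)

text \<open>The shift acts on residues modulo \<open>N\<close> and fixes the quotient, so that it is a permutation
  of all of \<open>\<nat>\<^sup>d\<close> preserving \<open>{0..<N}\<^sup>d\<close>.\<close>

definition sh :: "nat \<Rightarrow> int^'d \<Rightarrow> nat^'d \<Rightarrow> nat^'d" where
  "sh N l n = (\<chi> i. N * (n $ i div N) + nat ((int (n $ i) + l $ i) mod int N))"

lemma sh_nr:
  assumes "0 < N" obtains q where "nr (sh N l n) = nr n + rv l + real N *\<^sub>R rv q"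
proof -
  have "\<exists>q::int. real (sh N l n $ i) = real (n $ i) + of_int (l $ i) + real N * of_int q" for i
  proof -
    let ?r = "(int (n $ i) + l $ i) mod int N"
    have "int (sh N l n $ i) = int N * int (n $ i div N) + ?r"
      using assms by (simp add: sh_def)
    also have "?r = int (n $ i) + l $ i - int N * ((int (n $ i) + l $ i) div int N)"
      by (simp add: minus_mult_div_eq_mod)
    finally have "int (sh N l n $ i) = int (n $ i) + l $ i + int N * (int (n $ i div N) - (int (n $ i) + l $ i) div int N)"
      by (simp add: algebra_simps)
    hence "real_of_int (int (sh N l n $ i)) = of_int (int (n $ i) + l $ i + int N * (int (n $ i div N) - (int (n $ i) + l $ i) div int N))"
      by (simp only:)
    thus ?thesis by (intro exI[of _ "int (n $ i div N) - (int (n $ i) + l $ i) div int N"]) simp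
  qed
  then obtain q where "\<And>i. real (sh N l n $ i) = real (n $ i) + of_int (l $ i) + real N * of_int (q i)" by metis
  hence "nr (sh N l n) = nr n + rv l + real N *\<^sub>R rv (\<chi> i. q i)" by (simp add: vec_eq_iff)
  thus thesis by (rule that)
qed

text \<open>Reduction modulo \<open>N\<close> changes the exponent by an integer, so phases may be
  computed as if the shift were plain addition.\<close>

lemma e_sh: assumes "0 < N" shows "e (s + rv k \<bullet> nr (sh N l n) / N) = e (s + rv k \<bullet> (nr n + rv l) / N)"
proof -
  obtain q where "nr (sh N l n) = nr n + rv l + real N *\<^sub>R rv q" by (rule sh_nr[OF assms])
  hence "s + rv k \<bullet> nr (sh N l n) / N = (s + rv k \<bullet> (nr n + rv l) / N) + rv k \<bullet> rv q"
    using assms by (simp add: inner_add_right field_simps)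
  thus ?thesis by (simp only: e_add_rv_inner)
qed

lemma sh_sh: assumes "0 < N" shows "sh N l (sh N l' n) = sh N (l + l') n"
proof -
  have "N * ((N * (n $ i div N) + nat ((int (n $ i) + l' $ i) mod int N)) div N) + nat ((int (N * (n $ i div N) + nat ((int (n $ i) + l' $ i) mod int N)) + l $ i) mod int N)
     = N * (n $ i div N) + nat ((int (n $ i) + (l $ i + l' $ i)) mod int N)" for i
  proof -
    define r where "r = nat ((int (n $ i) + l' $ i) mod int N)"
    have r: "r < N" "int r = (int (n $ i) + l' $ i) mod int N"
      using assms by (simp_all add: r_def nat_less_iff)
    have "(N * (n $ i div N) + r) div N = n $ i div N" using r by simp
    moreover have "(int (N * (n $ i div N) + r) + l $ i) mod int N = (int r + l $ i) mod int N"
      by (simp add: add.assoc)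
    moreover have "(int r + l $ i) mod int N = (int (n $ i) + (l $ i + l' $ i)) mod int N"
      unfolding r(2) by (simp add: mod_add_left_eq add.assoc add.commute[of "l' $ i"])
    ultimately show ?thesis unfolding r_def[symmetric] by simp
  qed
  thus ?thesis by (simp add: sh_def vec_eq_iff)
qed

lemma sh_0: "0 < N \<Longrightarrow> sh N 0 n = n"
  by (simp add: sh_def vec_eq_iff flip: of_nat_mod) 

lemma bij_sh: assumes "0 < N" shows "bij (sh N l)"
  by (rule bij_betw_byWitness[where f' = "sh N (- l)"]) (simp_all add: sh_sh sh_0 assms)

lemma sh_idx: assumes "0 < N" shows "sh N l n \<in> idx N \<longleftrightarrow> n \<in> idx N"
proof -
  have "sh N l n $ i < N \<longleftrightarrow> n $ i < N" for i
  proof -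
    define r where "r = nat ((int (n $ i) + l $ i) mod int N)"
    have r: "r < N" using assms by (simp add: r_def nat_less_iff)
    have "N * (n $ i div N) + r < N \<longleftrightarrow> n $ i div N = 0"
      using r assms by (cases "n $ i div N") auto
    thus ?thesis using assms by (simp add: sh_def r_def[symmetric] div_eq_0_iff)
  qed
  thus ?thesis by (simp add: idx_def)
qed

text \<open>The half phase makes the inverse of the operator at \<open>(k, l)\<close> exactly the
  operator at \<open>(- k, - l)\<close>, without a residual phase.\<close>

definition weyl_phase :: "nat \<Rightarrow> int^'d \<Rightarrow> int^'d \<Rightarrow> nat^'d \<Rightarrow> complex" where
  "weyl_phase N k l n = e (rv k \<bullet> nr n / N + rv k \<bullet> rv l / (2 * N))"

definition weyl_ell2 :: "nat \<Rightarrow> int^'d \<Rightarrow> int^'d \<Rightarrow> (nat^'d) ell2 \<Rightarrow> (nat^'d) ell2" where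
  "weyl_ell2 N k l f = Abs_ell2 (\<lambda>n. weyl_phase N k l n * coord f (sh N l n))"

lemma coord_weyl_ell2:
  assumes "0 < N" shows "coord (weyl_ell2 N k l f) n = weyl_phase N k l n * coord f (sh N l n)"
proof -
  have "(\<lambda>n. (norm (coord f (sh N l n)))\<^sup>2) summable_on UNIV"
    using summable_on_reindex_bij_betw[OF bij_sh[OF assms, of l], of "\<lambda>n. (norm (coord f n))\<^sup>2"] coord_summable by blast
  thus ?thesis by (simp add: weyl_ell2_def Abs_ell2_inverse norm_mult weyl_phase_def)
qed

lemma coord_eqI: "coord f = coord g \<Longrightarrow> f = g"
  by (simp add: coord_inject)

lemma norm_weyl_ell2: assumes "0 < N" shows "norm (weyl_ell2 N k l f) = norm f"
proof -
  have "(norm (weyl_ell2 N k l f))\<^sup>2 = (\<Sum>\<^sub>\<infinity>n. (norm (coord f (sh N l n)))\<^sup>2)"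
    by (simp add: norm_ell2_square coord_weyl_ell2 assms norm_mult weyl_phase_def)
  also have "\<dots> = (norm f)\<^sup>2"
    unfolding norm_ell2_square by (rule infsum_reindex_bij_betw[OF bij_sh[OF assms]])
  finally show ?thesis by (simp add: power2_eq_iff_nonneg)
qed

lemma bounded_linear_weyl_ell2: assumes "0 < N" shows "bounded_linear (weyl_ell2 N k l)"
  by (rule bounded_linear_intro[where K = 1])
     (auto intro!: coord_eqI simp: fun_eq_iff coord_weyl_ell2 plus_ell2.rep_eq scaleR_ell2.rep_eq assms
        algebra_simps norm_weyl_ell2)

definition weyl_op :: "nat \<Rightarrow> int^'d \<Rightarrow> int^'d \<Rightarrow> (nat^'d) cop" where
  "weyl_op N k l = Abs_cop (Blinfun (weyl_ell2 N k l))"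

lemma app_weyl_op: assumes "0 < N" shows "app (weyl_op N k l) f = weyl_ell2 N k l f"
proof -
  have "weyl_ell2 N k l (cmul z x) = cmul z (weyl_ell2 N k l x)" for z x
    by (rule coord_eqI) (simp add: fun_eq_iff coord_weyl_ell2 cmul.rep_eq assms)
  hence "Rep_cop (weyl_op N k l) = Blinfun (weyl_ell2 N k l)"
    unfolding weyl_op_def by (subst Abs_cop_inverse) (simp_all add: bounded_linear_Blinfun_apply bounded_linear_weyl_ell2 assms)
  thus ?thesis by (simp add: app.rep_eq bounded_linear_Blinfun_apply bounded_linear_weyl_ell2 assms)
qed

lemma coord_weyl_op:
  "0 < N \<Longrightarrow> coord (app (weyl_op N k l) f) n = weyl_phase N k l n * coord f (sh N l n)"
  by (simp add: app_weyl_op coord_weyl_ell2)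

lemma norm_app_weyl_op: "0 < N \<Longrightarrow> norm (app (weyl_op N k l) f) = norm f"
  by (simp add: app_weyl_op norm_weyl_ell2)

lemma norm_weyl_op: "0 < N \<Longrightarrow> norm (weyl_op N k l) \<le> 1"
  by (rule norm_cop_bound) (simp_all add: norm_app_weyl_op)

lemma weyl_op_inverse: assumes "0 < N" shows "weyl_op N k l * weyl_op N (- k) (- l) = 1"
proof (rule cop_eqI, rule coord_eqI, rule ext)
  fix f n
  have "(rv k \<bullet> nr n / N + rv k \<bullet> rv l / (2 * N)) + (rv k \<bullet> rv l / (2 * N) + rv (- k) \<bullet> (nr n + rv l) / N) = 0"
    using assms by (simp add: inner_add_right field_simps)
  hence "weyl_phase N k l n * weyl_phase N (- k) (- l) (sh N l n) = 1"
    using e_sh[OF assms, of "rv (- k) \<bullet> rv (- l) / (2 * N)" "- k" l n]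
    unfolding weyl_phase_def by (simp add: e_add[symmetric] add.commute)
  thus "coord (app (weyl_op N k l * weyl_op N (- k) (- l)) f) n = coord (app 1 f) n"
    by (simp add: coord_weyl_op assms sh_sh sh_0 mult.assoc[symmetric])
qed

text \<open>The standard symplectic form on phase space, up to sign, restricted to integer
  vectors.\<close>

definition symp :: "(int^'d) \<times> (int^'d) \<Rightarrow> (int^'d) \<times> (int^'d) \<Rightarrow> real" where
  "symp m m' = rv (fst m') \<bullet> rv (snd m) - rv (fst m) \<bullet> rv (snd m')"

text \<open>The Weyl form of the canonical commutation relations. Its phase is within a multiple of
  \<open>1 / N\<close> of 1, and every negative power of \<open>N\<close> in the estimates
  originates here.\<close>

lemma weyl_op_commute:
  assumes "0 < N"
  shows "weyl_op N k l * weyl_op N k' l' = csc (e (symp (k, l) (k', l') / N)) (weyl_op N k' l' * weyl_op N k l)"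
proof (rule cop_eqI, rule coord_eqI, rule ext)
  fix f n
  let ?\<alpha> = "rv k \<bullet> nr n / N + rv k \<bullet> rv l / (2 * N)" and ?\<beta> = "rv k' \<bullet> nr n / N + rv k' \<bullet> rv l' / (2 * N)"
  have 1: "weyl_phase N k' l' (sh N l n) = e (rv k' \<bullet> rv l' / (2 * N) + rv k' \<bullet> (nr n + rv l) / N)"
    using e_sh[OF assms, of "rv k' \<bullet> rv l' / (2 * N)" k' l n] by (simp add: weyl_phase_def add.commute)
  have 2: "weyl_phase N k l (sh N l' n) = e (rv k \<bullet> rv l / (2 * N) + rv k \<bullet> (nr n + rv l') / N)"
    using e_sh[OF assms, of "rv k \<bullet> rv l / (2 * N)" k l' n] by (simp add: weyl_phase_def add.commute)
  have "?\<alpha> + (rv k' \<bullet> rv l' / (2 * N) + rv k' \<bullet> (nr n + rv l) / N)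
      = symp (k, l) (k', l') / N + (?\<beta> + (rv k \<bullet> rv l / (2 * N) + rv k \<bullet> (nr n + rv l') / N))"
    using assms by (simp add: symp_def inner_add_right field_simps)
  hence "weyl_phase N k l n * weyl_phase N k' l' (sh N l n) = e (symp (k, l) (k', l') / N) * (weyl_phase N k' l' n * weyl_phase N k l (sh N l' n))"
    unfolding 1 2 unfolding weyl_phase_def e_add[symmetric] by (simp only:)
  thus "coord (app (weyl_op N k l * weyl_op N k' l') f) n = coord (app (csc (e (symp (k, l) (k', l') / N)) (weyl_op N k' l' * weyl_op N k l)) f) n"
    by (simp add: coord_weyl_op assms sh_sh cmul.rep_eq mult.assoc[symmetric] add.commute)
qed

definition wgt :: "(int^'d) \<times> (int^'d) \<Rightarrow> real" where
  "wgt m = 1 + norm (rv (fst m), rv (snd m))"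

definition wop :: "nat \<Rightarrow> (int^'d) \<times> (int^'d) \<Rightarrow> (nat^'d) cop" where
  "wop N m = weyl_op N (fst m) (snd m)"

lemma wgt_ge_1: "1 \<le> wgt m" by (simp add: wgt_def)

lemma wgt_nonneg [simp]: "0 \<le> wgt m" by (simp add: wgt_def)

lemma wgt_minus [simp]: "wgt (- m) = wgt m"
  by (simp add: wgt_def norm_prod_def)

lemma norm_wop: "0 < N \<Longrightarrow> norm (wop N m) \<le> 1"
  by (simp add: wop_def norm_weyl_op)

lemma wop_inverse: "0 < N \<Longrightarrow> wop N m * wop N (- m) = 1"
  by (simp add: wop_def weyl_op_inverse)

lemma wop_commute: "0 < N \<Longrightarrow> wop N m * wop N m' = csc (e (symp m m' / N)) (wop N m' * wop N m)"
  using weyl_op_commute[of N "fst m" "snd m" "fst m'" "snd m'"] by (simp add: wop_def)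

lemma symp_bound: "\<bar>symp m m'\<bar> \<le> 2 * (wgt m * wgt m')"
proof -
  have le: "norm (rv (fst m)) \<le> wgt m" "norm (rv (snd m)) \<le> wgt m" for m :: "(int^'a) \<times> (int^'a)"
    using norm_fst_le[of "rv (fst m)" "rv (snd m)"] norm_snd_le[of "rv (snd m)" "rv (fst m)"] by (simp_all add: wgt_def)
  have "\<bar>rv (fst m') \<bullet> rv (snd m)\<bar> \<le> norm (rv (fst m')) * norm (rv (snd m))"
    "\<bar>rv (fst m) \<bullet> rv (snd m')\<bar> \<le> norm (rv (fst m)) * norm (rv (snd m'))"
    by (rule Cauchy_Schwarz_ineq2)+
  moreover have "norm (rv (fst m')) * norm (rv (snd m)) \<le> wgt m' * wgt m"
    "norm (rv (fst m)) * norm (rv (snd m')) \<le> wgt m * wgt m'"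
    using wgt_ge_1[of m] wgt_ge_1[of m'] by (auto intro!: mult_mono le)
  ultimately show ?thesis unfolding symp_def by (simp add: mult.commute)
qed

lemma norm_symp_phase_le:
  assumes "0 < N" shows "norm (e (symp m m' / real N) - 1) \<le> 4 * pi / N * (wgt m * wgt m')"
proof -
  have "norm (e (symp m m' / real N) - 1) \<le> 2 * pi * \<bar>symp m m' / real N\<bar>" by (rule norm_e_minus_1_le)
  also have "\<dots> = 2 * pi / N * \<bar>symp m m'\<bar>" by (simp add: abs_divide)
  also have "\<dots> \<le> 2 * pi / N * (2 * (wgt m * wgt m'))"
    by (intro mult_left_mono symp_bound) auto
  finally show ?thesis by simp
qed

lemma conj_family_wop: assumes "0 < N" shows "conj_family (wop N) (\<lambda>m. wop N (- m)) wgt"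
proof
  fix m :: "(int^'a) \<times> (int^'a)"
  show "wop N m * wop N (- m) = 1" by (rule wop_inverse[OF assms])
  show "wop N (- m) * wop N m = 1" using wop_inverse[OF assms, of "- m"] by simp
qed (simp_all add: norm_wop assms wgt_ge_1)

lemma wop_conj_left:
  assumes "0 < N" shows "wop N m * wop N m' * wop N (- m) = csc (e (symp m m' / N)) (wop N m')"
proof -
  have "wop N m * wop N m' * wop N (- m) = csc (e (symp m m' / N)) (wop N m' * wop N m) * wop N (- m)"
    by (simp only: wop_commute[OF assms, of m m'])
  also have "\<dots> = csc (e (symp m m' / N)) (wop N m')"
    by (simp add: csc_mult_left mult.assoc wop_inverse[OF assms])
  finally show ?thesis .
qed

subsection \<open>Norm bounds for quantized observables\<close>

definition csc_linear :: "('i cop \<Rightarrow> 'i cop) \<Rightarrow> bool" where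
  "csc_linear F \<longleftrightarrow> bounded_linear F \<and> (\<forall>z X. F (csc z X) = csc z (F X))"

text \<open>An estimate linear in a quantized observable need only be checked on the single Weyl operators
  \<open>wop N m\<close>, with polynomial growth in \<open>m\<close>; \<open>S\<close> is then the corresponding weighted sum of the Fourier
  coefficients.\<close>

definition wbounded :: "nat \<Rightarrow> nat \<Rightarrow> real \<Rightarrow> (nat^'d) cop \<Rightarrow> bool" where
  "wbounded N p S A \<longleftrightarrow> (\<forall>F K. csc_linear F \<longrightarrow> (\<forall>m. norm (F (wop N m)) \<le> K * wgt m ^ p) \<longrightarrow> norm (F A) \<le> K * S)"

lemma wboundedD:
  "wbounded N p S A \<Longrightarrow> csc_linear F \<Longrightarrow> (\<And>m. norm (F (wop N m)) \<le> K * wgt m ^ p) \<Longrightarrow> norm (F A) \<le> K * S"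
  unfolding wbounded_def by blast

lemma wbounded_csc: assumes "wbounded N p S A" shows "wbounded N p (norm z * S) (csc z A)"
  unfolding wbounded_def
proof (intro allI impI)
  fix F :: "(nat^'a) cop \<Rightarrow> (nat^'a) cop" and K
  assume F: "csc_linear F" "\<forall>m. norm (F (wop N m)) \<le> K * wgt m ^ p"
  have "norm (F (csc z A)) \<le> norm z * norm (F A)" using F(1) norm_csc by (simp add: csc_linear_def)
  also have "\<dots> \<le> norm z * (K * S)" by (rule mult_left_mono[OF wboundedD[OF assms F(1)]]) (use F(2) in blast, simp)
  finally show "norm (F (csc z A)) \<le> K * (norm z * S)" by (simp add: mult.left_commute)
qed

lemma wbounded_add: assumes "wbounded N p S A" "wbounded N p S' B" shows "wbounded N p (S + S') (A + B)"
  unfolding wbounded_def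
proof (intro allI impI)
  fix F :: "(nat^'a) cop \<Rightarrow> (nat^'a) cop" and K
  assume F: "csc_linear F" "\<forall>m. norm (F (wop N m)) \<le> K * wgt m ^ p"
  have "F (A + B) = F A + F B" using F(1) by (simp add: csc_linear_def bounded_linear.linear linear_add)
  moreover have "norm (F A) \<le> K * S" "norm (F B) \<le> K * S'" using F assms wboundedD by blast+
  ultimately show "norm (F (A + B)) \<le> K * (S + S')"
    using norm_triangle_ineq[of "F A" "F B"] by (simp add: distrib_left)
qed

definition wseq :: "nat \<Rightarrow> (nat \<Rightarrow> complex) \<Rightarrow> (nat \<Rightarrow> (int^'d) \<times> (int^'d)) \<Rightarrow> (nat^'d) cop" where
  "wseq N c m = (\<Sum>j. csc (c j) (wop N (m j)))"

abbreviation mrv :: "(int^'d) \<times> (int^'d) \<Rightarrow> (real^'d) \<times> (real^'d)" where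
  "mrv m \<equiv> (rv (fst m), rv (snd m))"

lemma rapid_summable_wgt:
  "rapid c (\<lambda>j. mrv (m j)) \<Longrightarrow> summable (\<lambda>j. norm (c j) * wgt (m j) ^ p)"
  by (simp add: rapid_def wgt_def)

lemma wseq_sums:
  assumes "0 < N" "summable (\<lambda>j. norm (c j))"
  shows "(\<lambda>j. csc (c j) (wop N (m j))) sums wseq N c m"
  unfolding wseq_def
proof (rule summable_sums, rule summable_norm_cancel, rule summable_comparison_test'[OF assms(2)])
  fix j
  show "norm (norm (csc (c j) (wop N (m j)))) \<le> norm (c j)"
    using order_trans[OF norm_csc mult_left_mono[OF norm_wop[OF assms(1)]], of "c j" "m j"] by simp
qed

text \<open>The constant involves only the Fourier coefficients and not \<open>N\<close>; this is
  the source of uniformity in all later bounds.\<close>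

lemma wbounded_wseq:
  assumes N: "0 < N" and c: "rapid c (\<lambda>j. mrv (m j))"
  shows "wbounded N p (\<Sum>j. norm (c j) * wgt (m j) ^ p) (wseq N c m)"
  unfolding wbounded_def
proof (intro allI impI)
  fix F :: "(nat^'a) cop \<Rightarrow> (nat^'a) cop" and K
  assume F: "csc_linear F" and K: "\<forall>m. norm (F (wop N m)) \<le> K * wgt m ^ p"
  have s: "summable (\<lambda>j. norm (c j))" using rapid_summable_wgt[OF c, of 0] by simp
  have "(\<lambda>j. F (csc (c j) (wop N (m j)))) sums F (wseq N c m)"
    using F by (intro bounded_linear.sums[OF _ wseq_sums[OF N s]]) (simp add: csc_linear_def)
  hence "F (wseq N c m) = (\<Sum>j. csc (c j) (F (wop N (m j))))" using F by (simp add: sums_iff csc_linear_def)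
  also have "norm \<dots> \<le> (\<Sum>j. K * (norm (c j) * wgt (m j) ^ p))"
  proof (rule norm_suminf_le)
    fix j
    have "norm (csc (c j) (F (wop N (m j)))) \<le> norm (c j) * norm (F (wop N (m j)))" by (rule norm_csc)
    also have "\<dots> \<le> norm (c j) * (K * wgt (m j) ^ p)" using K by (intro mult_left_mono) (blast, simp)
    finally show "norm (csc (c j) (F (wop N (m j)))) \<le> K * (norm (c j) * wgt (m j) ^ p)" by (simp add: ac_simps)
  qed (intro summable_mult rapid_summable_wgt c)
  also have "\<dots> = K * (\<Sum>j. norm (c j) * wgt (m j) ^ p)" by (intro suminf_mult rapid_summable_wgt c)
  finally show "norm (F (wseq N c m)) \<le> K * (\<Sum>j. norm (c j) * wgt (m j) ^ p)" .
qed

lemma comm_csc: "comm (csc z X) Y = csc z (comm X Y)" "comm X (csc z Y) = csc z (comm X Y)"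
  by (simp_all add: comm_def csc_mult_left csc_mult_right bounded_linear_csc[THEN bounded_linear.linear, THEN linear_diff])

lemma bounded_linear_comm: "bounded_linear (\<lambda>X. comm X Y)" "bounded_linear (comm X)"
  unfolding comm_def[abs_def] by (intro bounded_linear_intros)+

lemma csc_linear_comm: "csc_linear (\<lambda>X. comm X Y)" "csc_linear (comm X)"
  by (simp_all add: csc_linear_def bounded_linear_comm comm_csc)

lemma csc_linear_compose: "csc_linear F \<Longrightarrow> csc_linear G \<Longrightarrow> csc_linear (\<lambda>X. F (G X))"
  by (auto simp: csc_linear_def intro: bounded_linear_compose)

lemma csc_linear_conj: "csc_linear (\<lambda>X. u * X * v - X)"
  unfolding csc_linear_def
  by (auto simp: csc_mult_left csc_mult_right bounded_linear_csc[THEN bounded_linear.linear, THEN linear_diff]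
        intro!: bounded_linear_intros bounded_linear_sub)

context
  fixes N :: nat assumes N: "0 < N"
begin

interpretation W: conj_family "wop N :: (int^'d) \<times> (int^'d) \<Rightarrow> (nat^'d) cop" "\<lambda>m. wop N (- m)" wgt
  by (rule conj_family_wop[OF N])

lemma wop_conj_diff:
  "wop N m * wop N m' * wop N (- m) - wop N m' = csc (e (symp m m' / N) - 1) (wop N m')"
  by (simp add: wop_conj_left[OF N] csc_diff)

lemma norm_wop_conj_diff: "norm (wop N m * wop N m' * wop N (- m) - wop N m') \<le> 4 * pi / N * wgt m * wgt m'"
proof -
  have "norm (wop N m * wop N m' * wop N (- m) - wop N m') \<le> norm (e (symp m m' / N) - 1) * norm (wop N m')"
    unfolding wop_conj_diff by (rule norm_csc)
  also have "\<dots> \<le> (4 * pi / N * (wgt m * wgt m')) * 1"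
    by (rule mult_mono[OF norm_symp_phase_le[OF N] norm_wop[OF N]]) simp_all
  finally show ?thesis by (simp add: mult.assoc)
qed

text \<open>Conjugation multiplies a Weyl operator by the commutation phase, which is linear in the
  frequency; one moment of the Fourier coefficients is therefore enough.\<close>

lemma lip_wbounded:
  assumes "wbounded N 1 S (A :: (nat^'d) cop)" shows "W.lip (4 * pi / N * S) A"
  unfolding W.lip_def
proof
  fix m
  have "norm (wop N m * A * wop N (- m) - A) \<le> (4 * pi / N * wgt m) * S"
    by (rule wboundedD[OF assms csc_linear_conj]) (simp only: power_one_right, rule norm_wop_conj_diff)
  thus "norm (wop N m * A * wop N (- m) - A) \<le> 4 * pi / N * S * wgt m" by (simp add: mult.commute mult.left_commute)
qed

text \<open>The commutator is the defect \<open>U Y U^-1 - Y\<close> of the conjugation, multiplied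
  from the right by the contraction \<open>U\<close>.\<close>

lemma norm_comm_wop_le:
  assumes "W.lip L (Y :: (nat^'d) cop)" shows "norm (comm (wop N m) Y) \<le> L * wgt m"
proof -
  have "comm (wop N m) Y = (wop N m * Y * wop N (- m) - Y) * wop N m"
    using W.VU[of m] by (simp add: comm_def left_diff_distrib mult.assoc)
  hence "norm (comm (wop N m) Y) \<le> norm (wop N m * Y * wop N (- m) - Y)"
    by (simp add: norm_mult_le_right norm_wop[OF N])
  also have "\<dots> \<le> L * wgt m" using assms unfolding W.lip_def by blast
  finally show ?thesis .
qed

text \<open>Two powers of the frequency \<open>m'\<close> occur: one from the conjugation phase, one
  from the commutator of \<open>wop N m'\<close> with \<open>Y\<close>.\<close>

lemma tame_wbounded:
  assumes "wbounded N 2 S (A :: (nat^'d) cop)" shows "W.tame (4 * pi / N * S) A"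
  unfolding W.tame_def
proof (intro allI impI)
  fix L Y m assume L: "W.lip L (Y :: (nat^'d) cop)"
  have "norm (comm (wop N (- m) * A * wop N m - A) Y) \<le> (4 * pi / N * wgt m * L) * S"
  proof (rule wboundedD[OF assms csc_linear_compose[OF csc_linear_comm(1) csc_linear_conj]])
    fix m'
    let ?z = "e (symp (- m) m' / N) - 1"
    have "norm (comm (wop N (- m) * wop N m' * wop N m - wop N m') Y) = norm (csc ?z (comm (wop N m') Y))"
      using wop_conj_diff[of "- m" m'] by (simp add: comm_csc)
    also have "\<dots> \<le> norm ?z * norm (comm (wop N m') Y)" by (rule norm_csc)
    also have "\<dots> \<le> (4 * pi / N * (wgt m * wgt m')) * (L * wgt m')"
      using norm_symp_phase_le[OF N, of "- m" m'] norm_comm_wop_le[OF L]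
        wgt_ge_1[of m] wgt_ge_1[of m'] wgt_minus[of m]
      by (intro mult_mono) auto
    finally show "norm (comm (wop N (- m) * wop N m' * wop N m - wop N m') Y) \<le> 4 * pi / N * wgt m * L * wgt m' ^ 2"
      by (simp add: power2_eq_square algebra_simps)
  qed
  thus "norm (comm (wop N (- m) * A * wop N m - A) Y) \<le> 4 * pi / N * S * L * wgt m" by (simp add: ac_simps)
qed

text \<open>The inner commutator of two Weyl operators is a small multiple of their product, and the
  Leibniz rule reduces the outer one to commutators of single Weyl operators with \<open>Y\<close>.
  Both are estimated by the product of the weights, hence the second power in each variable.\<close>

lemma double_comm_wbounded:
  assumes A: "wbounded N 2 S (A :: (nat^'d) cop)" and B: "wbounded N 2 S' B" and L: "W.lip L Y"
  shows "norm (comm (comm A B) Y) \<le> 8 * pi / N * L * S * S'"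
proof -
  have L0: "0 \<le> L" by (rule W.lip_nonneg[OF L])
  have base: "norm (comm (comm (wop N m) (wop N m')) Y) \<le> (8 * pi / N * L) * wgt m ^ 2 * wgt m' ^ 2" for m m' :: "(int^'d) \<times> (int^'d)"
  proof -
    let ?z = "e (symp m m' / N) - 1"
    have "comm (wop N m) (wop N m') = csc ?z (wop N m' * wop N m)"
      unfolding comm_def by (subst wop_commute[OF N]) (simp add: csc_diff)
    hence "norm (comm (comm (wop N m) (wop N m')) Y) \<le> norm ?z * norm (comm (wop N m' * wop N m) Y)"
      by (simp add: comm_csc norm_csc)
    also have "\<dots> \<le> (4 * pi / N * (wgt m * wgt m')) * (2 * L * (wgt m * wgt m'))"
    proof (intro mult_mono)
      have "comm (wop N m' * wop N m) Y = wop N m' * comm (wop N m) Y + comm (wop N m') Y * wop N m"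
        by (simp add: comm_def algebra_simps)
      hence "norm (comm (wop N m' * wop N m) Y) \<le> norm (comm (wop N m) Y) + norm (comm (wop N m') Y)"
        by (metis add_mono norm_triangle_le norm_mult_le_left norm_mult_le_right norm_wop[OF N])
      also have "\<dots> \<le> L * wgt m + L * wgt m'" by (intro add_mono norm_comm_wop_le[OF L])
      also have "\<dots> \<le> L * (wgt m * wgt m') + L * (wgt m * wgt m')"
        using wgt_ge_1[of m] wgt_ge_1[of m'] L0 mult_left_mono[of 1 "wgt m'" "wgt m"] mult_right_mono[of 1 "wgt m" "wgt m'"]
        by (intro add_mono mult_left_mono) auto
      finally show "norm (comm (wop N m' * wop N m) Y) \<le> 2 * L * (wgt m * wgt m')" by (simp add: algebra_simps)
    qed (use norm_symp_phase_le[OF N, of m m'] wgt_ge_1[of m] wgt_ge_1[of m'] in auto)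
    finally show ?thesis by (simp add: power2_eq_square algebra_simps)
  qed
  \<comment> \<open>The estimate on Weyl operators is extended in two rounds, first in the second
    argument with \<open>wop N m\<close> fixed, then in the first.\<close>
  have "norm (comm (comm A B) Y) \<le> (8 * pi / N * L * S') * S"
  proof (rule wboundedD[OF A csc_linear_compose[OF csc_linear_comm(1) csc_linear_comm(1)]])
    fix m
    have "norm (comm (comm (wop N m) B) Y) \<le> ((8 * pi / N * L) * wgt m ^ 2) * S'"
      by (rule wboundedD[OF B csc_linear_compose[OF csc_linear_comm(1) csc_linear_comm(2)]]) (rule base)
    thus "norm (comm (comm (wop N m) B) Y) \<le> 8 * pi / N * L * S' * wgt m ^ 2" by (simp add: ac_simps)
  qed
  thus ?thesis by (simp add: ac_simps)
qed

end

section \<open>Skew symmetry and contractive exponentials\<close>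

lemma inner_cmul: "cmul z f \<bullet> g = f \<bullet> cmul (cnj z) g"
  by (simp add: inner_ell2_def cmul.rep_eq inner_complex_def algebra_simps)

text \<open>A linear isometry preserves the inner product by polarization; as the inverse is known
  explicitly, it is the adjoint.\<close>

lemma inner_weyl_op:
  assumes "0 < N" shows "app (weyl_op N k l) f \<bullet> g = f \<bullet> app (weyl_op N (- k) (- l)) g"
proof -
  have iso: "app (weyl_op N k l) f \<bullet> app (weyl_op N k l) f' = f \<bullet> f'" for f f'
  proof -
    have "4 * (x \<bullet> y) = (norm (x + y))\<^sup>2 - (norm (x - y))\<^sup>2" for x y :: "(nat^'a) ell2"
      by (simp add: power2_norm_eq_inner inner_add_left inner_add_right inner_diff_left inner_diff_right inner_commute)
    from this[of "app (weyl_op N k l) f" "app (weyl_op N k l) f'"] this[of f f'] show ?thesis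
      using norm_app_weyl_op[OF assms, of k l]
      by (simp flip: bounded_linear.linear[OF bounded_linear_app, THEN linear_add]
            bounded_linear.linear[OF bounded_linear_app, THEN linear_diff])
  qed
  have "app (weyl_op N k l) (app (weyl_op N (- k) (- l)) g) = g"
    using weyl_op_inverse[OF assms, of k l] by (metis app_simps(2,7))
  thus ?thesis using iso[of f "app (weyl_op N (- k) (- l)) g"] by simp
qed

text \<open>The squared norm of \<open>exp (s a) x\<close> has derivative
  \<open>2 (a y \<bullet> y) = 0\<close>. Negative times are reduced to positive ones by passing to
  \<open>- a\<close>.\<close>

lemma contr_skew:
  fixes a :: "'i cop"
  assumes "\<And>f. app a f \<bullet> f = 0" shows "contr a"
proof -
  have pos: "norm (exp (t *\<^sub>R a)) \<le> 1" if "0 \<le> t" and skew: "\<And>f. app a f \<bullet> f = 0" for t and a :: "'i cop"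
  proof (rule norm_cop_bound)
    fix x
    define y where "y s = app (exp (s *\<^sub>R a)) x" for s
    have y: "(y has_vector_derivative app a (y s)) (at s)" for s
      unfolding y_def app_simps(7)[symmetric]
      by (rule bounded_linear.has_vector_derivative[OF bounded_linear_app_left exp_scaleR_has_vector_derivative_left])
    have "((\<lambda>s. y s \<bullet> y s) has_vector_derivative (y s \<bullet> app a (y s) + app a (y s) \<bullet> y s)) (at s)" for s
      by (rule bounded_bilinear.has_vector_derivative[OF bounded_bilinear_inner y y])
    moreover have "y s \<bullet> app a (y s) + app a (y s) \<bullet> y s = 0" for s
      using skew[of "y s"] inner_commute[of "y s" "app a (y s)"] by simp
    ultimately have "norm (y t \<bullet> y t - y 0 \<bullet> y 0) \<le> 0 * t"
      by (intro norm_diff_le_vector_derivative[OF \<open>0 \<le> t\<close>]) auto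
    hence "norm (y t) = norm (y 0)" by (simp add: norm_eq_sqrt_inner)
    thus "norm (app (exp (t *\<^sub>R a)) x) \<le> 1 * norm x" by (simp add: y_def)
  qed simp
  show ?thesis unfolding contr_def
  proof
    fix t :: real
    show "norm (exp (t *\<^sub>R a)) \<le> 1"
    proof (cases "0 \<le> t")
      case False
      have "norm (exp ((- t) *\<^sub>R (- a))) \<le> 1" using False assms by (intro pos) auto
      thus ?thesis by simp
    qed (simp add: pos assms)
  qed
qed

text \<open>The frequencies \<open>m j\<close> and \<open>- m j\<close> carry mutually adjoint
  operators with conjugate coefficients. Each pair is symmetric, and an imaginary factor makes it
  skew.\<close>

lemma skew_wseq:
  fixes f :: "(nat^'d) ell2"
  assumes N: "0 < N" and c: "summable (\<lambda>j. norm (c j))"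
  shows "app (csc (\<i> * of_real r) (wseq N c m + wseq N (\<lambda>j. cnj (c j)) (\<lambda>j. - m j))) f \<bullet> f = 0"
proof -
  let ?z = "\<i> * complex_of_real r"
  have bl: "bounded_linear (\<lambda>X. app (csc ?z X) f \<bullet> f)"
    by (intro bounded_linear_compose[OF bounded_linear_inner_left]
          bounded_linear_compose[OF bounded_linear_app_left bounded_linear_csc])
  have "(\<lambda>j. app (csc ?z (csc (c j) (wop N (m j)) + csc (cnj (c j)) (wop N (- m j)))) f \<bullet> f) sums
     (app (csc ?z (wseq N c m + wseq N (\<lambda>j. cnj (c j)) (\<lambda>j. - m j))) f \<bullet> f)"
    by (intro bounded_linear.sums[OF bl] sums_add wseq_sums N) (use c in auto)
  moreover have "app (csc ?z (csc (c j) (wop N (m j)) + csc (cnj (c j)) (wop N (- m j)))) f \<bullet> f = 0" for j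
  proof -
    have "app (csc ?z (csc (cnj (c j)) (wop N (- m j)))) f \<bullet> f = app (wop N (- m j)) f \<bullet> cmul (cnj (?z * cnj (c j))) f"
      by (simp add: csc_csc inner_cmul)
    also have "\<dots> = f \<bullet> app (wop N (m j)) (cmul (cnj (?z * cnj (c j))) f)"
      using inner_weyl_op[OF N, of "- fst (m j)" "- snd (m j)"] by (simp add: wop_def)
    also have "\<dots> = f \<bullet> app (csc (- (?z * c j)) (wop N (m j))) f" by (simp add: app_cmul)
    also have "\<dots> = - (app (csc ?z (csc (c j) (wop N (m j)))) f \<bullet> f)"
    proof -
      have "csc (- (?z * c j)) X = - csc ?z (csc (c j) X)" for X :: "(nat^'d) cop"
        using csc_diff[of 0 "?z * c j" X] csc_of_real[of 0 X] by (simp add: csc_csc)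
      thus ?thesis by (simp add: inner_commute)
    qed
    finally show ?thesis
      by (simp add: bounded_linear_csc[THEN bounded_linear.linear, THEN linear_add] inner_add_left)
  qed
  ultimately show ?thesis by (simp add: sums_iff)
qed

subsection \<open>Sums of Schwartz functions over the lattice\<close>

lemma torus_smooth_Fourier_series:
  fixes a :: "(real^'d) \<times> (real^'d) \<Rightarrow> complex"
  assumes a: "torus_smooth a"
  obtains c and m :: "nat \<Rightarrow> (int^'d) \<times> (int^'d)"
  where "rapid c (\<lambda>j. mrv (m j))" and "\<And>z. (\<lambda>j. c j * e (mrv (m j) \<bullet> z)) sums a z"
proof -
  define P where "P g = ((\<chi> i. g (axis i 1, 0)) :: int^'d, (\<chi> i. g (0, axis i 1)) :: int^'d)"
    for g :: "(real^'d) \<times> (real^'d) \<Rightarrow> int"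
  have lat: "lat g = mrv (P g)" for g
  proof (rule euclidean_eqI)
    fix b :: "(real^'d) \<times> (real^'d)" assume b: "b \<in> Basis"
    then consider i where "b = (axis i 1, 0)" | i where "b = (0, axis i 1)"
      by (auto simp: Basis_prod_def Basis_vec_def)
    thus "lat g \<bullet> b = mrv (P g) \<bullet> b"
      using lat_inner[OF b, of g] by cases (simp_all add: P_def inner_axis)
  qed
  have "periodic a" unfolding periodic_def
  proof (intro allI)
    fix z g
    have "\<forall>x \<xi>. \<forall>k l :: int^'d. a (x + rv k, \<xi> + rv l) = a (x, \<xi>)"
      using a by (simp add: torus_smooth_def rv_def)
    hence "a (fst z + rv (fst (P g)), snd z + rv (snd (P g))) = a (fst z, snd z)" by blast
    thus "a (z + lat g) = a z" by (simp add: lat plus_prod_def)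
  qed
  moreover have "smooth a" using a by (simp add: torus_smooth_def)
  ultimately obtain c g where "rapid c (\<lambda>j. lat (g j))" "\<And>z. (\<lambda>j. c j * e (lat (g j) \<bullet> z)) sums a z"
    using smooth_periodic_Fourier_series by blast
  thus thesis using that[of c "\<lambda>j. P (g j)"] by (simp add: lat)
qed

lemma wt_cart: "wt (x :: real^'d) = (\<Prod>i\<in>UNIV. 1 / (1 + (x $ i)\<^sup>2))"
proof -
  have B: "(Basis :: (real^'d) set) = (\<lambda>i. axis i 1) ` UNIV" by (auto simp: Basis_vec_def)
  have inj: "inj (\<lambda>i::'d. axis i (1::real))" by (auto simp: inj_on_def axis_eq_axis)
  show ?thesis unfolding wt_def B by (subst prod.reindex[OF inj]) (simp add: inner_axis)
qed

lemma wt_lattice_summable: "(\<lambda>k :: int^'d. wt (rv k)) summable_on UNIV"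
proof -
  have "(\<lambda>g :: 'd \<Rightarrow> int. \<Prod>i\<in>UNIV. 1 / (1 + (real_of_int (g i))\<^sup>2)) summable_on (PiE UNIV (\<lambda>_. UNIV))"
    by (rule summable_on_prod_PiE[OF _ _ summable_on_int_inverse_square]) auto
  moreover have "bij_betw (($) :: int^'d \<Rightarrow> 'd \<Rightarrow> int) UNIV (PiE UNIV (\<lambda>_. UNIV))"
    by (rule bij_betw_byWitness[where f' = vec_lambda]) (auto simp: vec_lambda_inverse)
  ultimately have "(\<lambda>k :: int^'d. \<Prod>i\<in>UNIV. 1 / (1 + (real_of_int (k $ i))\<^sup>2)) summable_on UNIV"
    using summable_on_reindex_bij_betw[of "($)" UNIV "PiE UNIV (\<lambda>_. UNIV)" "\<lambda>g :: 'd \<Rightarrow> int. \<Prod>i\<in>UNIV. 1 / (1 + (real_of_int (g i))\<^sup>2)"] by simp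
  thus ?thesis by (simp add: wt_cart)
qed

lemma wt_shift_cart:
  assumes "\<And>i. \<bar>s $ i\<bar> \<le> 1" shows "wt (x + s :: real^'d) \<le> 3 ^ CARD('d) * wt x"
proof -
  have 1: "1 / (1 + (t + r)\<^sup>2) \<le> 3 * (1 / (1 + t\<^sup>2))" if "\<bar>r\<bar> \<le> 1" for t r :: real
    using wt_shift_le[of "1::real" r t] that by (simp add: wt_def)
  have "wt (x + s) \<le> (\<Prod>i\<in>(UNIV::'d set). 3 * (1 / (1 + (x $ i)\<^sup>2)))"
    unfolding wt_cart by (intro prod_mono conjI) (use 1[OF assms] in auto)
  also have "\<dots> = 3 ^ CARD('d) * wt x" unfolding wt_cart prod.distrib by simp
  finally show ?thesis .
qed

lemma bij_add_int: "bij (\<lambda>k :: int^'d. k + q)"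
  by (rule bij_betw_byWitness[where f' = "\<lambda>k. k - q"]) auto

text \<open>Shifting by the integer part of \<open>y\<close> leaves an offset in the unit cube, so
  one comparable weight dominates for all \<open>y\<close>. Uniformity in \<open>y\<close> is what
  later permits exchanging this sum with a series of translates.\<close>

lemma lattice_summable:
  fixes \<phi> :: "real^'d \<Rightarrow> complex"
  assumes "schwartz \<phi>"
  obtains B where "\<And>y. (\<lambda>k. norm (\<phi> (rv k + y))) summable_on UNIV"
    and "\<And>y. (\<Sum>\<^sub>\<infinity>k. norm (\<phi> (rv k + y))) \<le> B"
proof -
  obtain C where C: "0 \<le> C" "\<And>x. norm (\<phi> x) \<le> C * wt x" using schwartz_wt_bound[OF assms] by blast
  let ?b = "\<lambda>k :: int^'d. C * (3 ^ CARD('d) * wt (rv k))"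
  have b: "?b summable_on UNIV" by (intro summable_on_cmult_right wt_lattice_summable)
  have *: "(\<lambda>k. norm (\<phi> (rv k + y))) summable_on UNIV \<and> (\<Sum>\<^sub>\<infinity>k. norm (\<phi> (rv k + y))) \<le> infsum ?b UNIV" for y
  proof -
    define q :: "int^'d" where "q = (\<chi> i. \<lfloor>y $ i\<rfloor>)"
    define s where "s = y - rv q"
    have s: "\<bar>s $ i\<bar> \<le> 1" for i by (simp add: s_def q_def) linarith
    have le: "norm (\<phi> (rv k + s)) \<le> ?b k" for k
      using C(2)[of "rv k + s"] mult_left_mono[OF wt_shift_cart[OF s, of "rv k"] C(1)] by linarith
    have sum: "(\<lambda>k. norm (\<phi> (rv k + s))) summable_on UNIV"
      by (rule summable_on_comparison_test[OF b]) (use le in auto)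
    have eq: "rv k + y = rv (k + q) + s" for k by (simp add: s_def rv_add)
    have "(\<lambda>k. norm (\<phi> (rv k + y))) summable_on UNIV"
      unfolding eq using sum summable_on_reindex_bij_betw[OF bij_add_int[of q], of "\<lambda>k. norm (\<phi> (rv k + s))"] by simp
    moreover have "(\<Sum>\<^sub>\<infinity>k. norm (\<phi> (rv k + y))) = (\<Sum>\<^sub>\<infinity>k. norm (\<phi> (rv k + s)))"
      unfolding eq by (rule infsum_reindex_bij_betw[OF bij_add_int])
    moreover have "(\<Sum>\<^sub>\<infinity>k. norm (\<phi> (rv k + s))) \<le> infsum ?b UNIV" by (rule infsum_mono[OF sum b le])
    ultimately show ?thesis by simp
  qed
  show thesis by (rule that) (use * in blast)+
qed

text \<open>The periodization of \<open>\<phi>\<close>; the distributions \<open>Q N n\<close>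
  sample it at the points \<open>n / N\<close>.\<close>

definition lat_sum :: "(real^'d \<Rightarrow> complex) \<Rightarrow> real^'d \<Rightarrow> complex" where
  "lat_sum \<phi> y = (\<Sum>\<^sub>\<infinity>k. \<phi> (rv k + y))"

lemma lat_sum_shift: "lat_sum \<phi> (y + rv q) = lat_sum \<phi> y"
proof -
  have "lat_sum \<phi> (y + rv q) = (\<Sum>\<^sub>\<infinity>k. \<phi> (rv (k + q) + y))"
    by (simp add: lat_sum_def rv_add add.assoc add.commute[of y])
  also have "\<dots> = lat_sum \<phi> y"
    unfolding lat_sum_def by (rule infsum_reindex_bij_betw[OF bij_add_int, of "\<lambda>k. \<phi> (rv k + y)"])
  finally show ?thesis .
qed

lemma Q_lat_sum:
  "Q N n \<phi> = (if schwartz \<phi> then complex_of_real (real N powr (- real CARD('d) / 2)) * lat_sum \<phi> (nr n /\<^sub>R N) else 0)"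
  for n :: "nat^'d"
proof -
  have "(\<chi> i. of_int (k $ i) + of_nat (n $ i) / of_nat N) = rv k + nr n /\<^sub>R N" for k :: "int^'d"
    by (simp add: vec_eq_iff divide_inverse_commute)
  thus ?thesis by (simp add: Q_def lat_sum_def)
qed

text \<open>Exponentials with integer frequencies are constant along the lattice and leave the
  periodization. The remaining lattice sums are bounded uniformly in the translation, so the double
  sum converges absolutely.\<close>

lemma lat_sum_wseries:
  fixes \<phi> :: "real^'d \<Rightarrow> complex"
  assumes c: "rapid c m" and phi: "schwartz \<phi>"
  shows "(\<lambda>j. c j * e (rv (k j) \<bullet> y) * lat_sum \<phi> (y - t j)) sums lat_sum (wseries c (\<lambda>j. rv (k j)) t \<phi>) y"
proof -
  obtain B where B: "\<And>y. (\<lambda>k. norm (\<phi> (rv k + y))) summable_on UNIV" "\<And>y. (\<Sum>\<^sub>\<infinity>k. norm (\<phi> (rv k + y))) \<le> B"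
    using lattice_summable[OF phi] by blast
  define f where "f j q = c j * e (rv (k j) \<bullet> y) * \<phi> (rv q + (y - t j))" for j and q :: "int^'d"
  have f: "c j * e (rv (k j) \<bullet> (rv q + y)) * \<phi> (rv q + y - t j) = f j q" for j q
  proof -
    have "e (rv (k j) \<bullet> (rv q + y)) = e (rv (k j) \<bullet> y)"
      by (simp only: inner_add_right add.commute[of "rv (k j) \<bullet> rv q"] e_add_rv_inner)
    thus ?thesis by (simp add: f_def add_diff_eq)
  qed
  have nf: "(\<lambda>q. norm (f j q)) summable_on UNIV" "(\<Sum>\<^sub>\<infinity>q. norm (f j q)) = norm (c j) * (\<Sum>\<^sub>\<infinity>q. norm (\<phi> (rv q + (y - t j))))" for j
    unfolding f_def norm_mult norm_e mult_1_right
    by (intro summable_on_cmult_right B, rule infsum_cmult_right')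
  have sumc: "summable (\<lambda>j. norm (c j) * B)" by (intro summable_mult2 rapid_summable_norm[OF c])
  have le: "norm (\<Sum>\<^sub>\<infinity>q. norm (f j q)) \<le> norm (c j) * B" for j
    unfolding nf(2) using B(2) by (auto simp: infsum_nonneg intro!: mult_left_mono)
  have double: "(\<lambda>(j, q). f j q) summable_on UNIV \<times> UNIV"
  proof (rule abs_summable_summable)
    show "(\<lambda>x. norm (case x of (j, q) \<Rightarrow> f j q)) summable_on UNIV \<times> UNIV"
      unfolding Infinite_Sum.abs_summable_on_Sigma_iff
    proof (intro conjI ballI)
      have "summable (\<lambda>j. norm (\<Sum>\<^sub>\<infinity>q. norm (f j q)))"
        by (rule summable_comparison_test'[OF sumc]) (use le in auto)
      thus "(\<lambda>j. norm (\<Sum>\<^sub>\<infinity>q. norm (case (j, q) of (j, q) \<Rightarrow> f j q))) summable_on UNIV"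
        by (subst summable_on_UNIV_nonneg_real_iff) auto
    qed (simp add: nf)
  qed
  have norms: "summable (\<lambda>j. norm (infsum (f j) UNIV))"
  proof (rule summable_comparison_test'[OF sumc])
    fix j
    have "norm (infsum (f j) UNIV) \<le> (\<Sum>\<^sub>\<infinity>q. norm (f j q))" by (rule norm_infsum_bound[OF nf(1)])
    thus "norm (norm (infsum (f j) UNIV)) \<le> norm (c j) * B" using le[of j] by simp
  qed
  have sw: "(\<lambda>j. f j q) sums (\<Sum>\<^sub>\<infinity>j. f j q)" "wseries c (\<lambda>j. rv (k j)) t \<phi> (rv q + y) = (\<Sum>\<^sub>\<infinity>j. f j q)" for q
  proof -
    have s: "summable (\<lambda>j. norm (f j q))"
      using wseries_summable[OF c phi, of "\<lambda>j. rv (k j)" "rv q + y" t] by (simp only: f)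
    have f_sums: "(\<lambda>j. f j q) sums (\<Sum>j. f j q)" by (rule summable_sums[OF summable_norm_cancel[OF s]])
    have "((\<lambda>j. f j q) has_sum (\<Sum>j. f j q)) UNIV" by (rule norm_summable_imp_has_sum[OF s f_sums])
    hence "(\<Sum>\<^sub>\<infinity>j. f j q) = (\<Sum>j. f j q)" by (rule infsumI)
    thus "(\<lambda>j. f j q) sums (\<Sum>\<^sub>\<infinity>j. f j q)" "wseries c (\<lambda>j. rv (k j)) t \<phi> (rv q + y) = (\<Sum>\<^sub>\<infinity>j. f j q)"
      using f_sums by (simp_all add: wseries_def f)
  qed
  have "lat_sum (wseries c (\<lambda>j. rv (k j)) t \<phi>) y = (\<Sum>\<^sub>\<infinity>q. \<Sum>\<^sub>\<infinity>j. f j q)"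
    unfolding lat_sum_def sw(2) ..
  also have "\<dots> = (\<Sum>\<^sub>\<infinity>j. infsum (f j) UNIV)" by (rule infsum_swap_banach[OF double, symmetric])
  also have "\<dots> = (\<Sum>j. infsum (f j) UNIV)"
    by (rule infsumI[OF norm_summable_imp_has_sum[OF norms summable_sums[OF summable_norm_cancel[OF norms]]]])
  finally have "(\<lambda>j. infsum (f j) UNIV) sums lat_sum (wseries c (\<lambda>j. rv (k j)) t \<phi>) y"
    using summable_sums[OF summable_norm_cancel[OF norms]] by simp
  moreover have "infsum (f j) UNIV = c j * e (rv (k j) \<bullet> y) * lat_sum \<phi> (y - t j)" for j
    unfolding f_def lat_sum_def by (rule infsum_cmult_right')
  ultimately show ?thesis by simp
qed

subsection \<open>The quantized operators on the spaces \<open>H\<^sub>N\<close>\<close>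

lemma finite_idx [simp]: "finite (idx N :: (nat^'d) set)"
proof -
  have "idx N \<subseteq> vec_lambda ` (PiE (UNIV :: 'd set) (\<lambda>_. {..<N}))"
  proof
    fix n :: "nat^'d" assume "n \<in> idx N"
    hence "($) n \<in> PiE UNIV (\<lambda>_. {..<N})" by (auto simp: idx_def)
    thus "n \<in> vec_lambda ` (PiE UNIV (\<lambda>_. {..<N}))" by (metis imageI vec_nth_inverse)
  qed
  thus ?thesis by (rule finite_subset) (auto intro!: finite_imageI finite_PiE)
qed

definition lc :: "nat \<Rightarrow> (nat^'d) ell2 \<Rightarrow> 'd distr" where
  "lc N x = lincomb N (coord x)"

text \<open>\<open>lc N\<close> forgets the coordinates outside \<open>idx N\<close>, and
  \<open>X\<close> is required to induce \<open>F\<close> on what remains. The relation passes to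
  products, sums and exponentials, so the estimates can be made for operators on \<open>ell2\<close>
  and transferred at the end.\<close>

definition rep :: "nat \<Rightarrow> ('d distr \<Rightarrow> 'd distr) \<Rightarrow> (nat^'d) cop \<Rightarrow> bool" where
  "rep N F X \<longleftrightarrow> (\<forall>x. F (lc N x) = lc N (app X x))"

lemma lc_eq: "lc N x \<phi> = (\<Sum>n\<in>idx N. coord x n * Q N n \<phi>)"
  by (simp add: lc_def lincomb_def)

lemma bounded_linear_coord: "bounded_linear (\<lambda>x. coord x n)"
  by (rule bounded_linear_intro[where K = 1]) (auto simp: plus_ell2.rep_eq scaleR_ell2.rep_eq norm_coord_le)

lemma bounded_linear_lc: "bounded_linear (\<lambda>x. lc N x \<phi>)"
  unfolding lc_eq
  by (intro bounded_linear_sum bounded_linear_compose[OF bounded_linear_mult_left bounded_linear_coord])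

lemma lc_cmul: "lc N (cmul z x) \<phi> = z * lc N x \<phi>"
  by (simp add: lc_eq cmul.rep_eq sum_distrib_left mult.assoc)

text \<open>Duality puts the operator on the test function, as a series of modulated translates.
  Periodization turns a translation by \<open>l / N\<close> into a shift of grid indices modulo
  \<open>N\<close>, and reindexing the sum over \<open>idx N\<close> moves that shift to the
  coefficients.\<close>

lemma rep_op_N:
  fixes a :: "(real^'d) \<times> (real^'d) \<Rightarrow> complex"
  assumes N: "1 \<le> N" and c: "rapid c (\<lambda>j. mrv (m j))" and a: "\<And>z. (\<lambda>j. c j * e (mrv (m j) \<bullet> z)) sums a z"
  shows "rep N (op_N N a) (wseq N c m)"
  unfolding rep_def
proof (intro allI ext)
  fix x :: "(nat^'d) ell2" and \<phi> :: "real^'d \<Rightarrow> complex"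
  have N0: "0 < N" using N by simp
  have HN: "lc N x \<in> HN N" by (auto simp: HN_def lc_def)
  show "op_N N a (lc N x) \<phi> = lc N (app (wseq N c m) x) \<phi>"
  proof (cases "schwartz \<phi>")
    case False
    thus ?thesis using HN by (simp add: op_N_def op_h_def extend_by_duality_def lc_eq Q_lat_sum)
  next
    case phi: True
    let ?K = "\<lambda>j. fst (m j)" and ?L = "\<lambda>j. snd (m j)"
    define d where "d j = c j * e (- (rv (?K j) \<bullet> rv (?L j) / (2 * N)))" for j
    define \<psi> where "\<psi> = wseries d (\<lambda>j. rv (?K j)) (\<lambda>j. rv (?L j) /\<^sub>R N) \<phi>"
    have d: "rapid d (\<lambda>j. mrv (m j))" using c by (simp add: d_def rapid_def norm_mult)
    have psi: "schwartz \<psi>" unfolding \<psi>_def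
    proof (rule schwartz_wseries[OF d phi])
      show "norm (rv (?K j)) \<le> norm (mrv (m j))" for j by (rule norm_fst_le)
      have "norm (rv (?L j) /\<^sub>R N) \<le> norm (rv (?L j))" for j
        using mult_right_mono[of 1 "real N" "norm (rv (?L j))"] N N0 by (simp add: field_simps)
      thus "norm (rv (?L j) /\<^sub>R N) \<le> norm (mrv (m j))" for j using norm_snd_le order_trans by blast
    qed
    define s where "s = complex_of_real (real N powr (- real CARD('d) / 2))"
    define T where "T j n = coord x n * (s * (d j * e (rv (?K j) \<bullet> (nr n /\<^sub>R N)) * lat_sum \<phi> (nr n /\<^sub>R N - rv (?L j) /\<^sub>R N)))" for j n
    have Tsums: "(\<lambda>j. T j n) sums (coord x n * Q N n \<psi>)" for n
    proof -
      have "Q N n \<psi> = s * lat_sum \<psi> (nr n /\<^sub>R N)" by (simp add: Q_lat_sum psi s_def)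
      thus ?thesis unfolding T_def \<psi>_def by (simp only:) (intro sums_mult lat_sum_wseries[OF d phi])
    qed
    have reidx: "(\<Sum>n\<in>idx N. T j n) = (\<Sum>n\<in>idx N. c j * coord (app (wop N (m j)) x) n * Q N n \<phi>)" for j
    proof -
      have bij: "bij_betw (sh N (?L j)) (idx N) (idx N)"
        by (rule bij_betw_byWitness[where f' = "sh N (- ?L j)"]) (auto simp: sh_sh sh_0 N0 sh_idx)
      have shifted: "(\<Sum>n\<in>idx N. T j n) = (\<Sum>n\<in>idx N. T j (sh N (?L j) n))"
        by (rule sum.reindex_bij_betw[OF bij, symmetric])
      have "T j (sh N (?L j) n) = c j * coord (app (wop N (m j)) x) n * Q N n \<phi>" for n
      proof -
        obtain q where q: "nr (sh N (?L j) n) = nr n + rv (?L j) + real N *\<^sub>R rv q" by (rule sh_nr[OF N0])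
        have "nr (sh N (?L j) n) /\<^sub>R N - rv (?L j) /\<^sub>R N = nr n /\<^sub>R N + rv q"
          using N0 by (simp add: q scaleR_add_right)
        hence l: "lat_sum \<phi> (nr (sh N (?L j) n) /\<^sub>R N - rv (?L j) /\<^sub>R N) = lat_sum \<phi> (nr n /\<^sub>R N)"
          by (simp only: lat_sum_shift)
        \<comment> \<open>The modulation is evaluated at the shifted index \<open>n + l\<close>; its
          extra phase \<open>k \<bullet> l / N\<close> turns the transposed half phase, which is
          negative, into the positive one of \<open>weyl_phase\<close>.\<close>
        have "e (- (rv (?K j) \<bullet> rv (?L j) / (2 * N))) * e (rv (?K j) \<bullet> (nr (sh N (?L j) n) /\<^sub>R N))
            = e (- (rv (?K j) \<bullet> rv (?L j) / (2 * N)) + rv (?K j) \<bullet> nr (sh N (?L j) n) / N)"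
          by (simp only: e_add inner_scaleR_right divide_inverse mult.commute[of "inverse _"])
        also have "\<dots> = e (- (rv (?K j) \<bullet> rv (?L j) / (2 * N)) + rv (?K j) \<bullet> (nr n + rv (?L j)) / N)"
          by (rule e_sh[OF N0])
        also have "- (rv (?K j) \<bullet> rv (?L j) / (2 * N)) + rv (?K j) \<bullet> (nr n + rv (?L j)) / N
            = rv (?K j) \<bullet> nr n / N + rv (?K j) \<bullet> rv (?L j) / (2 * N)"
          using N0 by (simp add: inner_add_right field_simps)
        finally have p: "e (- (rv (?K j) \<bullet> rv (?L j) / (2 * N))) * e (rv (?K j) \<bullet> (nr (sh N (?L j) n) /\<^sub>R N))
            = weyl_phase N (?K j) (?L j) n" by (simp add: weyl_phase_def)
        have "T j (sh N (?L j) n) = coord x (sh N (?L j) n) * (s * (c j * (e (- (rv (?K j) \<bullet> rv (?L j) / (2 * N)))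
            * e (rv (?K j) \<bullet> (nr (sh N (?L j) n) /\<^sub>R N))) * lat_sum \<phi> (nr n /\<^sub>R N)))"
          unfolding T_def l d_def by (simp only: mult.assoc)
        thus ?thesis unfolding p wop_def coord_weyl_op[OF N0] Q_lat_sum s_def using phi by simp
      qed
      thus ?thesis unfolding shifted by (simp only:)
    qed
    have csums: "(\<lambda>j. c j * coord (app (wop N (m j)) x) n * Q N n \<phi>) sums (coord (app (wseq N c m) x) n * Q N n \<phi>)" for n
    proof -
      have "bounded_linear (\<lambda>X. coord (app X x) n)"
        by (rule bounded_linear_compose[OF bounded_linear_coord bounded_linear_app_left])
      from bounded_linear.sums[OF this wseq_sums[OF N0 rapid_summable_norm[OF c]]]
      show ?thesis by (intro sums_mult2) (simp add: cmul.rep_eq)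
    qed
    have "op_N N a (lc N x) \<phi> = lc N x \<psi>"
      using HN phi transposed_weyl_Fourier_series[OF N refl c a phi]
      by (simp add: op_N_def op_h_def extend_by_duality_def \<psi>_def d_def[abs_def])
    also have "\<dots> = (\<Sum>n\<in>idx N. \<Sum>j. T j n)"
      using Tsums by (simp add: lc_eq sums_iff)
    also have "\<dots> = (\<Sum>j. \<Sum>n\<in>idx N. T j n)"
      by (rule suminf_sum[symmetric]) (use Tsums sums_summable in blast)
    also have "\<dots> = (\<Sum>j. \<Sum>n\<in>idx N. c j * coord (app (wop N (m j)) x) n * Q N n \<phi>)"
      unfolding reidx ..
    also have "\<dots> = (\<Sum>n\<in>idx N. \<Sum>j. c j * coord (app (wop N (m j)) x) n * Q N n \<phi>)"
      by (rule suminf_sum) (use csums sums_summable in blast)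
    also have "\<dots> = lc N (app (wseq N c m) x) \<phi>"
      using csums by (simp add: lc_eq sums_iff)
    finally show ?thesis .
  qed
qed

lemma rep_comp: "rep N F X \<Longrightarrow> rep N G Y \<Longrightarrow> rep N (F \<circ> G) (X * Y)"
  by (simp add: rep_def)

lemma rep_funpow: "rep N F X \<Longrightarrow> rep N (F ^^ n) (X ^ n)"
  by (induction n) (simp_all add: rep_def)

lemma rep_plus: "rep N F X \<Longrightarrow> rep N G Y \<Longrightarrow> rep N (op_plus F G) (X + Y)"
  unfolding rep_def op_plus_def
  by (auto simp: fun_eq_iff lc_eq plus_ell2.rep_eq distrib_right sum.distrib)

lemma rep_minus: "rep N F X \<Longrightarrow> rep N G Y \<Longrightarrow> rep N (op_minus F G) (X - Y)"
  unfolding rep_def op_minus_def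
  by (auto simp: fun_eq_iff lc_eq minus_ell2.rep_eq left_diff_distrib sum_subtractf)

text \<open>For a fixed vector and test function the value of \<open>lc\<close> is a bounded linear
  functional of the operator, so the norm-convergent exponential becomes the pointwise series in
  \<open>op_exp\<close>.\<close>

lemma rep_exp:
  fixes X :: "(nat^'d) cop"
  assumes F: "rep N F X" shows "rep N (op_exp z F) (exp (csc z X))"
  unfolding rep_def
proof (intro allI ext)
  fix x :: "(nat^'d) ell2" and \<phi>
  have bl: "bounded_linear (\<lambda>Y. lc N (app Y x) \<phi>)"
    by (rule bounded_linear_compose[OF bounded_linear_lc bounded_linear_app_left])
  have t: "lc N (app (csc z X ^ k /\<^sub>R fact k) x) \<phi> = z ^ k / fact k * (F ^^ k) (lc N x) \<phi>" for k
  proof -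
    have "lc N (app (csc z X ^ k /\<^sub>R fact k) x) \<phi> = lc N (app (csc z X ^ k) x) \<phi> /\<^sub>R fact k"
      by (rule linear_scale[OF bounded_linear.linear[OF bl]])
    also have "lc N (app (csc z X ^ k) x) \<phi> = z ^ k * lc N (app (X ^ k) x) \<phi>"
      by (simp add: csc_power lc_cmul)
    also have "lc N (app (X ^ k) x) = (F ^^ k) (lc N x)" using rep_funpow[OF F, of k] by (simp add: rep_def)
    finally show ?thesis by (simp add: scaleR_conv_of_real field_simps)
  qed
  from bounded_linear.sums[OF bl exp_converges[of "csc z X"]]
  show "op_exp z F (lc N x) \<phi> = lc N (app (exp (csc z X)) x) \<phi>"
    unfolding t op_exp_def by (simp add: sums_iff)
qed

subsection \<open>Norms on \<open>H\<^sub>N\<close>\<close>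

text \<open>Modulation is a \<open>wseries\<close> with a single nonzero term.\<close>

lemma schwartz_mult_e:
  fixes \<phi> :: "'a::euclidean_space \<Rightarrow> complex"
  assumes "schwartz \<phi>" shows "schwartz (\<lambda>x. e (k \<bullet> x) * \<phi> x)"
proof -
  let ?c = "\<lambda>j::nat. if j = 0 then 1 else 0 :: complex"
  have "rapid ?c (\<lambda>_. k)" unfolding rapid_def
    by (auto intro!: summable_finite[of "{0}"] split: if_splits)
  from schwartz_wseries[OF this assms, of "\<lambda>_. k" "\<lambda>_. 0"]
  have "schwartz (wseries ?c (\<lambda>_. k) (\<lambda>_. 0) \<phi>)" by simp
  moreover have "wseries ?c (\<lambda>_. k) (\<lambda>_. 0) \<phi> = (\<lambda>x. e (k \<bullet> x) * \<phi> x)"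
    unfolding wseries_def by (subst suminf_finite[of "{0}"]) auto
  ultimately show ?thesis by simp
qed

lemma e_root_inject:
  assumes "s < N" "t < N" "e (real s / N) = e (real t / N)" shows "s = t"
proof -
  have "e (real s / N - real t / N) = e (real s / N) * cnj (e (real t / N))"
    by (metis diff_conv_add_uminus e_add e_minus)
  also have "\<dots> = 1" unfolding assms(3)[symmetric] by (metis add.right_inverse e_0 e_add e_minus)
  finally have "norm (e (real s / N - real t / N) - 1) = 0" by simp
  hence "sin (pi * (real s / N - real t / N)) = 0" by (simp add: norm_e_minus_1)
  then obtain i :: int where "pi * (real s / N - real t / N) = of_int i * pi" using sin_zero_iff_int2 by blast
  hence "real s / N - real t / N = of_int i" by simp
  hence *: "real s - real t = of_int i * real N" using assms(1) by (simp add: field_simps)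
  hence "int s - int t = i * int N" by (metis of_int_diff of_int_eq_iff of_int_mult of_int_of_nat_eq)
  moreover have "\<bar>int s - int t\<bar> < int N" using assms by auto
  ultimately have "\<bar>i\<bar> * int N < 1 * int N" by (simp add: abs_mult)
  hence "i = 0" using assms(1) by (subst (asm) mult_less_cancel_right_pos) auto
  thus ?thesis using \<open>int s - int t = i * int N\<close> by simp
qed

text \<open>A Gaussian times a trigonometric polynomial that vanishes on the grid except at the residue
  class of \<open>n0\<close>.\<close>

lemma separating_schwartz_function:
  fixes n0 :: "nat^'d"
  assumes N: "0 < N" and n0: "n0 \<in> idx N"
  obtains \<phi> where "\<And>n. n \<in> idx N \<Longrightarrow> n \<noteq> n0 \<Longrightarrow> Q N n \<phi> = 0" "Q N n0 \<phi> \<noteq> 0"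
proof -
  define G where "G x = complex_of_real (exp (- (x \<bullet> x)))" for x :: "real^'d"
  define \<phi> where "\<phi> F x = (\<Prod>(i, t)\<in>F. e (x $ i) - e (real t / N)) * G x" for F and x :: "real^'d"
  have G: "schwartz G" unfolding G_def[abs_def] by (rule schwartz_gauss)
  have s: "schwartz (\<phi> F)" if "finite F" for F
    using that
  proof (induction F rule: finite_induct)
    case empty thus ?case using G by (simp add: \<phi>_def[abs_def])
  next
    case (insert p F)
    obtain i t where p: "p = (i, t)" by force
    have "\<phi> (insert p F) = (\<lambda>x. e (axis i 1 \<bullet> x) * \<phi> F x - e (real t / N) * \<phi> F x)"
      using insert.hyps by (simp add: \<phi>_def[abs_def] p inner_axis' algebra_simps)
    thus ?case using schwartz_diff[OF schwartz_mult_e schwartz_mult_left, OF insert.IH insert.IH] by simp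
  qed
  define F where "F = (SIGMA i:(UNIV::'d set). {t. t < N \<and> t \<noteq> n0 $ i})"
  have F: "finite F" unfolding F_def by (intro finite_SigmaI) auto
  define P where "P n = (\<Prod>(i, t)\<in>F. e (real (n $ i) / N) - e (real t / N))" for n :: "nat^'d"
  have lat: "lat_sum (\<phi> F) (nr n /\<^sub>R N) = P n * lat_sum G (nr n /\<^sub>R N)" for n
  proof -
    have "\<phi> F (rv k + nr n /\<^sub>R N) = P n * G (rv k + nr n /\<^sub>R N)" for k
      by (simp add: \<phi>_def P_def e_add divide_inverse_commute)
    thus ?thesis unfolding lat_sum_def by (simp add: infsum_cmult_right')
  qed
  show thesis
  proof (rule that)
    fix n :: "nat^'d" assume n: "n \<in> idx N" "n \<noteq> n0"
    then obtain i where "n $ i \<noteq> n0 $ i" by (auto simp: vec_eq_iff)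
    hence "(i, n $ i) \<in> F" using n by (simp add: F_def idx_def)
    hence "P n = 0" unfolding P_def by (intro prod_zero[OF F] bexI[of _ "(i, n $ i)"]) auto
    thus "Q N n (\<phi> F) = 0" by (simp add: Q_lat_sum lat)
  next
    have "P n0 \<noteq> 0"
    proof
      assume "P n0 = 0"
      then obtain i t where it: "(i, t) \<in> F" "e (real (n0 $ i) / N) = e (real t / N)"
        using F by (auto simp: P_def prod_zero_iff)
      hence "n0 $ i = t" using n0 by (intro e_root_inject[of _ N]) (auto simp: F_def idx_def)
      thus False using it by (simp add: F_def)
    qed
    \<comment> \<open>The periodized Gaussian is a sum of positive terms, so the one at 0 already
      bounds it away from 0.\<close>
    moreover have "lat_sum G (nr n0 /\<^sub>R N) \<noteq> 0"
    proof -
      let ?g = "\<lambda>k :: int^'d. exp (- ((rv k + nr n0 /\<^sub>R N) \<bullet> (rv k + nr n0 /\<^sub>R N)))"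
      obtain B where "\<And>y. (\<lambda>k. norm (G (rv k + y))) summable_on UNIV" using lattice_summable[OF G] by blast
      from this[of "nr n0 /\<^sub>R N"] have g: "?g summable_on UNIV" by (simp add: G_def)
      hence "(?g has_sum infsum ?g UNIV) UNIV" by (rule has_sum_infsum)
      hence "((\<lambda>k. complex_of_real (?g k)) has_sum complex_of_real (infsum ?g UNIV)) UNIV" by (rule has_sum_of_real)
      hence "lat_sum G (nr n0 /\<^sub>R N) = complex_of_real (infsum ?g UNIV)"
        unfolding lat_sum_def G_def by (rule infsumI)
      moreover have "sum ?g {0} \<le> infsum ?g UNIV" by (rule finite_sum_le_infsum[OF g]) auto
      hence "0 < infsum ?g UNIV" by (auto intro: less_le_trans[OF exp_gt_zero])
      ultimately show ?thesis by simp
    qed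
    ultimately show "Q N n0 (\<phi> F) \<noteq> 0" using s[OF F] N by (simp add: Q_lat_sum lat)
  qed
qed

text \<open>The definite description in \<open>coords\<close> requires uniqueness of coefficients; a
  separating test function isolates one coefficient at a time.\<close>

lemma coords_lc:
  fixes x :: "(nat^'d) ell2"
  assumes N: "0 < N" shows "coords N (lc N x) = (\<lambda>n. if n \<in> idx N then coord x n else 0)"
  unfolding coords_def
proof (rule the_equality)
  show "(\<forall>n. n \<notin> idx N \<longrightarrow> (if n \<in> idx N then coord x n else 0) = 0) \<and> lc N x = lincomb N (\<lambda>n. if n \<in> idx N then coord x n else 0)"
    by (auto simp: lc_def lincomb_def)
  fix c assume c: "(\<forall>n. n \<notin> idx N \<longrightarrow> c n = 0) \<and> lc N x = lincomb N c"
  show "c = (\<lambda>n. if n \<in> idx N then coord x n else 0)"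
  proof
    fix n0
    show "c n0 = (if n0 \<in> idx N then coord x n0 else 0)"
    proof (cases "n0 \<in> idx N")
      case True
      obtain \<phi> where phi: "\<And>n. n \<in> idx N \<Longrightarrow> n \<noteq> n0 \<Longrightarrow> Q N n \<phi> = 0" "Q N n0 \<phi> \<noteq> 0"
        by (rule separating_schwartz_function[OF N True]) blast
      have pick: "lincomb N f \<phi> = f n0 * Q N n0 \<phi>" for f
      proof -
        have "lincomb N f \<phi> = (\<Sum>n\<in>{n0}. f n * Q N n \<phi>)"
          unfolding lincomb_def by (rule sum.mono_neutral_right) (use True phi in auto)
        thus ?thesis by simp
      qed
      have "lincomb N (coord x) \<phi> = lincomb N c \<phi>" using c by (simp add: lc_def)
      thus ?thesis using True phi(2) by (simp add: pick)
    qed (use c in auto)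
  qed
qed

lemma HN_norm_lc:
  assumes "0 < N" shows "HN_norm N (lc N x) = sqrt (\<Sum>n\<in>idx N. (norm (coord x n))\<^sup>2)"
proof -
  have "Re (z * cnj z) = (norm z)\<^sup>2" for z by (metis Re_complex_of_real complex_norm_square)
  thus ?thesis by (simp add: HN_norm_def HN_inner_def coords_lc[OF assms])
qed

lemma HN_norm_lc_le: "0 < N \<Longrightarrow> HN_norm N (lc N x) \<le> norm x"
  by (simp add: HN_norm_lc real_le_lsqrt sum_nonneg sum_coord_le)

text \<open>Extending the coefficients by 0 outside \<open>idx N\<close> makes the two norms agree,
  so the unit ball of the space lifts into the unit ball of \<open>ell2\<close>.\<close>

lemma HN_elem:
  fixes u :: "'d::finite distr"
  assumes N: "0 < N" and u: "u \<in> HN N" obtains x where "u = lc N x" "norm x = HN_norm N u"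
proof -
  obtain c where c: "u = lincomb N c" using u by (auto simp: HN_def)
  define f where "f n = (if n \<in> idx N then c n else 0)" for n
  define x where "x = Abs_ell2 f"
  have "(\<lambda>n. (norm (f n))\<^sup>2) summable_on UNIV"
    by (rule summable_on_cong_neutral[THEN iffD1, OF _ _ _ summable_on_finite[of "idx N"]]) (auto simp: f_def)
  hence x: "coord x = f" by (simp add: x_def Abs_ell2_inverse)
  have "(norm x)\<^sup>2 = (\<Sum>n\<in>idx N. (norm (coord x n))\<^sup>2)"
    unfolding norm_ell2_square x
    by (subst infsum_cong_neutral[where T = "idx N" and g = "\<lambda>n. (norm (f n))\<^sup>2"]) (auto simp: f_def)
  moreover have "u = lc N x" by (simp add: c lc_def lincomb_def x f_def fun_eq_iff)
  moreover have "norm x = sqrt ((norm x)\<^sup>2)" by simp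
  ultimately show thesis using that HN_norm_lc[OF N, of x] by metis
qed

text \<open>A vector is lifted without changing its norm, \<open>X\<close> is applied, and dropping
  the coordinates outside \<open>idx N\<close> cannot increase the norm of the result.\<close>

lemma op_norm_rep_le:
  fixes X :: "(nat^'d) cop"
  assumes N: "0 < N" and F: "rep N F X" shows "op_norm N F \<le> norm X"
  unfolding op_norm_def
proof (rule cSup_least)
  have "lc N (0 :: (nat^'d) ell2) \<in> HN N" by (auto simp: HN_def lc_def)
  moreover have "HN_norm N (lc N (0 :: (nat^'d) ell2)) \<le> 1"
    by (rule order_trans[OF HN_norm_lc_le[OF N]]) simp
  ultimately show "{HN_norm N (F u) |u. u \<in> HN N \<and> HN_norm N u \<le> 1} \<noteq> {}" by blast
next
  fix r assume "r \<in> {HN_norm N (F u) |u. u \<in> HN N \<and> HN_norm N u \<le> 1}"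
  then obtain u where u: "r = HN_norm N (F u)" "u \<in> HN N" "HN_norm N u \<le> 1" by blast
  obtain x where x: "u = lc N x" "norm x = HN_norm N u" by (rule HN_elem[OF N u(2)])
  have "r = HN_norm N (lc N (app X x))" using F u(1) x(1) by (simp add: rep_def)
  also have "\<dots> \<le> norm (app X x)" by (rule HN_norm_lc_le[OF N])
  also have "\<dots> \<le> norm X * norm x" by (rule norm_app)
  also have "\<dots> \<le> norm X" using u(3) x(2) by (simp add: mult_left_le)
  finally show "r \<le> norm X" .
qed

subsection \<open>Trotter error\<close>

lemma csc_minus: "csc (- z) X = - csc z X"
  using csc_diff[of 0 z X] csc_of_real[of 0 X] by simp

lemma csc_add_right: "csc z (X + Y) = csc z X + csc z Y"
  by (rule linear_add[OF bounded_linear.linear[OF bounded_linear_csc]])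

text \<open>Averaging the series of \<open>a\<close> with that of its complex conjugate makes the quantization of a
  real symbol manifestly symmetric on the whole of \<open>\<ell>\<^sup>2\<close>.\<close>

lemma real_symbol_rep:
  fixes a :: "(real^'d) \<times> (real^'d) \<Rightarrow> complex"
  assumes a: "torus_smooth a" and real: "\<forall>z. a z \<in> \<real>"
  obtains S and A :: "nat \<Rightarrow> (nat^'d) cop"
  where "0 \<le> S" and "\<And>N. 1 \<le> N \<Longrightarrow> rep N (op_N N a) (A N)" and "\<And>N. 1 \<le> N \<Longrightarrow> wbounded N 2 S (A N)"
    and "\<And>N r f. 1 \<le> N \<Longrightarrow> app (csc (\<i> * of_real r) (A N)) f \<bullet> f = 0"
proof -
  obtain c and m :: "nat \<Rightarrow> (int^'d) \<times> (int^'d)"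
    where c: "rapid c (\<lambda>j. mrv (m j))" and s: "\<And>z. (\<lambda>j. c j * e (mrv (m j) \<bullet> z)) sums a z"
    using torus_smooth_Fourier_series[OF a] by blast
  have c': "rapid (\<lambda>j. cnj (c j)) (\<lambda>j. mrv (- m j))"
    using c by (simp add: rapid_def norm_prod_def)
  have s': "(\<lambda>j. cnj (c j) * e (mrv (- m j) \<bullet> z)) sums a z" for z
  proof -
    have "cnj (c j) * e (mrv (- m j) \<bullet> z) = cnj (c j * e (mrv (m j) \<bullet> z))" for j
      by (simp add: e_minus[symmetric] inner_prod_def)
    moreover have "(\<lambda>j. cnj (c j * e (mrv (m j) \<bullet> z))) sums cnj (a z)" using s by (simp only: sums_cnj)
    moreover have "cnj (a z) = a z" using real Reals_cnj_iff by blast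
    ultimately show ?thesis by (simp only:)
  qed
  define S where "S = (\<Sum>j. norm (c j) * wgt (m j) ^ 2)"
  define A where "A N = csc (1 / 2) (wseq N c m + wseq N (\<lambda>j. cnj (c j)) (\<lambda>j. - m j))" for N
  show thesis
  proof (rule that)
    show "0 \<le> S" unfolding S_def by (intro suminf_nonneg rapid_summable_wgt c) auto
    fix N :: nat assume N: "1 \<le> N"
    hence N0: "0 < N" by simp
    have r: "rep N (op_N N a) (wseq N c m)" "rep N (op_N N a) (wseq N (\<lambda>j. cnj (c j)) (\<lambda>j. - m j))"
      by (rule rep_op_N[OF N c s], rule rep_op_N[OF N c' s'])
    show "rep N (op_N N a) (A N)" unfolding rep_def
    proof (intro allI ext)
      fix x :: "(nat^'d) ell2" and \<phi>
      have "lc N (app (A N) x) \<phi> = 1 / 2 * lc N (app (wseq N c m) x + app (wseq N (\<lambda>j. cnj (c j)) (\<lambda>j. - m j)) x) \<phi>"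
        by (simp only: A_def app_csc lc_cmul app_simps)
      also have "\<dots> = 1 / 2 * (lc N (app (wseq N c m) x) \<phi> + lc N (app (wseq N (\<lambda>j. cnj (c j)) (\<lambda>j. - m j)) x) \<phi>)"
        by (simp only: linear_add[OF bounded_linear.linear[OF bounded_linear_lc]])
      also have "\<dots> = op_N N a (lc N x) \<phi>" using r by (simp add: rep_def)
      finally show "op_N N a (lc N x) \<phi> = lc N (app (A N) x) \<phi>" by (rule sym)
    qed
    have "wbounded N 2 (norm (1 / 2 :: complex) * (S + S)) (A N)"
      unfolding A_def S_def
      using wbounded_wseq[OF N0 c, of 2] wbounded_wseq[OF N0 c', of 2]
      by (intro wbounded_csc wbounded_add) simp_all
    thus "wbounded N 2 S (A N)" by (simp add: norm_divide)
    fix r and f :: "(nat^'d) ell2"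
    show "app (csc (\<i> * of_real r) (A N)) f \<bullet> f = 0"
      using skew_wseq[OF N0 rapid_summable_norm[OF c], of "r / 2" m f] by (simp add: A_def csc_csc)
  qed
qed

text \<open>Collects the iterated conjugations into the two powers that appear in
  \<open>trotter_evol\<close>; the right factor reverses the order of the left one.\<close>

lemma funpow_evol:
  "((\<lambda>Y. evol a s (evol b s Y)) ^^ n) X =
    (exp (s *\<^sub>R a) * exp (s *\<^sub>R b)) ^ n * X * (exp (s *\<^sub>R - b) * exp (s *\<^sub>R - a)) ^ n"
proof (induction n)
  case (Suc n)
  let ?P = "exp (s *\<^sub>R a) * exp (s *\<^sub>R b)" and ?R = "exp (s *\<^sub>R - b) * exp (s *\<^sub>R - a)"
  have "((\<lambda>Y. evol a s (evol b s Y)) ^^ Suc n) X = ?P * (?P ^ n * X * ?R ^ n) * ?R"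
    unfolding funpow.simps o_apply Suc by (simp only: evol_def mult.assoc)
  also have "\<dots> = ?P ^ Suc n * X * ?R ^ Suc n"
    unfolding power_Suc[of ?P] power_Suc2[of ?R] by (simp only: mult.assoc)
  finally show ?case .
qed simp

lemma exp_csc_rep:
  assumes "rep N F A"
  shows "rep N (op_exp (\<i> * of_real (s / h)) F) (exp (s *\<^sub>R csc (\<i> * of_real (1 / h)) A))"
    and "rep N (op_exp (- (\<i> * of_real (s / h))) F) (exp (s *\<^sub>R - csc (\<i> * of_real (1 / h)) A))"
proof -
  have eq: "csc (\<i> * of_real (s / h)) A = s *\<^sub>R csc (\<i> * of_real (1 / h)) A"
    unfolding csc_of_real[symmetric] csc_csc by (simp add: mult.commute)
  show "rep N (op_exp (\<i> * of_real (s / h)) F) (exp (s *\<^sub>R csc (\<i> * of_real (1 / h)) A))"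
    using rep_exp[OF assms] by (simp only: eq[symmetric])
  show "rep N (op_exp (- (\<i> * of_real (s / h))) F) (exp (s *\<^sub>R - csc (\<i> * of_real (1 / h)) A))"
    using rep_exp[OF assms, of "- (\<i> * of_real (s / h))"] by (simp only: csc_minus eq scaleR_minus_right)
qed

theorem theorem10:
  fixes a b ob :: "(real^'d) \<times> (real^'d) \<Rightarrow> complex" and t :: real
  assumes "torus_smooth a" and "torus_smooth b" and "torus_smooth ob"
    and "\<forall>z. a z \<in> \<real>" and "\<forall>z. b z \<in> \<real>"
    and "t > 0"
  shows "\<exists>C::real. \<forall>N n :: nat. \<forall>h s :: real.
    N \<ge> 1 \<longrightarrow> n \<ge> 1 \<longrightarrow> h = 1 / (2 * pi * real N) \<longrightarrow> t = real n * s \<longrightarrow>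
    op_norm N (op_minus
      (trotter_evol h (op_N N a) (op_N N b) (op_N N ob) n s)
      (exact_evol h (op_plus (op_N N a) (op_N N b)) (op_N N ob) t)) \<le> C * s"
proof -
  obtain Sa and A :: "nat \<Rightarrow> (nat^'d) cop" where A: "0 \<le> Sa"
    "\<And>N. 1 \<le> N \<Longrightarrow> rep N (op_N N a) (A N)" "\<And>N. 1 \<le> N \<Longrightarrow> wbounded N 2 Sa (A N)"
    "\<And>N r f. 1 \<le> N \<Longrightarrow> app (csc (\<i> * of_real r) (A N)) f \<bullet> f = 0"
    using real_symbol_rep[OF assms(1,4)] by blast
  obtain Sb and B :: "nat \<Rightarrow> (nat^'d) cop" where B: "0 \<le> Sb"
    "\<And>N. 1 \<le> N \<Longrightarrow> rep N (op_N N b) (B N)" "\<And>N. 1 \<le> N \<Longrightarrow> wbounded N 2 Sb (B N)"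
    "\<And>N r f. 1 \<le> N \<Longrightarrow> app (csc (\<i> * of_real r) (B N)) f \<bullet> f = 0"
    using real_symbol_rep[OF assms(2,5)] by blast
  obtain c and m :: "nat \<Rightarrow> (int^'d) \<times> (int^'d)"
    where c: "rapid c (\<lambda>j. mrv (m j))" and ob: "\<And>z. (\<lambda>j. c j * e (mrv (m j) \<bullet> z)) sums ob z"
    using torus_smooth_Fourier_series[OF assms(3)] by blast
  define So where "So = (\<Sum>j. norm (c j) * wgt (m j) ^ 1)"
  \<comment> \<open>The tameness bound \<open>4 pi / N\<close> times \<open>2 pi N\<close>, the size
    of \<open>1 / h\<close>, gives \<open>8 pi^2\<close> without any \<open>N\<close>.\<close>
  define Cb Ch where "Cb = 8 * pi\<^sup>2 * Sb" and "Ch = 8 * pi\<^sup>2 * (Sa + Sb)"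
  have C0: "0 \<le> Cb" "0 \<le> Ch" using A(1) B(1) by (simp_all add: Cb_def Ch_def)
  \<comment> \<open>The growth constant of the sum dominates that of \<open>b\<close>, so one number
    of doublings is enough for both flows. It depends on \<open>t\<close> and the symbols but not on
    \<open>N\<close> or \<open>n\<close>.\<close>
  obtain q :: nat where q: "2 * (Ch * t) < real q" using reals_Archimedean2 by blast
  have le: "Cb * t \<le> Ch * t" using A(1) assms(6) by (simp add: Cb_def Ch_def mult_right_mono)
  have nonneg: "0 \<le> Ch * t" using C0 assms(6) by simp
  have "0 < real q" using q nonneg by linarith
  hence qs: "0 < q" "Cb * t \<le> real q / 2" "Ch * t \<le> real q / 2" using q le by (simp, linarith, linarith)
  \<comment> \<open>The double commutator contributes \<open>8 pi / N\<close> times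
    \<open>(2 pi N)^2\<close>, that is \<open>32 pi^3 N\<close>, and the regularity of the
    observable contributes \<open>4 pi / N\<close>; the product is \<open>128 pi^4\<close>.\<close>
  define C where "C = t * (128 * pi ^ 4 * Sa * Sb * So) * 4 ^ q"
  have "op_norm N (op_minus
      (trotter_evol h (op_N N a) (op_N N b) (op_N N ob) n s)
      (exact_evol h (op_plus (op_N N a) (op_N N b)) (op_N N ob) t)) \<le> C * s"
    if N: "1 \<le> N" and n: "1 \<le> n" and h: "h = 1 / (2 * pi * real N)" and t: "t = real n * s" for N n h s
  proof -
    have N0: "0 < N" and n_pos: "0 < n" using N n by simp_all
    interpret W: conj_family "wop N :: (int^'d) \<times> (int^'d) \<Rightarrow> (nat^'d) cop" "\<lambda>m. wop N (- m)" wgt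
      by (rule conj_family_wop[OF N0])
    define O' where "O' = wseq N c m"
    define \<alpha> \<beta> where "\<alpha> = csc (\<i> * of_real (1 / h)) (A N)" and "\<beta> = csc (\<i> * of_real (1 / h)) (B N)"
    have sum: "csc (\<i> * of_real (1 / h)) (A N + B N) = \<alpha> + \<beta>" by (simp only: \<alpha>_def \<beta>_def csc_add_right)
    have nh: "norm (\<i> * complex_of_real (1 / h)) = 2 * pi * N" by (simp add: h norm_mult)
    have wb: "wbounded N 2 (2 * pi * N * Sa) \<alpha>" "wbounded N 2 (2 * pi * N * Sb) \<beta>"
      unfolding \<alpha>_def \<beta>_def nh[symmetric] by (intro wbounded_csc A B N)+
    have contr: "contr \<alpha>" "contr \<beta>" "contr (\<alpha> + \<beta>)"
      unfolding \<alpha>_def \<beta>_def by (intro contr_skew; simp only: A(4)[OF N] B(4)[OF N] app_simps inner_add_left; simp)+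
    have tame: "W.tame Cb \<beta>" "W.tame Ch (\<alpha> + \<beta>)"
    proof -
      have "4 * pi / N * (2 * pi * N * Sb) = Cb" "4 * pi / N * (2 * pi * N * Sa + 2 * pi * N * Sb) = Ch"
        using N0 by (simp_all add: Cb_def Ch_def power2_eq_square field_simps)
      thus "W.tame Cb \<beta>" "W.tame Ch (\<alpha> + \<beta>)"
        using tame_wbounded[OF N0 wb(2)] tame_wbounded[OF N0 wbounded_add[OF wb]] by (simp_all only:)
    qed
    have P: "norm (comm (comm \<alpha> \<beta>) Y) \<le> (32 * pi ^ 3 * N * Sa * Sb) * L" if "W.lip L Y" for L Y
    proof -
      have "norm (comm (comm \<alpha> \<beta>) Y) \<le> 8 * pi / N * L * (2 * pi * N * Sa) * (2 * pi * N * Sb)"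
        by (rule double_comm_wbounded[OF N0 wb that])
      also have "\<dots> = (32 * pi ^ 3 * N * Sa * Sb) * L" using N0 by (simp add: power3_eq_cube)
      finally show ?thesis .
    qed
    have lip: "W.lip (4 * pi / N * So) O'"
      unfolding O'_def So_def by (rule lip_wbounded[OF N0 wbounded_wseq[OF N0 c]])
    have s: "0 < s" using assms(6) n t by (simp add: zero_less_mult_iff)
    let ?X = "((\<lambda>Y. evol \<alpha> s (evol \<beta> s Y)) ^^ n) O'"
    have main: "norm (?X - evol (\<alpha> + \<beta>) t O') \<le> t * (32 * pi ^ 3 * N * Sa * Sb) * 4 ^ q * (4 * pi / N * So) * s"
      by (rule W.trotter_error[OF contr tame C0 P lip n_pos t s qs])
    also have "\<dots> = C * s" using N0 by (simp add: C_def power3_eq_cube power4_eq_xxxx)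
    finally have bound: "norm (?X - evol (\<alpha> + \<beta>) t O') \<le> C * s" .
    have rO: "rep N (op_N N ob) O'" unfolding O'_def by (rule rep_op_N[OF N c ob])
    have "rep N (trotter_evol h (op_N N a) (op_N N b) (op_N N ob) n s) ?X"
      unfolding trotter_evol_def funpow_evol \<alpha>_def \<beta>_def
      by (intro rep_comp rep_funpow rO exp_csc_rep A B N)
    moreover have "rep N (exact_evol h (op_plus (op_N N a) (op_N N b)) (op_N N ob) t) (evol (\<alpha> + \<beta>) t O')"
      unfolding exact_evol_def evol_def sum[symmetric]
      by (intro rep_comp rO exp_csc_rep rep_plus A B N)
    ultimately show ?thesis
      using op_norm_rep_le[OF N0 rep_minus] bound by (meson order_trans)
  qed
  thus ?thesis by blast
qed

end
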